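(* The complex manifold $R_3$ of degree-three holomorphic self-maps of $\mathbb P^1$ is holomorphically elliptic. In particular, it is Oka.
   Context: $R_d$ denotes the complex manifold of degree-$d$ holomorphic self-maps of $\mathbb P^1$ over $\mathbb C$. Equivalently, a point of $R_d$ is represented by a pair $[p:q]$ of binary forms of degree $d$ without a common zero, modulo simultaneous nonzero scaling; thus $R_d$ is the Zariski-open subset of $\mathbb P^{2d+1}$ where the resultant of $p$ and $q$ is nonzero. A holomorphic spray on a complex manifold $M$ is a triple $(V,\pi,s)$, where $\pi:V\to M$ is a holomorphic vector bundle and $s:V\to M$ is a holomorphic map with $s(0_x)=x$ for all $x\in M$. It is dominating if $(ds)_{0_x}|_{V_x}:V_x\to T_xM$ is surjective for every $x\in M$. $M$ is holomorphically elliptic if it admits a dominating holomorphic spray. A complex manifold $M$ is Oka if for every $N\geqslant1$ and every compact convex set $K\subset\mathbb C^N$, every holomorphic map from a neighbourhood of $K$ to $M$ can be approximated uniformly on $K$ by holomorphic maps $\mathbb C^N\to M$. *)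

theory Defs
  imports "HOL-Analysis.Analysis"
begin

subsection \<open>Complex coordinate spaces\<close>

text \<open>The dimension \<open>n\<close> of \<open>\<complex>\<^sup>n\<close> has to be quantified over inside definitions (bundle ranks, the
  source dimension in the Oka property), so it is not a type.  As for the library's
  \<open>Euclidean_space\<close>, the elements of \<open>\<complex>\<^sup>n\<close> are the sequences that vanish from index \<open>n\<close> on, with
  the topology inherited from the product topology.\<close>

definition Cset :: "nat \<Rightarrow> (nat \<Rightarrow> complex) set" where
  "Cset n = {z. \<forall>i\<ge>n. z i = 0}"

definition Ctop :: "nat \<Rightarrow> (nat \<Rightarrow> complex) topology" where
  "Ctop n = top_of_set (Cset n)"

definition cnorm :: "nat \<Rightarrow> (nat \<Rightarrow> complex) \<Rightarrow> real" where
  "cnorm n z = L2_set (\<lambda>i. cmod (z i)) {..<n}"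

definition Cconvex :: "(nat \<Rightarrow> complex) set \<Rightarrow> bool" where
  "Cconvex K \<longleftrightarrow> (\<forall>z\<in>K. \<forall>w\<in>K. \<forall>t::real. 0 \<le> t \<and> t \<le> 1 \<longrightarrow>
     (\<lambda>i. of_real (1 - t) * z i + of_real t * w i) \<in> K)"

text \<open>Complex Frechet differentiability at every point of a (relatively open) set \<open>S \<subseteq> \<complex>\<^sup>n\<close>; the
  matrix \<open>A\<close> is the complex derivative.\<close>

definition holo_on :: "nat \<Rightarrow> nat \<Rightarrow> (nat \<Rightarrow> complex) set \<Rightarrow> ((nat \<Rightarrow> complex) \<Rightarrow> nat \<Rightarrow> complex) \<Rightarrow> bool"
  where
  "holo_on n m S F \<longleftrightarrow> F ` S \<subseteq> Cset m \<and>
     (\<forall>z\<in>S. \<exists>A :: nat \<Rightarrow> nat \<Rightarrow> complex. \<forall>\<epsilon>>0. \<exists>\<delta>>0. \<forall>w\<in>S. cnorm n (w - z) < \<delta> \<longrightarrow>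
        cnorm m (\<lambda>j. F w j - F z j - (\<Sum>i<n. A j i * (w i - z i))) \<le> \<epsilon> * cnorm n (w - z))"

definition jacobian :: "((nat \<Rightarrow> complex) \<Rightarrow> nat \<Rightarrow> complex) \<Rightarrow> (nat \<Rightarrow> complex) \<Rightarrow> nat \<Rightarrow> nat \<Rightarrow> complex"
  where
  "jacobian F z j i = deriv (\<lambda>t. F (z(i := t)) j) (z i)"


subsection \<open>Complex manifolds and holomorphic maps\<close>

type_synonym 'a cchart = "'a set \<times> ('a \<Rightarrow> nat \<Rightarrow> complex)"

record 'a cmanifold =
  cm_top :: "'a topology"
  cm_dim :: nat
  cm_atlas :: "'a cchart set"

text \<open>The map \<open>G \<circ> \<phi>\<^sup>-\<^sup>1\<close> for a chart \<open>c = (U, \<phi>)\<close>.\<close>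

definition in_chart :: "'a cchart \<Rightarrow> ('a \<Rightarrow> 'b) \<Rightarrow> (nat \<Rightarrow> complex) \<Rightarrow> 'b" where
  "in_chart c G = G \<circ> inv_into (fst c) (snd c)"

definition complex_manifold :: "'a cmanifold \<Rightarrow> bool" where
  "complex_manifold M \<longleftrightarrow>
     Hausdorff_space (cm_top M) \<and> second_countable (cm_top M) \<and>
     (\<Union>c\<in>cm_atlas M. fst c) = topspace (cm_top M) \<and>
     (\<forall>(U, \<phi>)\<in>cm_atlas M. openin (cm_top M) U \<and> openin (Ctop (cm_dim M)) (\<phi> ` U) \<and>
        homeomorphic_map (subtopology (cm_top M) U) (subtopology (Ctop (cm_dim M)) (\<phi> ` U)) \<phi>) \<and>
     (\<forall>c\<in>cm_atlas M. \<forall>d\<in>cm_atlas M.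
        holo_on (cm_dim M) (cm_dim M) (snd c ` (fst c \<inter> fst d)) (in_chart c (snd d)))"

definition holomorphic_map :: "'a cmanifold \<Rightarrow> 'b cmanifold \<Rightarrow> ('a \<Rightarrow> 'b) \<Rightarrow> bool" where
  "holomorphic_map M N f \<longleftrightarrow> continuous_map (cm_top M) (cm_top N) f \<and>
     (\<forall>c\<in>cm_atlas M. \<forall>d\<in>cm_atlas N.
        holo_on (cm_dim M) (cm_dim N) (snd c ` {x \<in> fst c. f x \<in> fst d}) (in_chart c (snd d \<circ> f)))"

definition biholomorphic_map :: "'a cmanifold \<Rightarrow> 'b cmanifold \<Rightarrow> ('a \<Rightarrow> 'b) \<Rightarrow> bool" where
  "biholomorphic_map M N f \<longleftrightarrow> holomorphic_map M N f \<and>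
     (\<exists>g. holomorphic_map N M g \<and> (\<forall>x\<in>topspace (cm_top M). g (f x) = x) \<and>
          (\<forall>y\<in>topspace (cm_top N). f (g y) = y))"

text \<open>The manifold structure induced on an open subset \<open>W\<close>.\<close>

definition open_submanifold :: "'a cmanifold \<Rightarrow> 'a set \<Rightarrow> 'a cmanifold" where
  "open_submanifold M W =
     \<lparr>cm_top = subtopology (cm_top M) W, cm_dim = cm_dim M,
      cm_atlas = (\<lambda>(U, \<phi>). (U \<inter> W, \<phi>)) ` cm_atlas M\<rparr>"

definition product_manifold :: "'a cmanifold \<Rightarrow> 'b cmanifold \<Rightarrow> ('a \<times> 'b) cmanifold" where
  "product_manifold M N =
     \<lparr>cm_top = prod_topology (cm_top M) (cm_top N), cm_dim = cm_dim M + cm_dim N,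
      cm_atlas = {(U \<times> W, \<lambda>(x, y) i. if i < cm_dim M then \<phi> x i else \<psi> y (i - cm_dim M)) | U \<phi> W \<psi>.
         (U, \<phi>) \<in> cm_atlas M \<and> (W, \<psi>) \<in> cm_atlas N}\<rparr>"

definition complex_space :: "nat \<Rightarrow> (nat \<Rightarrow> complex) cmanifold" where
  "complex_space n = \<lparr>cm_top = Ctop n, cm_dim = n, cm_atlas = {(Cset n, id)}\<rparr>"


subsection \<open>Tangent spaces and differentials\<close>

definition charts_at :: "'a cmanifold \<Rightarrow> 'a \<Rightarrow> 'a cchart set" where
  "charts_at M x = {c \<in> cm_atlas M. x \<in> fst c}"

text \<open>A (holomorphic) tangent vector at \<open>x\<close> assigns to each chart at \<open>x\<close> its coordinate vector, the
  coordinate vectors being related by the Jacobian matrices of the transition maps.  Elsewhere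
  it takes the dummy value \<open>0\<close>.\<close>

definition tangent_space :: "'a cmanifold \<Rightarrow> 'a \<Rightarrow> ('a cchart \<Rightarrow> nat \<Rightarrow> complex) set" where
  "tangent_space M x = {v.
     (\<forall>c\<in>charts_at M x. v c \<in> Cset (cm_dim M)) \<and>
     (\<forall>c\<in>charts_at M x. \<forall>d\<in>charts_at M x. \<forall>j<cm_dim M.
        v d j = (\<Sum>i<cm_dim M. jacobian (in_chart c (snd d)) (snd c x) j i * v c i)) \<and>
     (\<forall>c. c \<notin> charts_at M x \<longrightarrow> v c = (\<lambda>_. 0))}"

text \<open>The differential of \<open>f\<close> at \<open>x\<close>, as a map from \<open>tangent_space M x\<close> to \<open>tangent_space N (f x)\<close>.
  By the chain rule, the choice of the chart \<open>c\<close> at \<open>x\<close> does not matter.\<close>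

definition differential ::
  "'a cmanifold \<Rightarrow> 'b cmanifold \<Rightarrow> ('a \<Rightarrow> 'b) \<Rightarrow> 'a \<Rightarrow> ('a cchart \<Rightarrow> nat \<Rightarrow> complex) \<Rightarrow>
     'b cchart \<Rightarrow> nat \<Rightarrow> complex" where
  "differential M N f x v d =
     (if d \<in> charts_at N (f x) then
        let c = (SOME c. c \<in> charts_at M x) in
        (\<lambda>j. if j < cm_dim N
             then \<Sum>i<cm_dim M. jacobian (in_chart c (snd d \<circ> f)) (snd c x) j i * v c i else 0)
      else (\<lambda>_. 0))"

text \<open>The velocity at time \<open>0\<close> of a holomorphic curve \<open>\<gamma>\<close> defined near \<open>0 \<in> \<complex>\<close>.\<close>

definition velocity :: "'a cmanifold \<Rightarrow> (complex \<Rightarrow> 'a) \<Rightarrow> 'a cchart \<Rightarrow> nat \<Rightarrow> complex" where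
  "velocity M \<gamma> c = (if c \<in> charts_at M (\<gamma> 0) then (\<lambda>j. deriv (\<lambda>t. snd c (\<gamma> t) j) 0) else (\<lambda>_. 0))"


subsection \<open>Vector bundles, sprays, ellipticity\<close>

record ('a, 'b) cbundle =
  vb_total :: "'b cmanifold"
  vb_proj :: "'b \<Rightarrow> 'a"
  vb_rank :: nat
  vb_zero :: "'a \<Rightarrow> 'b"
  vb_add :: "'b \<Rightarrow> 'b \<Rightarrow> 'b"
  vb_scale :: "complex \<Rightarrow> 'b \<Rightarrow> 'b"

definition fibre :: "('a, 'b) cbundle \<Rightarrow> 'a \<Rightarrow> 'b set" where
  "fibre E x = {e \<in> topspace (cm_top (vb_total E)). vb_proj E e = x}"

definition local_trivialization ::
  "'a cmanifold \<Rightarrow> ('a, 'b) cbundle \<Rightarrow> 'a set \<Rightarrow> ('b \<Rightarrow> 'a \<times> (nat \<Rightarrow> complex)) \<Rightarrow> bool" where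
  "local_trivialization M E U \<theta> \<longleftrightarrow>
     biholomorphic_map
       (open_submanifold (vb_total E) (\<Union>x\<in>U. fibre E x))
       (product_manifold (open_submanifold M U) (complex_space (vb_rank E))) \<theta> \<and>
     (\<forall>x\<in>U. (\<forall>e\<in>fibre E x. fst (\<theta> e) = x) \<and>
        snd (\<theta> (vb_zero E x)) = (\<lambda>_. 0) \<and>
        (\<forall>e\<in>fibre E x. \<forall>e'\<in>fibre E x. snd (\<theta> (vb_add E e e')) = (\<lambda>i. snd (\<theta> e) i + snd (\<theta> e') i)) \<and>
        (\<forall>a. \<forall>e\<in>fibre E x. snd (\<theta> (vb_scale E a e)) = (\<lambda>i. a * snd (\<theta> e) i)))"

text \<open>The vector space axioms for the fibres are not listed: they hold because trivializations
  restrict to bijections of the fibres with \<open>\<complex>\<^sup>r\<close> that carry the fibre operations to those of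
  \<open>\<complex>\<^sup>r\<close>.\<close>

definition holomorphic_vector_bundle :: "'a cmanifold \<Rightarrow> ('a, 'b) cbundle \<Rightarrow> bool" where
  "holomorphic_vector_bundle M E \<longleftrightarrow>
     complex_manifold M \<and> complex_manifold (vb_total E) \<and>
     holomorphic_map (vb_total E) M (vb_proj E) \<and>
     (\<forall>x\<in>topspace (cm_top M).
        vb_zero E x \<in> fibre E x \<and>
        (\<forall>e\<in>fibre E x. \<forall>e'\<in>fibre E x. vb_add E e e' \<in> fibre E x) \<and>
        (\<forall>a. \<forall>e\<in>fibre E x. vb_scale E a e \<in> fibre E x)) \<and>
     (\<forall>x\<in>topspace (cm_top M). \<exists>U \<theta>. openin (cm_top M) U \<and> x \<in> U \<and> local_trivialization M E U \<theta>)"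

definition holomorphic_spray :: "'a cmanifold \<Rightarrow> ('a, 'b) cbundle \<Rightarrow> ('b \<Rightarrow> 'a) \<Rightarrow> bool" where
  "holomorphic_spray M E s \<longleftrightarrow> holomorphic_vector_bundle M E \<and> holomorphic_map (vb_total E) M s \<and>
     (\<forall>x\<in>topspace (cm_top M). s (vb_zero E x) = x)"

text \<open>The inclusion \<open>V\<^sub>x \<subseteq> T\<^bsub>0\<^sub>x\<^esub> V\<close> sends \<open>e\<close> to the velocity of the curve \<open>t \<mapsto> t e\<close> at \<open>t = 0\<close>.\<close>

definition vertical_vector :: "('a, 'b) cbundle \<Rightarrow> 'b \<Rightarrow> 'b cchart \<Rightarrow> nat \<Rightarrow> complex" where
  "vertical_vector E e = velocity (vb_total E) (\<lambda>t. vb_scale E t e)"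

definition dominating_spray :: "'a cmanifold \<Rightarrow> ('a, 'b) cbundle \<Rightarrow> ('b \<Rightarrow> 'a) \<Rightarrow> bool" where
  "dominating_spray M E s \<longleftrightarrow> holomorphic_spray M E s \<and>
     (\<forall>x\<in>topspace (cm_top M).
        (\<lambda>e. differential (vb_total E) M s (vb_zero E x) (vertical_vector E e)) ` fibre E x
          = tangent_space M x)"

text \<open>Fixing the type of the points of the total space is no restriction: choosing a basis in each
  fibre of a bundle \<open>V \<rightarrow> M\<close> of rank \<open>r\<close> gives a bijection from \<open>V\<close> to \<open>M \<times> \<complex>\<^sup>r\<close>, along which the
  structure of \<open>V\<close> can be transported.\<close>

definition holomorphically_elliptic :: "'a cmanifold \<Rightarrow> bool" where
  "holomorphically_elliptic M \<longleftrightarrow> complex_manifold M \<and>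
     (\<exists>(E :: ('a, 'a \<times> (nat \<Rightarrow> complex)) cbundle) s. dominating_spray M E s)"


subsection \<open>Oka manifolds\<close>

text \<open>Uniform approximation on the compact set \<open>K\<close> is required for every metric \<open>D\<close> that induces the
  topology of the manifold; since \<open>f ` K\<close> is compact, all such metrics give the same notion.\<close>

definition Oka_manifold :: "'a cmanifold \<Rightarrow> bool" where
  "Oka_manifold M \<longleftrightarrow> complex_manifold M \<and>
     (\<forall>N\<ge>1. \<forall>K. compactin (Ctop N) K \<and> Cconvex K \<longrightarrow>
        (\<forall>U f. openin (Ctop N) U \<and> K \<subseteq> U \<and>
               holomorphic_map (open_submanifold (complex_space N) U) M f \<longrightarrow>
           (\<forall>D :: 'a metric. mtopology_of D = cm_top M \<longrightarrow>
              (\<forall>\<epsilon>>0. \<exists>g. holomorphic_map (complex_space N) M g \<and>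
                 (\<forall>z\<in>K. mdist D (f z) (g z) < \<epsilon>)))))"


subsection \<open>Projective space and the spaces of rational maps\<close>

definition proj_point :: "(nat \<Rightarrow> complex) \<Rightarrow> (nat \<Rightarrow> complex) set" where
  "proj_point z = {(\<lambda>i. a * z i) | a. a \<noteq> 0}"

definition proj_points :: "nat \<Rightarrow> (nat \<Rightarrow> complex) set set" where
  "proj_points n = proj_point ` (Cset (Suc n) - {\<lambda>_. 0})"

text \<open>The quotient topology of \<open>\<complex>\<^sup>n\<^sup>+\<^sup>1 \<setminus> {0} \<rightarrow> P\<^sup>n\<close>.\<close>

definition proj_top :: "nat \<Rightarrow> (nat \<Rightarrow> complex) set topology" where
  "proj_top n = topology (\<lambda>W. W \<subseteq> proj_points n \<and>
     openin (Ctop (Suc n)) {z \<in> Cset (Suc n) - {\<lambda>_. 0}. proj_point z \<in> W})"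

text \<open>The affine chart on \<open>{z\<^sub>k \<noteq> 0}\<close>, given by the quotients \<open>z\<^sub>j / z\<^sub>k\<close> with \<open>j \<noteq> k\<close> in increasing
  order of \<open>j\<close>.\<close>

definition affine_chart :: "nat \<Rightarrow> nat \<Rightarrow> (nat \<Rightarrow> complex) set cchart" where
  "affine_chart n k =
     (proj_point ` {z \<in> Cset (Suc n). z k \<noteq> 0},
      \<lambda>L. let z = (SOME z. z \<in> L) in (\<lambda>j. z (if j < k then j else Suc j) / z k))"

definition projective_space :: "nat \<Rightarrow> (nat \<Rightarrow> complex) set cmanifold" where
  "projective_space n = \<lparr>cm_top = proj_top n, cm_dim = n, cm_atlas = affine_chart n ` {..n}\<rparr>"

text \<open>The value at \<open>(x, y)\<close> of the binary form of degree \<open>d\<close> with coefficients \<open>a\<^sub>0, \<dots>, a\<^sub>d\<close>.\<close>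

definition binary_form :: "nat \<Rightarrow> (nat \<Rightarrow> complex) \<Rightarrow> complex \<Rightarrow> complex \<Rightarrow> complex" where
  "binary_form d a x y = (\<Sum>i\<le>d. a i * x ^ i * y ^ (d - i))"

definition no_common_zero :: "nat \<Rightarrow> (nat \<Rightarrow> complex) \<Rightarrow> (nat \<Rightarrow> complex) \<Rightarrow> bool" where
  "no_common_zero d p q \<longleftrightarrow>
     \<not> (\<exists>x y. (x, y) \<noteq> (0, 0) \<and> binary_form d p x y = 0 \<and> binary_form d q x y = 0)"

text \<open>The point \<open>[p : q]\<close> of the projective space of dimension \<open>2 d + 1\<close>: the coefficients of \<open>p\<close> come first, followed
  by those of \<open>q\<close>.\<close>

definition pair_point :: "nat \<Rightarrow> (nat \<Rightarrow> complex) \<Rightarrow> (nat \<Rightarrow> complex) \<Rightarrow> (nat \<Rightarrow> complex) set" where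
  "pair_point d p q = proj_point (\<lambda>i. if i \<le> d then p i else q (i - Suc d))"

text \<open>The space of degree \<open>d\<close> holomorphic self-maps of \<open>P\<^sup>1\<close>: the point \<open>[p : q]\<close> stands for the map
  \<open>[x : y] \<mapsto> [p(x, y) : q(x, y)]\<close>.\<close>

definition rational_map_space :: "nat \<Rightarrow> (nat \<Rightarrow> complex) set cmanifold" where
  "rational_map_space d = open_submanifold (projective_space (2 * d + 1))
     {pair_point d p q | p q. p \<in> Cset (Suc d) \<and> q \<in> Cset (Suc d) \<and> no_common_zero d p q}"

end

theory Submission
  imports Defs "HOL-Complex_Analysis.Complex_Analysis" "HOL-Computational_Algebra.Fundamental_Theorem_Algebra"
    "HOL-Computational_Algebra.Field_as_Ring" "HOL-Computational_Algebra.Polynomial_Factorial"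
begin

text \<open>Write \<open>R\<close> for the space of cubic rational maps and \<open>X \<subseteq> \<complex>\<^sup>8\<close> (\<open>map_cone\<close>) for the open cone of the pairs
  \<open>v = (p, q)\<close> of binary cubic forms without a common zero, so that \<open>R\<close> is the quotient of \<open>X\<close> by
  nonzero scaling.  Everything rests on one holomorphic map \<open>S : X \<times> \<complex>\<^sup>8 \<rightarrow> X\<close> (\<open>cone_spray\<close>) that
  behaves like the addition \<open>v + r\<close> to first order in \<open>r\<close> and satisfies \<open>S(c v, c r) = c S(v, r)\<close>.

  The map \<open>S\<close> first moves \<open>p\<close> with \<open>q\<close> fixed.  The cubic forms modulo \<open>q\<close> are a free module of rank one
  over the ring \<open>A\<close> of functions on the zero scheme of \<open>q\<close>, and \<open>p\<close> is coprime to \<open>q\<close> iff it generates this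
  module.  Hence \<open>exp(h) p\<close> is again coprime to \<open>q\<close> for every \<open>h\<close> in \<open>A\<close>.  Multiplications by elements of
  \<open>A\<close> lift to endomorphisms of the space of cubic forms that depend linearly on \<open>q\<close>: with the Bezoutian
  \<open>B(f, q)(x, \<eta>) = (f(x) q(\<eta>) - f(\<eta>) q(x)) / (x - \<eta>)\<close>, contract \<open>\<eta>\<close> with a vector and multiply the
  resulting quadratic form by a linear form (\<open>bez_op\<close>).  At a zero of \<open>q\<close>, evaluation is a left
  eigenvector of such an operator, and therefore of its exponential, so no common zero can appear
  (\<open>bez_det_flow\<close>).  When \<open>p\<close> and \<open>q\<close> are coprime the Bezout matrix is invertible
  (\<open>bez_det_nonzero_iff\<close>), so that these operators move \<open>p\<close> in every prescribed direction
  (\<open>bez_op_solve\<close>).  Then the roles of \<open>p\<close> and \<open>q\<close> are exchanged.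

  Ellipticity: on the trivial bundle of \<open>8 \<times> 8\<close> matrices put \<open>s([v], E) = [S(v, E v)]\<close>.  Homogeneity makes
  this well defined, and it is dominating because \<open>E \<mapsto> E v\<close> maps onto \<open>\<complex>\<^sup>8\<close> (\<open>dominating_spray_RM\<close>).

  Oka property: let \<open>f\<close> be holomorphic near the compact convex set \<open>K\<close>; after a translation, the
  origin lies in \<open>K\<close>.  Along the homotopy \<open>f(t z)\<close> from a constant map to \<open>f\<close>, the map lifts to \<open>F\<close> with values in \<open>X\<close>, in small
  steps, since a lift at time \<open>t\<close> selects representatives of all nearby lines (\<open>global_lift\<close>).  For
  a fine subdivision of \<open>[0, 1]\<close>, an entire map \<open>v\<^sub>i\<close> into \<open>X\<close> close to \<open>F(t\<^sub>i z)\<close> on \<open>K\<close> is replaced by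
  \<open>S(v\<^sub>i, g - v\<^sub>i)\<close>, where \<open>g\<close> is an entire map into \<open>\<complex>\<^sup>8\<close> close to \<open>F(t\<^sub>i\<^sub>+\<^sub>1 z)\<close> on \<open>K\<close>.  The value is again in \<open>X\<close>,
  and \<open>S(v, r) - v - r\<close> is of second order in \<open>r\<close>, so that the error does not grow from step to step
  (\<open>approximation_in_cone\<close>).  The maps \<open>g\<close> come from a Runge theorem for starlike compact sets
  (\<open>Runge_starlike\<close>).\<close>

section \<open>Holomorphic functions of several variables\<close>

lemma coord_le_cnorm: "i < n \<Longrightarrow> cmod (z i) \<le> cnorm n z"
  unfolding cnorm_def by (rule member_le_L2_set) auto

lemma cnorm_nonneg [simp]: "0 \<le> cnorm n z"
  unfolding cnorm_def by simp

lemma cnorm_le_bound: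
  assumes "\<And>j. j < n \<Longrightarrow> cmod (z j) \<le> b"
  shows "cnorm n z \<le> real n * b"
proof -
  have "cnorm n z \<le> (\<Sum>i<n. cmod (z i))"
    unfolding cnorm_def by (rule L2_set_le_sum) auto
  also have "\<dots> \<le> (\<Sum>i<n. b)"
    using assms by (intro sum_mono) auto
  finally show ?thesis by simp
qed

lemma Cset_diff_zero: "u \<in> Cset n \<Longrightarrow> v \<in> Cset n \<Longrightarrow> \<not> j < n \<Longrightarrow> u j - v j = 0"
  by (simp add: Cset_def)

lemma Cset_upd [simp]: "z \<in> Cset n \<Longrightarrow> i < n \<Longrightarrow> z(i := t) \<in> Cset n"
  by (auto simp: Cset_def)

lemma zero_in_Cset [simp]: "(\<lambda>_. 0) \<in> Cset n"
  by (simp add: Cset_def)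

text \<open>The distance of the type of functions is a series over an unspecified enumeration of the indices;
  as the coordinates from \<open>n\<close> on vanish, a bound for the first \<open>n\<close> ones controls all its terms.\<close>

lemma dist_le_coords:
  assumes "u \<in> Cset n" "v \<in> Cset n" "\<And>j. j < n \<Longrightarrow> cmod (u j - v j) \<le> b" "0 \<le> b"
  shows "dist u v \<le> 2 * b"
proof (rule field_le_epsilon)
  fix e :: real assume "0 < e"
  then obtain N where N: "(1/2::real) ^ N < e"
    using real_arch_pow_inv[of e "1/2"] by auto
  have c: "dist (u k) (v k) \<le> b" for k
    using assms Cset_diff_zero[OF assms(1,2), of k] by (cases "k < n") (auto simp: dist_norm)
  have "Max {dist (u (from_nat n)) (v (from_nat n))|n. n \<le> N} \<le> b"
    using c by (subst Max_le_iff) (auto simp: setcompr_eq_image)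
  then show "dist u v \<le> 2 * b + e"
    using dist_fun_le_dist_first_terms[of u v N] N by linarith
qed

lemma openin_Ctop_coords:
  "openin (Ctop n) S \<longleftrightarrow> S \<subseteq> Cset n \<and>
     (\<forall>z\<in>S. \<exists>\<delta>>0. \<forall>w\<in>Cset n. (\<forall>j<n. cmod (w j - z j) < \<delta>) \<longrightarrow> w \<in> S)"
proof (intro iffI conjI ballI)
  assume S: "openin (Ctop n) S"
  then show sub: "S \<subseteq> Cset n"
    using openin_subset by (fastforce simp: Ctop_def)
  fix z assume z: "z \<in> S"
  from S obtain T where T: "open T" "S = Cset n \<inter> T"
    unfolding Ctop_def by (auto simp: openin_open)
  then obtain e where e: "e > 0" "ball z e \<subseteq> T"
    using z openE by blast
  show "\<exists>\<delta>>0. \<forall>w\<in>Cset n. (\<forall>j<n. cmod (w j - z j) < \<delta>) \<longrightarrow> w \<in> S"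
  proof (intro exI[of _ "e/4"] conjI ballI impI)
    fix w assume w: "w \<in> Cset n" "\<forall>j<n. cmod (w j - z j) < e/4"
    have "dist w z \<le> 2 * (e/4)"
      using w sub z e by (intro dist_le_coords[where n = n]) (auto intro: less_imp_le)
    then show "w \<in> S" using e T w by (auto simp: dist_commute)
  qed (use e in auto)
next
  assume A: "S \<subseteq> Cset n \<and>
     (\<forall>z\<in>S. \<exists>\<delta>>0. \<forall>w\<in>Cset n. (\<forall>j<n. cmod (w j - z j) < \<delta>) \<longrightarrow> w \<in> S)"
  then obtain d where d: "\<And>z. z \<in> S \<Longrightarrow> d z > 0"
     "\<And>z w. z \<in> S \<Longrightarrow> w \<in> Cset n \<Longrightarrow> (\<forall>j<n. cmod (w j - z j) < d z) \<Longrightarrow> w \<in> S"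
    by metis
  define T where "T = (\<Union>z\<in>S. \<Inter>j<n. {w. cmod (w j - z j) < d z})"
  have "open T" unfolding T_def
  proof (intro open_UN open_INT ballI)
    show "open {w. cmod (w j - z j) < d z}" for j and z :: "nat \<Rightarrow> complex"
      by (intro open_Collect_less continuous_intros) simp_all
  qed auto
  moreover have "S = Cset n \<inter> T"
    using A d unfolding T_def by (auto 4 4)
  ultimately show "openin (Ctop n) S"
    unfolding Ctop_def by (auto simp: openin_open)
qed

lemma openin_Ctop_nbhd:
  assumes "openin (Ctop n) S" "z \<in> S"
  obtains \<delta> where "\<delta> > 0" "\<And>w. w \<in> Cset n \<Longrightarrow> (\<And>j. j < n \<Longrightarrow> cmod (w j - z j) < \<delta>) \<Longrightarrow> w \<in> S"
  using assms unfolding openin_Ctop_coords by metis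

lemma openin_Ctop_subset: "openin (Ctop n) S \<Longrightarrow> S \<subseteq> Cset n"
  by (simp add: openin_Ctop_coords)

lemma openin_Ctop_UNIV [simp]: "openin (Ctop n) (Cset n)"
  by (simp add: openin_Ctop_coords gt_ex)

lemma openin_polydisc:
  assumes "z \<in> Cset n"
  shows "openin (Ctop n) {w \<in> Cset n. \<forall>j<n. cmod (w j - z j) < r}"
proof -
  have "open (\<Inter>j<n. {w :: nat \<Rightarrow> complex. cmod (w j - z j) < r})"
    by (intro open_INT ballI open_Collect_less continuous_intros) simp_all
  moreover have "{w \<in> Cset n. \<forall>j<n. cmod (w j - z j) < r} = Cset n \<inter> (\<Inter>j<n. {w. cmod (w j - z j) < r})"
    by auto
  ultimately show ?thesis unfolding Ctop_def by (auto simp: openin_open)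
qed

lemma open_line_section:
  assumes S: "openin (Ctop n) S" and z: "z \<in> Cset n" and i: "i < n"
  shows "open {t. z(i := t) \<in> S}"
  unfolding open_contains_ball
proof
  fix t assume "t \<in> {t. z(i := t) \<in> S}"
  then have t: "z(i := t) \<in> S" by simp
  obtain d where d: "d > 0" "\<And>w. w \<in> Cset n \<Longrightarrow> (\<And>j. j < n \<Longrightarrow> cmod (w j - (z(i := t)) j) < d) \<Longrightarrow> w \<in> S"
    using openin_Ctop_nbhd[OF S t] by metis
  have "ball t d \<subseteq> {t. z(i := t) \<in> S}"
  proof
    fix s assume "s \<in> ball t d"
    then have "z(i := s) \<in> S"
      using z i d(1) by (intro d(2)) (auto simp: dist_norm norm_minus_commute)
    then show "s \<in> {t. z(i := t) \<in> S}" by simp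
  qed
  then show "\<exists>e>0. ball t e \<subseteq> {t. z(i := t) \<in> S}"
    using d(1) by blast
qed

text \<open>Continuity together with partial complex differentiability is easier to establish than Frechet
  differentiability, since it passes to sums, products and uniform limits coordinate by coordinate;
  the two notions agree by \<open>holo_on_iff_hol_fun\<close>.\<close>

definition hol_fun :: "nat \<Rightarrow> (nat \<Rightarrow> complex) set \<Rightarrow> ((nat \<Rightarrow> complex) \<Rightarrow> complex) \<Rightarrow> bool" where
  "hol_fun n S f \<longleftrightarrow> continuous_on S f \<and>
     (\<forall>z\<in>S. \<forall>i<n. (\<lambda>t. f (z(i := t))) field_differentiable at (z i))"

lemma hol_fun_cont: "hol_fun n S f \<Longrightarrow> continuous_on S f"
  by (simp add: hol_fun_def)

lemma hol_fun_line:
  assumes "hol_fun n S f" "i < n"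
  shows "(\<lambda>t. f (z(i := t))) holomorphic_on {t. z(i := t) \<in> S}"
proof -
  have "(\<lambda>t. f (z(i := t))) field_differentiable at t" if "z(i := t) \<in> S" for t
  proof -
    have "(\<lambda>s. f ((z(i := t))(i := s))) field_differentiable at ((z(i := t)) i)"
      using assms that unfolding hol_fun_def by blast
    then show ?thesis by simp
  qed
  then show ?thesis
    by (auto simp: holomorphic_on_def intro: field_differentiable_at_within)
qed

lemma hol_fun_subset: "hol_fun n S f \<Longrightarrow> T \<subseteq> S \<Longrightarrow> hol_fun n T f"
  by (auto simp: hol_fun_def intro: continuous_on_subset)

lemma hol_fun_const [simp]: "hol_fun n S (\<lambda>_. c)"
  by (simp add: hol_fun_def)

lemma hol_fun_coord [simp]: "hol_fun n S (\<lambda>z. z j)"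
proof -
  have "(\<lambda>t. (z(i := t)) j) field_differentiable at (z i)" for z :: "nat \<Rightarrow> complex" and i
  proof (cases "j = i")
    case True
    then have "(\<lambda>t. (z(i := t)) j) = (\<lambda>t. t)" by auto
    then show ?thesis by (simp only: field_differentiable_ident)
  next
    case False
    then have "(\<lambda>t. (z(i := t)) j) = (\<lambda>t. z j)" by auto
    then show ?thesis by (simp only: field_differentiable_const)
  qed
  moreover have "continuous_on S (\<lambda>z::nat \<Rightarrow> complex. z j)"
    by (rule continuous_on_subset[OF continuous_on_product_coordinates subset_UNIV])
  ultimately show ?thesis unfolding hol_fun_def by blast
qed

lemma hol_fun_add: "hol_fun n S f \<Longrightarrow> hol_fun n S g \<Longrightarrow> hol_fun n S (\<lambda>z. f z + g z)"
  unfolding hol_fun_def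
  by (intro conjI ballI allI impI continuous_on_add field_differentiable_add) simp_all

lemma hol_fun_diff: "hol_fun n S f \<Longrightarrow> hol_fun n S g \<Longrightarrow> hol_fun n S (\<lambda>z. f z - g z)"
  unfolding hol_fun_def
  by (intro conjI ballI allI impI continuous_on_diff field_differentiable_diff) simp_all

lemma hol_fun_minus: "hol_fun n S f \<Longrightarrow> hol_fun n S (\<lambda>z. - f z)"
  unfolding hol_fun_def
  by (intro conjI ballI allI impI continuous_on_minus field_differentiable_minus) simp_all

lemma hol_fun_mult: "hol_fun n S f \<Longrightarrow> hol_fun n S g \<Longrightarrow> hol_fun n S (\<lambda>z. f z * g z)"
  unfolding hol_fun_def
  by (intro conjI ballI allI impI continuous_on_mult field_differentiable_mult) simp_all

lemma hol_fun_divide: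
  "hol_fun n S f \<Longrightarrow> hol_fun n S g \<Longrightarrow> (\<And>z. z \<in> S \<Longrightarrow> g z \<noteq> 0) \<Longrightarrow> hol_fun n S (\<lambda>z. f z / g z)"
  unfolding hol_fun_def
  by (intro conjI ballI allI impI continuous_on_divide field_differentiable_divide) auto

lemma hol_fun_sum: "(\<And>j. j \<in> I \<Longrightarrow> hol_fun n S (f j)) \<Longrightarrow> hol_fun n S (\<lambda>z. \<Sum>j\<in>I. f j z)"
  by (induction I rule: infinite_finite_induct) (auto intro: hol_fun_add)

lemmas hol_fun_intros = hol_fun_const hol_fun_coord hol_fun_add hol_fun_diff hol_fun_minus
  hol_fun_mult hol_fun_sum

lemma hol_fun_cong:
  assumes "hol_fun n S f" "openin (Ctop n) S" "\<And>z. z \<in> S \<Longrightarrow> f z = g z"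
  shows "hol_fun n S g"
  unfolding hol_fun_def
proof (intro conjI ballI allI impI)
  show "continuous_on S g"
    by (rule continuous_on_eq[OF hol_fun_cont[OF assms(1)] assms(3)])
  fix z i assume zi: "z \<in> S" "i < n"
  have zC: "z \<in> Cset n" using zi openin_Ctop_subset[OF assms(2)] by auto
  have d: "(\<lambda>t. f (z(i := t))) field_differentiable at (z i)"
    using assms(1) zi by (simp add: hol_fun_def)
  have "eventually (\<lambda>t. t \<in> {t. z(i := t) \<in> S}) (nhds (z i))"
    using open_line_section[OF assms(2) zC zi(2)] zi by (intro eventually_nhds_in_open) auto
  then have ev: "eventually (\<lambda>t. f (z(i := t)) = g (z(i := t))) (nhds (z i))"
    by (rule eventually_mono) (simp add: assms(3))
  obtain D where "((\<lambda>t. f (z(i := t))) has_field_derivative D) (at (z i))"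
    using d unfolding field_differentiable_def ..
  then have "((\<lambda>t. g (z(i := t))) has_field_derivative D) (at (z i))"
    by (rule iffD1[OF DERIV_cong_ev[OF refl ev refl]])
  then show "(\<lambda>t. g (z(i := t))) field_differentiable at (z i)"
    unfolding field_differentiable_def ..
qed

lemma hol_fun_local:
  assumes S: "openin (Ctop n) S"
    and loc: "\<And>z. z \<in> S \<Longrightarrow> \<exists>T. openin (Ctop n) T \<and> z \<in> T \<and> T \<subseteq> S \<and> hol_fun n T f"
  shows "hol_fun n S f"
  unfolding hol_fun_def
proof (intro conjI ballI allI impI)
  show "continuous_on S f"
    unfolding continuous_on_eq_continuous_within
  proof
    fix z assume z: "z \<in> S"
    obtain T where T: "openin (Ctop n) T" "z \<in> T" "T \<subseteq> S" "hol_fun n T f" using loc[OF z] by auto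
    obtain V where V: "open V" "T = Cset n \<inter> V" using T(1) unfolding Ctop_def openin_open by auto
    have "at z within S = at z within T"
    proof (rule at_within_nhd)
      show "z \<in> V" "open V" using V T by auto
      show "S \<inter> V - {z} = T \<inter> V - {z}" using V T openin_Ctop_subset[OF S] by blast
    qed
    moreover have "continuous (at z within T) f"
      using hol_fun_cont[OF T(4)] T(2) unfolding continuous_on_eq_continuous_within by blast
    ultimately show "continuous (at z within S) f" by simp
  qed
next
  fix z i assume zi: "z \<in> S" "i < n"
  then obtain T where "z \<in> T" "hol_fun n T f" using loc by blast
  then show "(\<lambda>t. f (z(i := t))) field_differentiable at (z i)"
    using zi unfolding hol_fun_def by blast
qed

lemma hol_fun_uniform_limit:
  assumes S: "openin (Ctop n) S" and f: "\<And>k::nat. hol_fun n S (f k)"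
    and lim: "uniform_limit S f g sequentially"
  shows "hol_fun n S g"
  unfolding hol_fun_def
proof (intro conjI ballI allI impI)
  show "continuous_on S g"
    by (rule uniform_limit_theorem[OF _ lim]) (simp_all add: hol_fun_cont[OF f])
  fix z i assume zi: "z \<in> S" "i < n"
  have zC: "z \<in> Cset n" using zi openin_Ctop_subset[OF S] by auto
  let ?U = "{t. z(i := t) \<in> S}"
  have U: "open ?U" by (rule open_line_section[OF S zC zi(2)])
  have "z i \<in> ?U" using zi by simp
  then obtain r where r: "r > 0" "cball (z i) r \<subseteq> ?U"
    using U open_contains_cball by blast
  have h: "(\<lambda>t. f k (z(i := t))) holomorphic_on ?U" for k
    by (rule hol_fun_line[OF f zi(2)])
  have u: "uniform_limit (cball (z i) r) (\<lambda>k t. f k (z(i := t))) (\<lambda>t. g (z(i := t))) sequentially"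
    unfolding uniform_limit_iff
  proof (intro allI impI)
    fix e :: real assume "0 < e"
    then have "\<forall>\<^sub>F k in sequentially. \<forall>x\<in>S. dist (f k x) (g x) < e"
      using lim unfolding uniform_limit_iff by blast
    then show "\<forall>\<^sub>F k in sequentially. \<forall>t\<in>cball (z i) r. dist (f k (z(i := t))) (g (z(i := t))) < e"
      by (rule eventually_mono) (use r(2) in blast)
  qed
  have "continuous_on (cball (z i) r) (\<lambda>t. f k (z(i := t)))"
    "(\<lambda>t. f k (z(i := t))) holomorphic_on ball (z i) r" for k
    using holomorphic_on_subset[OF h r(2)] holomorphic_on_subset[OF h subset_trans[OF ball_subset_cball r(2)]]
    by (auto intro: holomorphic_on_imp_continuous_on)
  then have "(\<lambda>t. g (z(i := t))) holomorphic_on ball (z i) r"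
    using holomorphic_uniform_limit[OF _ u] by simp
  then show "(\<lambda>t. g (z(i := t))) field_differentiable at (z i)"
    using r(1) by (simp add: holomorphic_on_imp_differentiable_at)
qed

definition has_cderiv ::
  "nat \<Rightarrow> (nat \<Rightarrow> complex) set \<Rightarrow> ((nat \<Rightarrow> complex) \<Rightarrow> complex) \<Rightarrow> (nat \<Rightarrow> complex) \<Rightarrow> (nat \<Rightarrow> complex) \<Rightarrow> bool"
  where "has_cderiv n S f z A \<longleftrightarrow> (\<forall>\<epsilon>>0. \<exists>\<delta>>0. \<forall>w\<in>S. cnorm n (w - z) < \<delta> \<longrightarrow>
     cmod (f w - f z - (\<Sum>i<n. A i * (w i - z i))) \<le> \<epsilon> * cnorm n (w - z))"

lemma compact_closed_polydisc:
  assumes "z \<in> Cset n"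
  shows "compact {w \<in> Cset n. \<forall>j<n. cmod (w j - z j) \<le> r}"
proof -
  have "{w \<in> Cset n. \<forall>j<n. cmod (w j - z j) \<le> r} =
     (\<Pi>\<^sub>E j\<in>UNIV. if j < n then cball (z j) r else {0})" (is "?L = ?P")
  proof (intro set_eqI)
    fix w
    have "w \<in> ?P \<longleftrightarrow> (\<forall>j. w j \<in> (if j < n then cball (z j) r else {0}))"
      by (simp add: PiE_UNIV_domain Pi_iff)
    also have "\<dots> \<longleftrightarrow> (\<forall>j\<ge>n. w j = 0) \<and> (\<forall>j<n. cmod (w j - z j) \<le> r)"
      by (metis dist_commute dist_norm linorder_not_le mem_cball singleton_iff)
    finally show "w \<in> ?L \<longleftrightarrow> w \<in> ?P" by (simp add: Cset_def)
  qed
  moreover have "compactin (product_topology (\<lambda>_. euclidean) UNIV) ?P"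
    by (subst compactin_PiE) auto
  ultimately show ?thesis by (simp add: euclidean_product_topology)
qed

text \<open>A form of Osgood's lemma.  Pass from \<open>z\<close> to \<open>w\<close> by changing one coordinate at a time.  By uniform
  continuity, the function of the coordinate being changed is uniformly close to its counterpart with
  the other coordinates frozen at \<open>z\<close>; by Cauchy's estimate so are their derivatives, hence their
  increments differ by a small multiple of the increment of the coordinate.\<close>

theorem hol_fun_has_cderiv:
  assumes S: "openin (Ctop n) S" and f: "hol_fun n S f" and z: "z \<in> S"
  shows "has_cderiv n S f z (\<lambda>i. deriv (\<lambda>t. f (z(i := t))) (z i))"
  unfolding has_cderiv_def
proof (intro allI impI)
  fix \<epsilon> :: real assume \<epsilon>: "\<epsilon> > 0"
  define A where "A = (\<lambda>i. deriv (\<lambda>t. f (z(i := t))) (z i))"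
  have zC: "z \<in> Cset n" using z openin_Ctop_subset[OF S] by auto
  obtain \<rho> where \<rho>: "\<rho> > 0" "\<And>w. w \<in> Cset n \<Longrightarrow> (\<And>j. j < n \<Longrightarrow> cmod (w j - z j) < \<rho>) \<Longrightarrow> w \<in> S"
    using openin_Ctop_nbhd[OF S z] by metis
  define r where "r = \<rho> / 2"
  have r: "r > 0" "r < \<rho>" using \<rho> by (auto simp: r_def)
  define P where "P = {w \<in> Cset n. \<forall>j<n. cmod (w j - z j) \<le> r}"
  have PS: "P \<subseteq> S" using \<rho>(2) r unfolding P_def by fastforce
  have "uniformly_continuous_on P f"
    using compact_closed_polydisc[OF zC, of r] continuous_on_subset[OF hol_fun_cont[OF f] PS]
    unfolding P_def by (intro compact_uniformly_continuous)
  define e where "e = \<epsilon> / (2 * (real n + 1))"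
  have e: "e > 0" using \<epsilon> by (simp add: e_def)
  have "e * r / 2 > 0" using e r by simp
  then obtain d where d: "d > 0" "\<And>x y. x \<in> P \<Longrightarrow> y \<in> P \<Longrightarrow> dist y x < d \<Longrightarrow> dist (f y) (f x) < e * r / 2"
    by (rule uniformly_continuous_onE[OF \<open>uniformly_continuous_on P f\<close>]) blast
  have Ad: "((\<lambda>t. f (z(i := t))) has_field_derivative A i) (at (z i))" if "i < n" for i
    using f z that unfolding hol_fun_def A_def DERIV_deriv_iff_field_differentiable by blast
  have "\<exists>\<delta>>0. \<forall>t. cmod (t - z i) < \<delta> \<longrightarrow>
        cmod (f (z(i := t)) - f z - A i * (t - z i)) \<le> e * cmod (t - z i)" if "i < n" for i
    using Ad[OF that] e unfolding has_field_derivative_def has_derivative_at_alt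
    by (simp add: mult.commute)
  then obtain \<delta>1 where \<delta>1: "\<And>i. i < n \<Longrightarrow> \<delta>1 i > 0"
     "\<And>i t. i < n \<Longrightarrow> cmod (t - z i) < \<delta>1 i \<Longrightarrow>
        cmod (f (z(i := t)) - f z - A i * (t - z i)) \<le> e * cmod (t - z i)"
    by metis
  define \<delta> where "\<delta> = Min (insert (r/2) (insert (d/4) (\<delta>1 ` {..<n})))"
  have \<delta>: "\<delta> > 0" "\<delta> \<le> r/2" "\<delta> \<le> d/4" "\<And>i. i < n \<Longrightarrow> \<delta> \<le> \<delta>1 i"
  proof -
    have "\<delta> \<le> x" if "x \<in> insert (r/2) (insert (d/4) (\<delta>1 ` {..<n}))" for x
      unfolding \<delta>_def by (rule Min_le[OF _ that]) simp
    then show "\<delta> \<le> r/2" "\<delta> \<le> d/4" "\<And>i. i < n \<Longrightarrow> \<delta> \<le> \<delta>1 i" by blast+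
    show "\<delta> > 0" unfolding \<delta>_def using \<delta>1(1) r d(1) by (subst Min_gr_iff) auto
  qed
  show "\<exists>\<delta>>0. \<forall>w\<in>S. cnorm n (w - z) < \<delta> \<longrightarrow>
      cmod (f w - f z - (\<Sum>i<n. deriv (\<lambda>t. f (z(i := t))) (z i) * (w i - z i))) \<le> \<epsilon> * cnorm n (w - z)"
  proof (intro exI[of _ \<delta>] conjI ballI impI \<delta>(1))
    fix w assume w: "w \<in> S" and wz: "cnorm n (w - z) < \<delta>"
    have wC: "w \<in> Cset n" using w openin_Ctop_subset[OF S] by auto
    have wj: "cmod (w j - z j) < \<delta>" if "j < n" for j
      using coord_le_cnorm[OF that, of "w - z"] wz by simp
    have wj': "cmod (w j - z j) \<le> r" if "j < n" for j
      using wj[OF that] \<delta>(2) r(1) by simp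
    \<comment> \<open>the points on the way from \<open>z = h 0\<close> to \<open>w = h n\<close>\<close>
    define h where "h = (\<lambda>i j. if j < i then w j else z j)"
    have hC: "h i \<in> Cset n" for i using wC zC by (auto simp: h_def Cset_def)
    have h0: "h 0 = z" by (auto simp: h_def)
    have hn: "h n = w" using wC zC by (auto simp: h_def Cset_def fun_eq_iff)
    have step: "cmod (f (h (Suc i)) - f (h i) - A i * (w i - z i)) \<le> 2 * e * cmod (w i - z i)"
      if i: "i < n" for i
    proof -
      \<comment> \<open>the difference from the function with the other coordinates frozen at \<open>z\<close>\<close>
      define g where "g = (\<lambda>t. f ((h i)(i := t)) - f (z(i := t)))"
      have hP: "(h i)(i := t) \<in> P" and zP: "z(i := t) \<in> P"
        and hz: "dist ((h i)(i := t)) (z(i := t)) < d" if "cmod (t - z i) \<le> r" for t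
      proof -
        show "(h i)(i := t) \<in> P" "z(i := t) \<in> P"
          using that hC zC i r(1) wj' unfolding P_def by (simp_all add: h_def)
        have "dist ((h i)(i := t)) (z(i := t)) \<le> 2 * \<delta>"
        proof (rule dist_le_coords[where n = n])
          show "cmod (((h i)(i := t)) j - (z(i := t)) j) \<le> \<delta>" if "j < n" for j
            using wj[OF that] \<delta>(1) by (simp add: h_def)
        qed (use hC zC i \<delta>(1) in simp_all)
        then show "dist ((h i)(i := t)) (z(i := t)) < d" using \<delta>(3) d(1) by linarith
      qed
      have sub1: "cball (z i) r \<subseteq> {t. (h i)(i := t) \<in> S}" and sub2: "cball (z i) r \<subseteq> {t. z(i := t) \<in> S}"
        using hP zP PS by (auto simp: dist_norm norm_minus_commute)
      have ghol: "g holomorphic_on cball (z i) r"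
        unfolding g_def using hol_fun_line[OF f i] sub1 sub2
        by (intro holomorphic_on_diff) (auto intro: holomorphic_on_subset)
      have gb: "cmod (g t) \<le> e * r / 2" if "cmod (t - z i) \<le> r" for t
        using d(2)[OF zP[OF that] hP[OF that] hz[OF that]] unfolding g_def
        by (simp add: dist_norm)
      have g': "cmod (deriv g t) \<le> e" if t: "t \<in> ball (z i) (r/2)" for t
      proof -
        have "cball t (r/2) \<subseteq> cball (z i) r"
        proof
          fix x assume "x \<in> cball t (r/2)"
          then show "x \<in> cball (z i) r"
            using t dist_triangle[of "z i" x t] by auto
        qed
        have "norm ((deriv ^^ 1) g t) \<le> fact 1 * (e * r / 2) / (r/2)^1"
        proof (rule Cauchy_inequality)
          show "g holomorphic_on ball t (r/2)" "continuous_on (cball t (r/2)) g"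
            using ghol \<open>cball t (r/2) \<subseteq> cball (z i) r\<close>
            by (meson ball_subset_cball holomorphic_on_subset holomorphic_on_imp_continuous_on subset_trans)+
          show "norm (g x) \<le> e * r / 2" if "norm (t - x) = r/2" for x
          proof (rule gb)
            have "x \<in> cball t (r/2)" using that by (simp add: dist_norm)
            then have "x \<in> cball (z i) r" using \<open>cball t (r/2) \<subseteq> cball (z i) r\<close> by auto
            then show "cmod (x - z i) \<le> r" by (simp add: dist_norm norm_minus_commute)
          qed
        qed (use r in auto)
        then show ?thesis using r by simp
      qed
      have b1: "cmod (g (w i) - g (z i)) \<le> e * cmod (w i - z i)"
      proof (rule field_differentiable_bound[of "ball (z i) (r/2)" g "deriv g"])
        show "(g has_field_derivative deriv g t) (at t within ball (z i) (r/2))" if "t \<in> ball (z i) (r/2)" for t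
        proof -
          have "g holomorphic_on ball (z i) r" using ghol by (rule holomorphic_on_subset) auto
          moreover have "t \<in> ball (z i) r" using that r by auto
          ultimately show ?thesis by (rule holomorphic_derivI[OF _ open_ball])
        qed
        show "w i \<in> ball (z i) (r/2)" using wj[OF i] \<delta>(2) by (auto simp: dist_norm norm_minus_commute)
      qed (use g' r in auto)
      have b2: "cmod (f (z(i := w i)) - f z - A i * (w i - z i)) \<le> e * cmod (w i - z i)"
        using \<delta>1(2)[OF i] wj[OF i] \<delta>(4)[OF i] by auto
      have eq: "f (h (Suc i)) - f (h i) - A i * (w i - z i) =
          (g (w i) - g (z i)) + (f (z(i := w i)) - f z - A i * (w i - z i))"
      proof -
        have "(h i)(i := w i) = h (Suc i)" "(h i)(i := z i) = h i"
          by (auto simp: h_def fun_eq_iff)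
        then show ?thesis by (simp add: g_def)
      qed
      show ?thesis
        unfolding eq using norm_triangle_mono[OF b1 b2] by linarith
    qed
    have tel: "f w - f z = (\<Sum>i<n. f (h (Suc i)) - f (h i))"
      using sum_lessThan_telescope[of "\<lambda>i. f (h i)" n] by (simp add: h0 hn)
    have "f w - f z - (\<Sum>i<n. A i * (w i - z i)) = (\<Sum>i<n. f (h (Suc i)) - f (h i) - A i * (w i - z i))"
      unfolding tel by (simp add: sum_subtractf)
    also have "cmod \<dots> \<le> (\<Sum>i<n. 2 * e * cnorm n (w - z))"
    proof (rule sum_norm_le)
      fix i assume i: "i \<in> {..<n}"
      have "cmod (w i - z i) \<le> cnorm n (w - z)" using coord_le_cnorm[of i n "w - z"] i by simp
      then have "2 * e * cmod (w i - z i) \<le> 2 * e * cnorm n (w - z)" using e by (intro mult_left_mono) auto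
      then show "cmod (f (h (Suc i)) - f (h i) - A i * (w i - z i)) \<le> 2 * e * cnorm n (w - z)"
        using step[of i] i by auto
    qed
    also have "\<dots> = (2 * e * real n) * cnorm n (w - z)" by simp
    also have "\<dots> \<le> \<epsilon> * cnorm n (w - z)"
    proof (rule mult_right_mono)
      have "2 * e * real n = \<epsilon> * (real n / (real n + 1))"
        using of_nat_0_le_iff[of n, where ?'a = real] by (simp add: e_def divide_simps)
      also have "\<dots> \<le> \<epsilon> * 1" using \<epsilon> by (intro mult_left_mono) auto
      finally show "2 * e * real n \<le> \<epsilon>" by simp
    qed simp
    finally show "cmod (f w - f z - (\<Sum>i<n. deriv (\<lambda>t. f (z(i := t))) (z i) * (w i - z i))) \<le> \<epsilon> * cnorm n (w - z)"
      by (simp add: A_def)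
  qed
qed

lemma has_cderiv_curve:
  assumes A: "has_cderiv n S f (\<gamma> t0) A" and \<gamma>: "\<And>i. i < n \<Longrightarrow> ((\<lambda>t. \<gamma> t i) has_field_derivative D i) (at t0)"
    and ev: "eventually (\<lambda>t. \<gamma> t \<in> S) (nhds t0)"
  shows "((\<lambda>t. f (\<gamma> t)) has_field_derivative (\<Sum>i<n. A i * D i)) (at t0)"
proof -
  define L where "L = (\<lambda>t. \<Sum>i<n. A i * (\<gamma> t i - \<gamma> t0 i))"
  have L: "(L has_field_derivative (\<Sum>i<n. A i * D i)) (at t0)"
    unfolding L_def by (auto intro!: derivative_eq_intros \<gamma> simp: mult.commute)
  \<comment> \<open>the curve is Lipschitz at \<open>t0\<close>\<close>
  obtain B where B: "B > 0" "eventually (\<lambda>t. cnorm n (\<gamma> t - \<gamma> t0) \<le> B * cmod (t - t0)) (nhds t0)"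
  proof -
    have "eventually (\<lambda>t. \<forall>i\<in>{..<n}. cmod (\<gamma> t i - \<gamma> t0 i) \<le> (cmod (D i) + 1) * cmod (t - t0)) (nhds t0)"
    proof (rule eventually_ball_finite)
      show "\<forall>i\<in>{..<n}. eventually (\<lambda>t. cmod (\<gamma> t i - \<gamma> t0 i) \<le> (cmod (D i) + 1) * cmod (t - t0)) (nhds t0)"
      proof
        fix i assume "i \<in> {..<n}"
        then have "((\<lambda>t. \<gamma> t i) has_derivative (\<lambda>h. D i * h)) (at t0)"
          using \<gamma>[of i] by (simp add: has_field_derivative_def)
        then obtain d where d: "d > 0" "\<And>t. norm (t - t0) < d \<Longrightarrow>
           norm (\<gamma> t i - \<gamma> t0 i - D i * (t - t0)) \<le> 1 * norm (t - t0)"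
          unfolding has_derivative_at_alt by (meson zero_less_one)
        show "eventually (\<lambda>t. cmod (\<gamma> t i - \<gamma> t0 i) \<le> (cmod (D i) + 1) * cmod (t - t0)) (nhds t0)"
          unfolding eventually_nhds_metric
        proof (intro exI[of _ d] conjI allI impI d(1))
          fix t assume "dist t t0 < d"
          then have "norm (\<gamma> t i - \<gamma> t0 i - D i * (t - t0)) \<le> norm (t - t0)"
            using d(2)[of t] by (simp add: dist_norm)
          then show "cmod (\<gamma> t i - \<gamma> t0 i) \<le> (cmod (D i) + 1) * cmod (t - t0)"
            using norm_triangle_sub[of "\<gamma> t i - \<gamma> t0 i" "D i * (t - t0)"]
            by (simp add: norm_mult distrib_right)
        qed
      qed
    qed simp
    then have ev': "eventually (\<lambda>t. cnorm n (\<gamma> t - \<gamma> t0) \<le> (real n * (\<Sum>i<n. cmod (D i) + 1) + 1) * cmod (t - t0)) (nhds t0)"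
    proof (rule eventually_mono)
      fix t assume t: "\<forall>i\<in>{..<n}. cmod (\<gamma> t i - \<gamma> t0 i) \<le> (cmod (D i) + 1) * cmod (t - t0)"
      have "cnorm n (\<gamma> t - \<gamma> t0) \<le> real n * ((\<Sum>i<n. cmod (D i) + 1) * cmod (t - t0))"
      proof (rule cnorm_le_bound)
        fix j assume j: "j < n"
        have "cmod (D j) + 1 \<le> (\<Sum>i<n. cmod (D i) + 1)"
          using j by (intro member_le_sum) auto
        then have "(cmod (D j) + 1) * cmod (t - t0) \<le> (\<Sum>i<n. cmod (D i) + 1) * cmod (t - t0)"
          by (rule mult_right_mono) simp
        then show "cmod ((\<gamma> t - \<gamma> t0) j) \<le> (\<Sum>i<n. cmod (D i) + 1) * cmod (t - t0)"
          using t j by force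
      qed
      then show "cnorm n (\<gamma> t - \<gamma> t0) \<le> (real n * (\<Sum>i<n. cmod (D i) + 1) + 1) * cmod (t - t0)"
        by (simp add: distrib_right mult.assoc add_increasing2)
    qed
    have "real n * (\<Sum>i<n. cmod (D i) + 1) + 1 > 0"
      by (smt (verit) mult_nonneg_nonneg of_nat_0_le_iff sum_nonneg norm_ge_zero)
    with ev' show ?thesis using that by blast
  qed
  have rem: "((\<lambda>t. f (\<gamma> t) - f (\<gamma> t0) - L t) has_derivative (\<lambda>h. 0 * h)) (at t0)"
    unfolding has_derivative_at_alt
  proof (intro conjI allI impI)
    fix e :: real assume e: "e > 0"
    then have "e / B > 0" using B by simp
    then obtain d where d: "d > 0" "\<And>w. w \<in> S \<Longrightarrow> cnorm n (w - \<gamma> t0) < d \<Longrightarrow>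
        cmod (f w - f (\<gamma> t0) - (\<Sum>i<n. A i * (w i - \<gamma> t0 i))) \<le> e / B * cnorm n (w - \<gamma> t0)"
      using A unfolding has_cderiv_def by metis
    have "eventually (\<lambda>t. dist t t0 < d / B) (nhds t0)"
      unfolding eventually_nhds_metric using d B by (intro exI[of _ "d/B"]) auto
    with B(2) ev have "eventually (\<lambda>t. norm (f (\<gamma> t) - f (\<gamma> t0) - L t) \<le> e * norm (t - t0)) (nhds t0)"
    proof eventually_elim
      case (elim t)
      have "B * cmod (t - t0) < d" using elim(3) B(1) by (simp add: dist_norm field_simps)
      then have "cmod (f (\<gamma> t) - f (\<gamma> t0) - L t) \<le> e / B * cnorm n (\<gamma> t - \<gamma> t0)"
        unfolding L_def using elim by (intro d(2)) auto
      also have "\<dots> \<le> e / B * (B * cmod (t - t0))"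
        using elim(1) e B(1) by (intro mult_left_mono) auto
      finally show ?case using B(1) by simp
    qed
    then show "\<exists>d>0. \<forall>y. norm (y - t0) < d \<longrightarrow>
        norm (f (\<gamma> y) - f (\<gamma> t0) - L y - (f (\<gamma> t0) - f (\<gamma> t0) - L t0) - 0 * (y - t0)) \<le> e * norm (y - t0)"
      unfolding eventually_nhds_metric by (simp add: dist_norm L_def)
  qed (auto intro: bounded_linear_mult_right)
  have "((\<lambda>t. (f (\<gamma> t) - f (\<gamma> t0) - L t) + f (\<gamma> t0) + L t) has_field_derivative (0 + 0 + (\<Sum>i<n. A i * D i))) (at t0)"
    by (intro DERIV_add L DERIV_const rem[folded has_field_derivative_def])
  then show ?thesis by simp
qed

lemma hol_fun_curve:
  assumes "openin (Ctop n) S" "hol_fun n S f" "\<gamma> t0 \<in> S"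
    and "\<And>i. i < n \<Longrightarrow> ((\<lambda>t. \<gamma> t i) has_field_derivative D i) (at t0)"
    and "eventually (\<lambda>t. \<gamma> t \<in> S) (nhds t0)"
  shows "((\<lambda>t. f (\<gamma> t)) has_field_derivative
     (\<Sum>i<n. deriv (\<lambda>t. f ((\<gamma> t0)(i := t))) (\<gamma> t0 i) * D i)) (at t0)"
  by (rule has_cderiv_curve[OF hol_fun_has_cderiv[OF assms(1-3)] assms(4,5)])

lemma continuous_into_Cset:
  assumes "\<And>z. z \<in> S \<Longrightarrow> F z \<in> Cset m" "\<And>j. j < m \<Longrightarrow> continuous_on S (\<lambda>z. F z j)"
  shows "continuous_on S F"
proof (rule continuous_on_coordinatewise_then_product)
  fix j show "continuous_on S (\<lambda>z. F z j)"
  proof (cases "j < m")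
    case False
    then have "continuous_on S (\<lambda>z. F z j) \<longleftrightarrow> continuous_on S (\<lambda>z. 0::complex)"
      using assms(1) by (intro continuous_on_cong) (auto simp: Cset_def)
    then show ?thesis by simp
  qed (rule assms(2))
qed

lemma hol_fun_compose:
  assumes S: "openin (Ctop n) S" and T: "openin (Ctop m) T" and g: "hol_fun m T g"
    and F: "\<And>j. j < m \<Longrightarrow> hol_fun n S (\<lambda>z. F z j)" and FT: "\<And>z. z \<in> S \<Longrightarrow> F z \<in> T"
  shows "hol_fun n S (\<lambda>z. g (F z))"
  unfolding hol_fun_def
proof (intro conjI ballI allI impI)
  have Fc: "continuous_on S F"
    using FT openin_Ctop_subset[OF T] by (intro continuous_into_Cset[where m = m] hol_fun_cont[OF F]) auto
  show "continuous_on S (\<lambda>z. g (F z))"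
    by (rule continuous_on_compose2[OF hol_fun_cont[OF g] Fc]) (use FT in auto)
  fix z i assume zi: "z \<in> S" "i < n"
  have zC: "z \<in> Cset n" using zi openin_Ctop_subset[OF S] by auto
  have "((\<lambda>t. g (F (z(i := t)))) has_field_derivative
     (\<Sum>j<m. deriv (\<lambda>t. g ((F (z(i := z i)))(j := t))) (F (z(i := z i)) j) *
        deriv (\<lambda>t. F (z(i := t)) j) (z i))) (at (z i))"
  proof (rule hol_fun_curve[OF T g])
    show "F (z(i := z i)) \<in> T" using FT zi by simp
    show "((\<lambda>t. F (z(i := t)) j) has_field_derivative deriv (\<lambda>t. F (z(i := t)) j) (z i)) (at (z i))"
      if "j < m" for j
      using F[OF that] zi unfolding hol_fun_def by (simp add: DERIV_deriv_iff_field_differentiable)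
    have "eventually (\<lambda>t. t \<in> {t. z(i := t) \<in> S}) (nhds (z i))"
      using open_line_section[OF S zC zi(2)] zi by (intro eventually_nhds_in_open) auto
    then show "eventually (\<lambda>t. F (z(i := t)) \<in> T) (nhds (z i))"
      by (rule eventually_mono) (use FT in auto)
  qed
  then show "(\<lambda>t. g (F (z(i := t)))) field_differentiable at (z i)"
    unfolding field_differentiable_def by blast
qed

lemma openin_Ctop_preimage:
  assumes S: "openin (Ctop n) S" and T: "openin (Ctop m) T"
    and F: "\<And>j. j < m \<Longrightarrow> continuous_on S (\<lambda>z. F z j)" and FC: "\<And>z. z \<in> S \<Longrightarrow> F z \<in> Cset m"
  shows "openin (Ctop n) {z \<in> S. F z \<in> T}"
proof -
  have "continuous_on S F" by (rule continuous_into_Cset[OF FC F])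
  then have "continuous_map (top_of_set S) (top_of_set (Cset m)) F"
    using FC by (auto simp: continuous_map_in_subtopology image_subset_iff)
  then have "openin (top_of_set S) {z \<in> topspace (top_of_set S). F z \<in> T}"
    using T unfolding Ctop_def by (rule openin_continuous_map_preimage)
  then show ?thesis
    using S unfolding Ctop_def by (auto intro: openin_trans)
qed

theorem holo_on_iff_hol_fun:
  assumes S: "openin (Ctop n) S"
  shows "holo_on n m S F \<longleftrightarrow> F ` S \<subseteq> Cset m \<and> (\<forall>j<m. hol_fun n S (\<lambda>z. F z j))"
proof (intro iffI conjI allI impI)
  assume H: "holo_on n m S F"
  then show "F ` S \<subseteq> Cset m" by (simp add: holo_on_def)
  fix j assume j: "j < m"
  define f where "f = (\<lambda>z. F z j)"
  have "\<exists>A. has_cderiv n S f z A" if z: "z \<in> S" for z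
  proof -
    obtain A where A: "\<And>\<epsilon>. \<epsilon> > 0 \<Longrightarrow> \<exists>\<delta>>0. \<forall>w\<in>S. cnorm n (w - z) < \<delta> \<longrightarrow>
        cnorm m (\<lambda>j. F w j - F z j - (\<Sum>i<n. A j i * (w i - z i))) \<le> \<epsilon> * cnorm n (w - z)"
      using H z unfolding holo_on_def by meson
    have "has_cderiv n S f z (A j)"
      unfolding has_cderiv_def
    proof (intro allI impI)
      fix \<epsilon> :: real assume "\<epsilon> > 0"
      then obtain \<delta> where \<delta>: "\<delta> > 0" "\<forall>w\<in>S. cnorm n (w - z) < \<delta> \<longrightarrow>
        cnorm m (\<lambda>j. F w j - F z j - (\<Sum>i<n. A j i * (w i - z i))) \<le> \<epsilon> * cnorm n (w - z)"
        using A by meson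
      show "\<exists>\<delta>>0. \<forall>w\<in>S. cnorm n (w - z) < \<delta> \<longrightarrow> cmod (f w - f z - (\<Sum>i<n. A j i * (w i - z i))) \<le> \<epsilon> * cnorm n (w - z)"
        using \<delta> coord_le_cnorm[OF j, of "\<lambda>j. F _ j - F z j - (\<Sum>i<n. A j i * (_ i - z i))"]
        unfolding f_def by (intro exI[of _ \<delta>]) (meson order_trans)
    qed
    then show ?thesis by blast
  qed
  then obtain A where A: "\<And>z. z \<in> S \<Longrightarrow> has_cderiv n S f z (A z)" by metis
  have "hol_fun n S f"
    unfolding hol_fun_def
  proof (intro conjI ballI allI impI)
    show "continuous_on S f"
      unfolding continuous_on_eq_continuous_within
    proof
      fix z assume z: "z \<in> S"
      obtain \<delta> where \<delta>: "\<delta> > 0" "\<And>w. w \<in> S \<Longrightarrow> cnorm n (w - z) < \<delta> \<Longrightarrow>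
          cmod (f w - f z - (\<Sum>i<n. A z i * (w i - z i))) \<le> 1 * cnorm n (w - z)"
        using A[OF z] unfolding has_cderiv_def by (metis zero_less_one)
      have cc: "((\<lambda>w. w i) \<longlongrightarrow> z i) (at z within S)" for i
        using continuous_on_subset[OF continuous_on_product_coordinates subset_UNIV, of S i] z
        by (simp add: continuous_on_def)
      have c0: "((\<lambda>w. cnorm n (w - z)) \<longlongrightarrow> 0) (at z within S)"
      proof -
        have "((\<lambda>w. sqrt (\<Sum>i<n. (cmod (w i - z i))\<^sup>2)) \<longlongrightarrow> sqrt (\<Sum>i<n. (cmod (z i - z i))\<^sup>2)) (at z within S)"
          by (intro tendsto_intros cc)
        then show ?thesis by (simp add: cnorm_def L2_set_def)
      qed
      have l0: "((\<lambda>w. \<Sum>i<n. A z i * (w i - z i)) \<longlongrightarrow> 0) (at z within S)"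
      proof -
        have "((\<lambda>w. \<Sum>i<n. A z i * (w i - z i)) \<longlongrightarrow> (\<Sum>i<n. A z i * (z i - z i))) (at z within S)"
          by (intro tendsto_intros cc)
        then show ?thesis by simp
      qed
      have "((\<lambda>w. f w - f z - (\<Sum>i<n. A z i * (w i - z i))) \<longlongrightarrow> 0) (at z within S)"
      proof (rule Lim_null_comparison[OF _ c0])
        have "eventually (\<lambda>w. cnorm n (w - z) < \<delta>) (at z within S)"
          using c0 \<delta>(1) by (auto simp: order_tendsto_iff)
        moreover have "eventually (\<lambda>w. w \<in> S) (at z within S)" by (simp add: eventually_at_filter)
        ultimately show "eventually (\<lambda>w. norm (f w - f z - (\<Sum>i<n. A z i * (w i - z i))) \<le> cnorm n (w - z)) (at z within S)"
          by eventually_elim (use \<delta>(2) in auto)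
      qed
      then have "((\<lambda>w. (f w - f z - (\<Sum>i<n. A z i * (w i - z i))) + (\<Sum>i<n. A z i * (w i - z i)) + f z) \<longlongrightarrow> 0 + 0 + f z) (at z within S)"
        by (intro tendsto_add l0 tendsto_const)
      then show "continuous (at z within S) f" by (simp add: continuous_within)
    qed
    fix z i assume zi: "z \<in> S" "i < n"
    have zC: "z \<in> Cset n" using zi openin_Ctop_subset[OF S] by auto
    have "((\<lambda>t. f (z(i := t))) has_field_derivative (\<Sum>k<n. A z k * (if k = i then 1 else 0))) (at (z i))"
    proof (rule has_cderiv_curve[where \<gamma> = "\<lambda>t. z(i := t)"])
      show "has_cderiv n S f (z(i := z i)) (A z)" using A zi by simp
      show "((\<lambda>t. (z(i := t)) k) has_field_derivative (if k = i then 1 else 0)) (at (z i))" if "k < n" for k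
        by (cases "k = i") auto
      show "eventually (\<lambda>t. z(i := t) \<in> S) (nhds (z i))"
        using open_line_section[OF S zC zi(2)] zi eventually_nhds_in_open[of "{t. z(i := t) \<in> S}" "z i"] by auto
    qed
    then show "(\<lambda>t. f (z(i := t))) field_differentiable at (z i)"
      unfolding field_differentiable_def by blast
  qed
  then show "hol_fun n S (\<lambda>z. F z j)" by (simp add: f_def)
next
  assume H: "F ` S \<subseteq> Cset m \<and> (\<forall>j<m. hol_fun n S (\<lambda>z. F z j))"
  show "holo_on n m S F"
    unfolding holo_on_def
  proof (intro conjI ballI)
    show "F ` S \<subseteq> Cset m" using H by simp
    fix z assume z: "z \<in> S"
    define A where "A = (\<lambda>j i. deriv (\<lambda>t. F (z(i := t)) j) (z i))"
    have A: "has_cderiv n S (\<lambda>z. F z j) z (A j)" if "j < m" for j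
      using hol_fun_has_cderiv[OF S _ z] H that unfolding A_def by blast
    show "\<exists>A. \<forall>\<epsilon>>0. \<exists>\<delta>>0. \<forall>w\<in>S. cnorm n (w - z) < \<delta> \<longrightarrow>
        cnorm m (\<lambda>j. F w j - F z j - (\<Sum>i<n. A j i * (w i - z i))) \<le> \<epsilon> * cnorm n (w - z)"
    proof (intro exI[of _ A] allI impI)
      fix \<epsilon> :: real assume \<epsilon>: "\<epsilon> > 0"
      define e where "e = \<epsilon> / (real m + 1)"
      have e: "e > 0" using \<epsilon> by (simp add: e_def)
      have "\<exists>\<delta>>0. \<forall>w\<in>S. cnorm n (w - z) < \<delta> \<longrightarrow>
          cmod (F w j - F z j - (\<Sum>i<n. A j i * (w i - z i))) \<le> e * cnorm n (w - z)" if "j < m" for j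
        using A[OF that] e unfolding has_cderiv_def by blast
      then obtain d where d: "\<And>j. j < m \<Longrightarrow> d j > 0" "\<And>j w. j < m \<Longrightarrow> w \<in> S \<Longrightarrow> cnorm n (w - z) < d j \<Longrightarrow>
          cmod (F w j - F z j - (\<Sum>i<n. A j i * (w i - z i))) \<le> e * cnorm n (w - z)"
        by metis
      define \<delta> where "\<delta> = Min (insert 1 (d ` {..<m}))"
      have \<delta>: "\<delta> > 0" "\<And>j. j < m \<Longrightarrow> \<delta> \<le> d j" 
      proof -
        have "\<delta> \<le> x" if "x \<in> insert 1 (d ` {..<m})" for x
          unfolding \<delta>_def by (rule Min_le[OF _ that]) simp
        then show "\<And>j. j < m \<Longrightarrow> \<delta> \<le> d j" by blast
        show "\<delta> > 0" unfolding \<delta>_def using d(1) by (subst Min_gr_iff) auto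
      qed
      show "\<exists>\<delta>>0. \<forall>w\<in>S. cnorm n (w - z) < \<delta> \<longrightarrow>
        cnorm m (\<lambda>j. F w j - F z j - (\<Sum>i<n. A j i * (w i - z i))) \<le> \<epsilon> * cnorm n (w - z)"
      proof (intro exI[of _ \<delta>] conjI ballI impI \<delta>(1))
        fix w assume w: "w \<in> S" "cnorm n (w - z) < \<delta>"
        have "cnorm m (\<lambda>j. F w j - F z j - (\<Sum>i<n. A j i * (w i - z i))) \<le> real m * (e * cnorm n (w - z))"
          using d(2) w \<delta>(2) by (intro cnorm_le_bound) force
        also have "\<dots> = (real m / (real m + 1)) * (\<epsilon> * cnorm n (w - z))" by (simp add: e_def)
        also have "\<dots> \<le> 1 * (\<epsilon> * cnorm n (w - z))"
          using \<epsilon> by (intro mult_right_mono) auto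
        finally show "cnorm m (\<lambda>j. F w j - F z j - (\<Sum>i<n. A j i * (w i - z i))) \<le> \<epsilon> * cnorm n (w - z)" by simp
      qed
    qed
  qed
qed


section \<open>Runge approximation on starlike sets\<close>

definition cscale :: "complex \<Rightarrow> (nat \<Rightarrow> complex) \<Rightarrow> nat \<Rightarrow> complex" where
  "cscale c z = (\<lambda>i. c * z i)"

lemma cscale_apply [simp]: "cscale c z i = c * z i"
  by (simp add: cscale_def)

lemma cscale_1 [simp]: "cscale 1 z = z"
  by (simp add: cscale_def)

lemma cscale_0 [simp]: "cscale 0 z = (\<lambda>_. 0)"
  by (simp add: cscale_def)

lemma cscale_Cset [simp]: "z \<in> Cset n \<Longrightarrow> cscale c z \<in> Cset n"
  by (simp add: Cset_def)

lemma continuous_on_cscale: "continuous_on S (\<lambda>p. cscale (fst p) (snd p))"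
proof (rule continuous_on_coordinatewise_then_product)
  fix i
  have "continuous_on S (\<lambda>p::complex \<times> (nat \<Rightarrow> complex). snd p i)"
    by (rule continuous_on_product_then_coordinatewise[OF continuous_on_snd[OF continuous_on_id]])
  then show "continuous_on S (\<lambda>p. cscale (fst p) (snd p) i)"
    by (simp add: continuous_on_mult continuous_on_fst continuous_on_id)
qed

lemma openin_Ctop_continuous_preimage:
  fixes f :: "(nat \<Rightarrow> complex) \<Rightarrow> 'a::topological_space"
  assumes "openin (Ctop n) S" "continuous_on S f" "open B"
  shows "openin (Ctop n) {z \<in> S. f z \<in> B}"
proof -
  have "openin (top_of_set S) (S \<inter> f -` B)"
    by (rule continuous_openin_preimage_gen[OF assms(2,3)])
  moreover have "S \<inter> f -` B = {z \<in> S. f z \<in> B}" by auto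
  ultimately show ?thesis
    using assms(1) unfolding Ctop_def by (auto intro: openin_trans)
qed

lemma hol_fun_cscale:
  assumes U: "openin (Ctop n) U" and f: "hol_fun n U f" and T: "openin (Ctop n) T"
    and sub: "\<And>z. z \<in> T \<Longrightarrow> cscale c z \<in> U"
  shows "hol_fun n T (\<lambda>z. f (cscale c z))"
  by (rule hol_fun_compose[OF T U f _ sub]) (auto intro: hol_fun_intros)

text \<open>The difference quotients in the parameter are holomorphic in \<open>z\<close>, and by a Cauchy estimate for the
  second derivative they converge uniformly in \<open>z\<close>.  The bound on a smaller disc is part of the
  conclusion in order to allow iteration.\<close>

lemma hol_fun_deriv_parameter:
  fixes H :: "complex \<Rightarrow> (nat \<Rightarrow> complex) \<Rightarrow> complex"
  assumes N: "openin (Ctop n) N" and Hz: "\<And>u. u \<in> ball 0 R \<Longrightarrow> hol_fun n N (H u)"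
    and Hu: "\<And>z. z \<in> N \<Longrightarrow> (\<lambda>u. H u z) holomorphic_on ball 0 R"
    and B: "\<And>u z. u \<in> ball 0 R \<Longrightarrow> z \<in> N \<Longrightarrow> cmod (H u z) \<le> B"
    and R': "0 < R'" "R' < R"
  shows "\<And>u. u \<in> ball 0 R' \<Longrightarrow> hol_fun n N (\<lambda>z. deriv (\<lambda>u. H u z) u)"
    and "\<And>z. z \<in> N \<Longrightarrow> (\<lambda>u. deriv (\<lambda>u. H u z) u) holomorphic_on ball 0 R'"
    and "\<And>u z. u \<in> ball 0 R' \<Longrightarrow> z \<in> N \<Longrightarrow> cmod (deriv (\<lambda>u. H u z) u) \<le> B / (R - R')"
proof -
  have sub: "cball x d \<subseteq> ball 0 R" if "x \<in> ball 0 R1" "R1 + d \<le> R" for x :: complex and d R1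
  proof
    fix y assume "y \<in> cball x d"
    then have "norm y \<le> norm x + d"
      using norm_triangle_ineq[of x "y - x"] by (simp add: dist_norm norm_minus_commute)
    then show "y \<in> ball 0 R" using that by simp
  qed
  have cauchy: "norm ((deriv ^^ k) (\<lambda>u. H u z) x) \<le> fact k * B / d ^ k"
    if z: "z \<in> N" and x: "cball x d \<subseteq> ball 0 R" and d: "d > 0" for x d z k
  proof (rule Cauchy_inequality)
    show "(\<lambda>u. H u z) holomorphic_on ball x d"
      by (rule holomorphic_on_subset[OF Hu[OF z] subset_trans[OF ball_subset_cball x]])
    show "continuous_on (cball x d) (\<lambda>u. H u z)"
      by (rule holomorphic_on_imp_continuous_on[OF holomorphic_on_subset[OF Hu[OF z] x]])
    show "norm (H y z) \<le> B" if "norm (x - y) = d" for y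
      using x that by (intro B z) (auto simp: dist_norm)
  qed (rule d)
  show "cmod (deriv (\<lambda>u. H u z) u) \<le> B / (R - R')" if u: "u \<in> ball 0 R'" and z: "z \<in> N" for u z
    using cauchy[OF z sub[OF u], of "R - R'" 1] R' by simp
  show "(\<lambda>u. deriv (\<lambda>u. H u z) u) holomorphic_on ball 0 R'" if z: "z \<in> N" for z
    by (rule holomorphic_on_subset[OF holomorphic_deriv[OF Hu[OF z] open_ball]]) (use R' in auto)
  show "hol_fun n N (\<lambda>z. deriv (\<lambda>u. H u z) u)" if u: "u \<in> ball 0 R'" for u
  proof -
    define d where "d = (R - R') / 2"
    have d: "d > 0" using R' by (simp add: d_def)
    define h where "h = (\<lambda>k::nat. complex_of_real (d / 2 / real (Suc k)))"
    have h: "h k \<noteq> 0" "cmod (h k) < d" for k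
    proof -
      have "d / 2 / real (Suc k) \<le> d / 2 / 1" using d by (intro divide_left_mono) auto
      moreover have "cmod (h k) = d / 2 / real (Suc k)"
        unfolding h_def using d by (simp only: norm_of_real abs_of_nonneg divide_nonneg_nonneg of_nat_0_le_iff less_imp_le)
      ultimately show "cmod (h k) < d" using d by linarith
      show "h k \<noteq> 0" using d by (simp add: h_def del: of_nat_Suc)
    qed
    have uh: "u + h k \<in> ball u d" for k using h(2) by (simp add: dist_norm)
    have ballR: "ball u d \<subseteq> ball 0 R"
    proof -
      have "R' + d \<le> R" using R' by (simp add: d_def field_simps)
      then show ?thesis using sub[OF u] ball_subset_cball[of u d] by blast
    qed
    have hR: "u + h k \<in> ball 0 R" for k using uh ballR by blast
    have uR: "u \<in> ball 0 R" using u R' by simp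
    define q where "q = (\<lambda>k z. (H (u + h k) z - H u z) / h k)"
    have q: "hol_fun n N (q k)" for k
      unfolding q_def by (intro hol_fun_divide hol_fun_diff Hz hR uR hol_fun_const) (rule h(1))
    define C where "C = 2 * B / d ^ 2"
    have est: "cmod (q k z - deriv (\<lambda>u. H u z) u) \<le> C * cmod (h k)" if z: "z \<in> N" for k z
    proof -
      define F where "F = (\<lambda>u. H u z)"
      have hol: "(deriv ^^ i) F holomorphic_on ball 0 R" for i
        unfolding F_def by (rule holomorphic_higher_deriv[OF Hu[OF z] open_ball])
      have "cmod ((deriv ^^ 0) F (u + h k) - (\<Sum>i\<le>1. (deriv ^^ i) F u * ((u + h k) - u) ^ i / fact i))
          \<le> C * cmod ((u + h k) - u) ^ Suc 1 / fact 1"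
      proof (rule complex_Taylor[where S = "ball u d" and f = "\<lambda>i. (deriv ^^ i) F"])
        show "((deriv ^^ i) F has_field_derivative (deriv ^^ Suc i) F x) (at x within ball u d)"
          if "x \<in> ball u d" for x i
          using holomorphic_derivI[OF hol[of i] open_ball] that ballR by auto
        show "cmod ((deriv ^^ Suc 1) F x) \<le> C" if x: "x \<in> ball u d" for x
        proof -
          have "x \<in> ball 0 (R' + d)"
            using x u norm_triangle_ineq[of u "x - u"] by (simp add: dist_norm norm_minus_commute)
          then have "cball x d \<subseteq> ball 0 R" by (rule sub) (simp add: d_def)
          then have "norm ((deriv ^^ 2) F x) \<le> fact 2 * B / d ^ 2"
            unfolding F_def by (rule cauchy[OF z _ d])
          then show ?thesis by (simp add: C_def numeral_2_eq_2)
        qed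
      qed (use uh d in auto)
      then have "cmod (F (u + h k) - (F u + deriv F u * h k)) \<le> C * cmod (h k) * cmod (h k)"
        by (simp add: power2_eq_square mult.assoc)
      also have "F (u + h k) - (F u + deriv F u * h k) = (q k z - deriv F u) * h k"
        using h(1)[of k] by (simp add: q_def F_def field_simps)
      finally show ?thesis using h(1)[of k] by (simp add: norm_mult F_def)
    qed
    have "uniform_limit N q (\<lambda>z. deriv (\<lambda>u. H u z) u) sequentially"
    proof (rule uniform_limitI)
      fix e :: real assume e: "e > 0"
      have "(\<lambda>k. C * cmod (h k)) \<longlonglongrightarrow> C * 0"
      proof (intro tendsto_intros)
        have "(\<lambda>k. d / 2 * (1 / real (Suc k))) \<longlonglongrightarrow> d / 2 * 0"
          by (intro tendsto_intros LIMSEQ_Suc lim_1_over_n)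
        then show "(\<lambda>k. cmod (h k)) \<longlonglongrightarrow> 0"
          using d by (simp add: h_def norm_divide del: of_nat_Suc)
      qed
      then have "\<forall>\<^sub>F k in sequentially. C * cmod (h k) < e"
        using e by (auto dest: order_tendstoD(2))
      then show "\<forall>\<^sub>F k in sequentially. \<forall>z\<in>N. dist (q k z) (deriv (\<lambda>u. H u z) u) < e"
        by (rule eventually_mono) (use est in \<open>auto simp: dist_norm intro: le_less_trans\<close>)
    qed
    then show ?thesis by (rule hol_fun_uniform_limit[OF N q])
  qed
qed

lemma hol_fun_higher_deriv_parameter:
  fixes H :: "complex \<Rightarrow> (nat \<Rightarrow> complex) \<Rightarrow> complex"
  assumes N: "openin (Ctop n) N" and "R > 0" and "\<And>u. u \<in> ball 0 R \<Longrightarrow> hol_fun n N (H u)"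
    and "\<And>z. z \<in> N \<Longrightarrow> (\<lambda>u. H u z) holomorphic_on ball 0 R"
    and "\<And>u z. u \<in> ball 0 R \<Longrightarrow> z \<in> N \<Longrightarrow> cmod (H u z) \<le> B"
  shows "hol_fun n N (\<lambda>z. (deriv ^^ k) (\<lambda>u. H u z) 0)"
  using assms(2-)
proof (induction k arbitrary: H R B)
  case 0
  then show ?case by simp
next
  case (Suc k)
  note D = hol_fun_deriv_parameter[OF N Suc.prems(2,3,4), of "R/2"]
  have "hol_fun n N (\<lambda>z. (deriv ^^ k) (\<lambda>u. deriv (\<lambda>u. H u z) u) 0)"
    by (rule Suc.IH[of "R/2" "\<lambda>u z. deriv (\<lambda>u. H u z) u" "B / (R - R/2)"])
      (use D Suc.prems(1) in auto)
  then show ?case by (simp only: funpow_Suc_right o_def)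
qed

text \<open>The function \<open>- Ln (1 - a u)\<close> maps the unit disc into a horizontal strip of width less than \<open>\<pi>\<close>, and
  it sends \<open>1\<close> to \<open>L = - ln (1 - a)\<close>, which is large for \<open>a\<close> close to \<open>1\<close>.  Division by \<open>L\<close> squeezes the
  image into a thin neighbourhood of the unit interval, and there is room for a disc of radius
  slightly larger than \<open>1\<close>.\<close>

lemma reparametrization_of_interval:
  fixes \<delta> :: real
  assumes \<delta>: "\<delta> > 0"
  obtains \<phi> r where "r > 1" "\<phi> holomorphic_on ball 0 r" "\<phi> 0 = 0" "\<phi> 1 = 1"
    "\<And>u. u \<in> ball 0 r \<Longrightarrow> \<exists>t. 0 \<le> t \<and> t \<le> 1 \<and> cmod (\<phi> u - complex_of_real t) \<le> \<delta>"
proof -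
  define L where "L = 1 + 4 / \<delta>"
  have L: "L > 1" "4 / L < \<delta>"
    using \<delta> by (auto simp: L_def field_simps)
  define a where "a = 1 - exp (- L)"
  \<comment> \<open>on the disc of radius \<open>r\<close>, the real part of \<open>Ln (1 - a u)\<close> is still at least \<open>- L - 1\<close>\<close>
  define r where "r = (1 - exp (- L - 1)) / a"
  define \<phi> where "\<phi> = (\<lambda>u. - Ln (1 - complex_of_real a * u) / complex_of_real L)"
  have a: "0 < a" "a < 1" using L by (auto simp: a_def)
  have r: "r > 1" using a by (simp add: r_def) (simp add: a_def)
  have ar: "cmod (complex_of_real a * u) < 1 - exp (- L - 1)" if "u \<in> ball 0 r" for u
    using that a by (simp add: norm_mult r_def field_simps)
  have pos: "Re (1 - complex_of_real a * u) > 0" if "u \<in> ball 0 r" for u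
    using ar[OF that] complex_Re_le_cmod[of "complex_of_real a * u"] by (simp add: less_diff_eq) (smt (verit) exp_gt_zero)
  have npos: "1 - complex_of_real a * u \<notin> \<real>\<^sub>\<le>\<^sub>0" if "u \<in> ball 0 r" for u
    using pos[OF that] by (auto simp: complex_nonpos_Reals_iff)
  have "\<phi> holomorphic_on ball 0 r"
    unfolding \<phi>_def by (intro holomorphic_intros npos) (use L in auto)
  moreover have "\<phi> 0 = 0" by (simp add: \<phi>_def)
  moreover have "\<phi> 1 = 1"
  proof -
    have "1 - complex_of_real a * 1 = complex_of_real (exp (- L))" by (simp add: a_def)
    then have "Ln (1 - complex_of_real a * 1) = complex_of_real (- L)"
      by (simp only: Ln_of_real[OF exp_gt_zero] ln_exp)
    then show ?thesis using L by (simp add: \<phi>_def)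
  qed
  moreover have "\<exists>t. 0 \<le> t \<and> t \<le> 1 \<and> cmod (\<phi> u - complex_of_real t) \<le> \<delta>" if u: "u \<in> ball 0 r" for u
  proof -
    define w where "w = 1 - complex_of_real a * u"
    have w0: "w \<noteq> 0" using pos[OF u] unfolding w_def[symmetric] by auto
    have "cmod w \<ge> exp (- L - 1)"
      using norm_triangle_ineq2[of 1 "complex_of_real a * u"] ar[OF u] by (simp add: w_def)
    then have l1: "Re (Ln w) \<ge> - L - 1"
      using w0 ln_mono[of "exp (- L - 1)" "cmod w"] by (simp add: Re_Ln)
    have "cmod w \<le> 2"
      using norm_triangle_ineq4[of 1 "complex_of_real a * u"] ar[OF u] exp_gt_zero[of "- L - 1"]
      unfolding w_def norm_one by linarith
    then have "ln (cmod w) \<le> ln 2" using w0 by (subst ln_le_cancel_iff) auto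
    then have l2: "Re (Ln w) \<le> 1"
      unfolding Re_Ln[OF w0] using ln_2_less_1 by linarith
    have l3: "\<bar>Im (Ln w)\<bar> < 2"
      using Re_Ln_pos_lt[OF w0] pos[OF u] pi_less_4 by (simp add: w_def)
    define x where "x = - Re (Ln w) / L"
    define t where "t = max 0 (min 1 x)"
    have "x \<le> 1 + 1 / L" "- (1 / L) \<le> x"
      using l1 l2 L by (auto simp: x_def field_simps)
    then have xt: "\<bar>x - t\<bar> \<le> 1 / L" using L unfolding t_def by (auto simp: max_def min_def)
    have "cmod (\<phi> u - complex_of_real t) \<le> \<bar>Re (\<phi> u - complex_of_real t)\<bar> + \<bar>Im (\<phi> u - complex_of_real t)\<bar>"
      by (rule cmod_le)
    also have "\<dots> = \<bar>x - t\<bar> + \<bar>Im (Ln w)\<bar> / L"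
      using L by (simp add: \<phi>_def x_def w_def)
    also have "\<dots> \<le> 1 / L + 2 / L"
      using xt l3 L by (intro add_mono divide_right_mono) auto
    also have "\<dots> \<le> \<delta>" using L by (simp add: field_simps)
    finally show ?thesis by (intro exI[of _ t]) (auto simp: t_def)
  qed
  ultimately show ?thesis using that r by blast
qed

text \<open>For \<open>z \<in> K\<close> the function \<open>u \<mapsto> f(\<phi>(u) z)\<close>, with \<open>\<phi>\<close> from \<open>reparametrization_of_interval\<close>, is
  holomorphic on a disc of radius \<open>r > 1\<close>, so \<open>f(z)\<close> is the sum of its Taylor series at \<open>u = 1\<close>,
  uniformly on \<open>K\<close>.  The Taylor coefficients at \<open>u = 0\<close> only depend on the germ of \<open>f\<close> at the origin, as
  \<open>\<phi>(0) = 0\<close>; this is why they are defined and holomorphic for all \<open>z\<close>.\<close>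

theorem Runge_starlike:
  assumes K: "compact K" "K \<subseteq> U" and U: "openin (Ctop n) U" and f: "hol_fun n U f"
    and star: "\<And>z t. z \<in> K \<Longrightarrow> 0 \<le> t \<Longrightarrow> t \<le> 1 \<Longrightarrow> cscale (complex_of_real t) z \<in> K"
    and \<epsilon>: "\<epsilon> > 0"
  shows "\<exists>g. hol_fun n (Cset n) g \<and> (\<forall>z\<in>K. cmod (g z - f z) < \<epsilon>)"
proof (cases "K = {}")
  case True
  then show ?thesis by (intro exI[of _ "\<lambda>_. 0"]) auto
next
  case False
  then have zero: "(\<lambda>_. 0) \<in> U" using star[of _ 0] K by auto
  have KC: "K \<subseteq> Cset n" using K openin_Ctop_subset[OF U] by auto
  obtain V where V: "open V" "U = Cset n \<inter> V"
    using U unfolding Ctop_def by (auto simp: openin_open)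
  let ?m = "\<lambda>p. cscale (fst p) (snd p)"
  define I where "I = complex_of_real ` {0..1}"
  have cI: "compact I" unfolding I_def by (intro compact_continuous_image continuous_intros) auto
  obtain e where e: "e > 0" "(\<Union>x\<in>I \<times> K. ball x e) \<subseteq> ?m -` V"
  proof (rule compact_subset_open_imp_ball_epsilon_subset)
    show "compact (I \<times> K)" using cI K(1) by (rule compact_Times)
    show "open (?m -` V)" using V(1) continuous_on_cscale by (rule open_vimage)
    show "I \<times> K \<subseteq> ?m -` V"
      using star K(2) V(2) by (force simp: I_def)
  qed blast
  define \<delta> where "\<delta> = e / 2"
  have \<delta>: "\<delta> > 0" using e by (simp add: \<delta>_def)
  \<comment> \<open>a compact neighbourhood of the unit interval with \<open>W \<cdot> K \<subseteq> U\<close>\<close>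
  define W where "W = (\<lambda>p. fst p + snd p) ` (I \<times> cball 0 \<delta>)"
  have "compact W" unfolding W_def
    by (intro compact_continuous_image compact_Times cI compact_cball continuous_intros)
  then have WK: "compact (W \<times> K)" using K(1) by (rule compact_Times)
  have WU: "cscale s z \<in> U" if s: "s \<in> W" and z: "z \<in> K" for s z
  proof -
    obtain t d where td: "t \<in> I" "cmod d \<le> \<delta>" "s = t + d" using s unfolding W_def by auto
    then have "(s, z) \<in> ball (t, z) e"
      using e(1) by (simp add: dist_prod_def dist_norm \<delta>_def)
    then have "?m (s, z) \<in> V" using e(2) td(1) z by blast
    then show ?thesis using V(2) KC z by auto
  qed
  have "continuous_on (W \<times> K) (\<lambda>p. f (?m p))"
    by (rule continuous_on_compose2[OF hol_fun_cont[OF f] continuous_on_cscale]) (use WU in auto)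
  then have "bounded ((\<lambda>p. f (?m p)) ` (W \<times> K))"
    by (intro compact_imp_bounded compact_continuous_image WK)
  then obtain B where B: "\<And>s z. s \<in> W \<Longrightarrow> z \<in> K \<Longrightarrow> cmod (f (cscale s z)) \<le> B"
    unfolding bounded_iff by force
  obtain \<phi> r where r: "r > 1" and \<phi>: "\<phi> holomorphic_on ball 0 r" "\<phi> 0 = 0" "\<phi> 1 = 1"
    and \<phi>I: "\<And>u. u \<in> ball 0 r \<Longrightarrow> \<exists>t. 0 \<le> t \<and> t \<le> 1 \<and> cmod (\<phi> u - complex_of_real t) \<le> \<delta>"
    using reparametrization_of_interval[OF \<delta>] by metis
  have \<phi>W: "\<phi> u \<in> W" if "u \<in> ball 0 r" for u
  proof -
    obtain t where "0 \<le> t" "t \<le> 1" "cmod (\<phi> u - complex_of_real t) \<le> \<delta>" using \<phi>I[OF \<open>u \<in> ball 0 r\<close>] by blast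
    then show ?thesis
      unfolding W_def I_def by (intro image_eqI[of _ _ "(complex_of_real t, \<phi> u - complex_of_real t)"]) auto
  qed
  have hol_line: "(\<lambda>u. f (cscale (\<phi> u) z)) holomorphic_on ball 0 R"
    if zC: "z \<in> Cset n" and R: "R \<le> r" and inU: "\<And>u. u \<in> ball 0 R \<Longrightarrow> cscale (\<phi> u) z \<in> U" for z R
    unfolding holomorphic_on_def
  proof
    fix u :: complex assume u: "u \<in> ball 0 R"
    have "(\<phi> has_field_derivative deriv \<phi> u) (at u)"
      using u R by (intro holomorphic_derivI[OF \<phi>(1) open_ball]) auto
    then have c: "((\<lambda>u. cscale (\<phi> u) z i) has_field_derivative deriv \<phi> u * z i) (at u)" for i
      by (auto intro!: derivative_eq_intros)
    have "((\<lambda>u. f (cscale (\<phi> u) z)) has_field_derivative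
       (\<Sum>i<n. deriv (\<lambda>t. f ((cscale (\<phi> u) z)(i := t))) (cscale (\<phi> u) z i) * (deriv \<phi> u * z i))) (at u)"
    proof (rule hol_fun_curve[OF U f, of "\<lambda>u. cscale (\<phi> u) z"])
      show "eventually (\<lambda>u. cscale (\<phi> u) z \<in> U) (nhds u)"
        using eventually_nhds_in_open[OF open_ball u] by (rule eventually_mono) (rule inU)
    qed (use inU u c in auto)
    then show "(\<lambda>u. f (cscale (\<phi> u) z)) field_differentiable at u within ball 0 R"
      by (meson field_differentiable_at_within field_differentiable_def)
  qed
  define G where "G = (\<lambda>z u. f (cscale (\<phi> u) z))"
  define c where "c = (\<lambda>k z. (deriv ^^ k) (G z) 0 / fact k)"
  have GK: "G z holomorphic_on ball 0 r" if "z \<in> K" for z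
    unfolding G_def by (rule hol_line) (use that KC WU \<phi>W in auto)
  have c_entire: "hol_fun n (Cset n) (c k)" for k
  proof (rule hol_fun_local)
    fix z0 assume z0: "z0 \<in> Cset n"
    define T where "T = {w \<in> Cset n. \<forall>j<n. cmod (w j - z0 j) < 1}"
    have T: "openin (Ctop n) T" unfolding T_def by (rule openin_polydisc[OF z0])
    define C where "C = 1 + (\<Sum>j<n. cmod (z0 j))"
    have C: "C > 0" unfolding C_def by (simp add: add_pos_nonneg sum_nonneg)
    have TC: "cmod (w j) \<le> C" if "w \<in> T" "j < n" for w j
    proof -
      have "cmod (z0 j) \<le> (\<Sum>j<n. cmod (z0 j))" using that by (intro member_le_sum) auto
      moreover have "cmod (w j) \<le> cmod (w j - z0 j) + cmod (z0 j)" using norm_triangle_sub[of "w j" "z0 j"] by simp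
      moreover have "cmod (w j - z0 j) < 1" using that by (auto simp: T_def)
      ultimately show ?thesis by (simp add: C_def)
    qed
    have "openin (Ctop n) {w \<in> U. f w \<in> ball (f (\<lambda>_. 0)) 1}"
      by (rule openin_Ctop_continuous_preimage[OF U hol_fun_cont[OF f] open_ball])
    then obtain \<eta> where \<eta>: "\<eta> > 0"
      "\<And>w. w \<in> Cset n \<Longrightarrow> (\<And>j. j < n \<Longrightarrow> cmod (w j - 0) < \<eta>) \<Longrightarrow> w \<in> {w \<in> U. f w \<in> ball (f (\<lambda>_. 0)) 1}"
      using openin_Ctop_nbhd[of n _ "\<lambda>_. 0"] zero by (metis (mono_tags, lifting) centre_in_ball mem_Collect_eq zero_less_one)
    have "continuous_on (ball 0 r) \<phi>" by (rule holomorphic_on_imp_continuous_on[OF \<phi>(1)])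
    then have "isCont \<phi> 0" using r by (simp add: continuous_on_eq_continuous_at)
    then obtain R0 where R0: "R0 > 0" "\<And>u. dist u 0 < R0 \<Longrightarrow> dist (\<phi> u) (\<phi> 0) < \<eta> / C"
      using \<eta>(1) C unfolding continuous_at_eps_delta by (metis divide_pos_pos)
    \<comment> \<open>for \<open>\<bar>u\<bar> < R\<close> the point \<open>\<phi>(u) z\<close> is close to the origin for all \<open>z \<in> T\<close>\<close>
    define R where "R = min R0 r"
    have R: "R > 0" "R \<le> r" using R0 r by (auto simp: R_def)
    have near: "cscale (\<phi> u) w \<in> U \<and> f (cscale (\<phi> u) w) \<in> ball (f (\<lambda>_. 0)) 1" if u: "u \<in> ball 0 R" and w: "w \<in> T" for u w
    proof -
      have "cmod (\<phi> u * w j) < \<eta>" if j: "j < n" for j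
      proof -
        have "cmod (\<phi> u) < \<eta> / C" using R0(2)[of u] u \<phi>(2) by (simp add: R_def)
        then have "cmod (\<phi> u) * C < \<eta>" using C by (simp add: field_simps)
        moreover have "cmod (\<phi> u) * cmod (w j) \<le> cmod (\<phi> u) * C" using TC[OF w j] by (intro mult_left_mono) auto
        ultimately show ?thesis by (simp add: norm_mult)
      qed
      then show ?thesis using \<eta>(2)[of "cscale (\<phi> u) w"] w by (auto simp: T_def)
    qed
    have "hol_fun n T (\<lambda>z. (deriv ^^ k) (\<lambda>u. f (cscale (\<phi> u) z)) 0)"
    proof (rule hol_fun_higher_deriv_parameter[OF T R(1), where B = "cmod (f (\<lambda>_. 0)) + 1"])
      show "hol_fun n T (\<lambda>z. f (cscale (\<phi> u) z))" if "u \<in> ball 0 R" for u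
        by (rule hol_fun_cscale[OF U f T]) (use near that in blast)
      show "(\<lambda>u. f (cscale (\<phi> u) z)) holomorphic_on ball 0 R" if "z \<in> T" for z
        by (rule hol_line) (use near that R in \<open>auto simp: T_def\<close>)
      show "cmod (f (cscale (\<phi> u) z)) \<le> cmod (f (\<lambda>_. 0)) + 1" if "u \<in> ball 0 R" "z \<in> T" for u z
        using near[OF that] norm_triangle_sub[of "f (cscale (\<phi> u) z)" "f (\<lambda>_. 0)"]
        by (simp add: dist_norm norm_minus_commute)
    qed
    then have "hol_fun n T (c k)"
      unfolding c_def G_def by (intro hol_fun_divide hol_fun_const) auto
    then show "\<exists>T. openin (Ctop n) T \<and> z0 \<in> T \<and> T \<subseteq> Cset n \<and> hol_fun n T (c k)"
      using T z0 by (intro exI[of _ T]) (auto simp: T_def)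
  qed simp
  define \<rho> where "\<rho> = (1 + r) / 2"
  have \<rho>: "1 < \<rho>" "\<rho> < r" using r by (auto simp: \<rho>_def)
  have cb: "norm (c k z) \<le> B * (1 / \<rho>) ^ k" if z: "z \<in> K" for k z
  proof -
    have s: "cball 0 \<rho> \<subseteq> ball (0::complex) r" using \<rho> by auto
    have "norm ((deriv ^^ k) (G z) 0) \<le> fact k * B / \<rho> ^ k"
    proof (rule Cauchy_inequality)
      show "G z holomorphic_on ball 0 \<rho>"
        by (rule holomorphic_on_subset[OF GK[OF z] subset_trans[OF ball_subset_cball s]])
      show "continuous_on (cball 0 \<rho>) (G z)"
        by (rule holomorphic_on_imp_continuous_on[OF holomorphic_on_subset[OF GK[OF z] s]])
      show "norm (G z x) \<le> B" if "norm (0 - x) = \<rho>" for x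
        unfolding G_def using that \<rho> by (intro B[OF \<phi>W z]) auto
    qed (use \<rho> in auto)
    then show ?thesis
      using \<rho> by (simp add: c_def norm_divide power_one_over field_simps)
  qed
  have "uniform_limit K (\<lambda>N z. \<Sum>k<N. c k z) (\<lambda>z. \<Sum>k. c k z) sequentially"
  proof (rule Weierstrass_m_test)
    show "summable (\<lambda>k. B * (1 / \<rho>) ^ k)"
      using \<rho> by (intro summable_mult summable_geometric) auto
  qed (use cb in auto)
  then have "\<forall>\<^sub>F N in sequentially. \<forall>z\<in>K. dist (\<Sum>k<N. c k z) (\<Sum>k. c k z) < \<epsilon>"
    using \<epsilon> by (rule uniform_limitD)
  then obtain N where N: "\<And>z. z \<in> K \<Longrightarrow> dist (\<Sum>k<N. c k z) (\<Sum>k. c k z) < \<epsilon>"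
    unfolding eventually_sequentially by blast
  have sumc: "(\<Sum>k. c k z) = f z" if "z \<in> K" for z
  proof -
    have "(\<lambda>k. (deriv ^^ k) (G z) 0 / fact k * (1 - 0) ^ k) sums G z 1"
      using r by (intro holomorphic_power_series[OF GK[OF that]]) auto
    then have "(\<lambda>k. c k z) sums f z" by (simp add: c_def G_def \<phi>(3))
    then show ?thesis by (rule sums_unique[symmetric])
  qed
  show ?thesis
  proof (intro exI[of _ "\<lambda>z. \<Sum>k<N. c k z"] conjI ballI)
    show "hol_fun n (Cset n) (\<lambda>z. \<Sum>k<N. c k z)" by (intro hol_fun_sum c_entire)
    show "cmod ((\<Sum>k<N. c k z) - f z) < \<epsilon>" if "z \<in> K" for z
      using N[OF that] sumc[OF that] by (simp add: dist_norm)
  qed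
qed


section \<open>Exponentials of matrices\<close>

primrec mexp_term :: "nat \<Rightarrow> (nat \<Rightarrow> nat \<Rightarrow> complex) \<Rightarrow> (nat \<Rightarrow> complex) \<Rightarrow> nat \<Rightarrow> nat \<Rightarrow> complex" where
  "mexp_term m A v 0 = v"
| "mexp_term m A v (Suc k) = (\<lambda>j. (\<Sum>l<m. A j l * mexp_term m A v k l) / of_nat (Suc k))"

text \<open>The vector \<open>exp(A) v\<close>, as a series of vectors; only the entries of \<open>A\<close> and \<open>v\<close> with indices below \<open>m\<close>
  matter for its first \<open>m\<close> coordinates.\<close>

definition mexp :: "nat \<Rightarrow> (nat \<Rightarrow> nat \<Rightarrow> complex) \<Rightarrow> (nat \<Rightarrow> complex) \<Rightarrow> nat \<Rightarrow> complex" where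
  "mexp m A v j = (\<Sum>k. mexp_term m A v k j)"

lemma exp_series_sums: "(\<lambda>k. x ^ k / fact k) sums exp x" for x :: "'a::{real_normed_field,banach}"
  using exp_converges[of x] by (simp add: scaleR_conv_of_real divide_inverse mult.commute)

lemma mexp_term_bound:
  assumes A: "\<And>j l. j < m \<Longrightarrow> l < m \<Longrightarrow> cmod (A j l) \<le> a" and v: "\<And>l. l < m \<Longrightarrow> cmod (v l) \<le> b"
    and ab: "0 \<le> a" "0 \<le> b" and j: "j < m"
  shows "cmod (mexp_term m A v k j) \<le> b * ((real m * a) ^ k / fact k)"
  using j
proof (induction k arbitrary: j)
  case 0
  then show ?case using v by simp
next
  case (Suc k)
  have "cmod (\<Sum>l<m. A j l * mexp_term m A v k l) \<le> (\<Sum>l<m. a * (b * ((real m * a) ^ k / fact k)))"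
  proof (rule sum_norm_le)
    fix l assume "l \<in> {..<m}"
    then show "cmod (A j l * mexp_term m A v k l) \<le> a * (b * ((real m * a) ^ k / fact k))"
      unfolding norm_mult using Suc A ab by (intro mult_mono) auto
  qed
  also have "\<dots> = b * ((real m * a) ^ Suc k / fact k)" by simp
  finally have s: "cmod (\<Sum>l<m. A j l * mexp_term m A v k l) \<le> b * ((real m * a) ^ Suc k / fact k)" .
  have "cmod (mexp_term m A v (Suc k) j) = cmod (\<Sum>l<m. A j l * mexp_term m A v k l) / real (Suc k)"
    by (simp only: mexp_term.simps norm_divide norm_of_nat)
  also have "\<dots> \<le> b * ((real m * a) ^ Suc k / fact k) / real (Suc k)"
    by (rule divide_right_mono[OF s]) simp
  also have "\<dots> = b * ((real m * a) ^ Suc k / fact (Suc k))"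
    by (simp add: field_simps del: of_nat_Suc)
  finally show ?case .
qed

lemma mexp_sums:
  assumes j: "j < m"
  shows "(\<lambda>k. mexp_term m A v k j) sums mexp m A v j"
proof -
  define a where "a = (\<Sum>j<m. \<Sum>l<m. cmod (A j l))"
  define b where "b = (\<Sum>l<m. cmod (v l))"
  have "cmod (A j l) \<le> a" if "j < m" "l < m" for j l
  proof -
    have "cmod (A j l) \<le> (\<Sum>l<m. cmod (A j l))" using that by (intro member_le_sum) auto
    also have "\<dots> \<le> a" unfolding a_def
      using that by (intro member_le_sum[of j _ "\<lambda>j. \<Sum>l<m. cmod (A j l)"]) (auto intro: sum_nonneg)
    finally show ?thesis .
  qed
  moreover have "cmod (v l) \<le> b" if "l < m" for l
    unfolding b_def using that by (intro member_le_sum) auto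
  moreover have "0 \<le> a" "0 \<le> b" by (auto simp: a_def b_def intro!: sum_nonneg)
  ultimately have bd: "cmod (mexp_term m A v k j) \<le> b * ((real m * a) ^ k / fact k)" for k
    using j by (rule mexp_term_bound)
  have "summable (\<lambda>k. b * ((real m * a) ^ k / fact k))"
    by (intro summable_mult sums_summable[OF exp_series_sums])
  then have "summable (\<lambda>k. mexp_term m A v k j)"
    by (rule summable_comparison_test'[where N = 0]) (rule bd)
  then show ?thesis unfolding mexp_def by (rule summable_sums)
qed

lemma mexp_zero: "j < m \<Longrightarrow> mexp m (\<lambda>_ _. 0) v j = v j"
proof -
  assume j: "j < m"
  have "mexp_term m (\<lambda>_ _. 0) v k j = (if k = 0 then v j else 0)" for k by (cases k) auto
  then have eq: "(\<lambda>k. mexp_term m (\<lambda>_ _. 0) v k j) = (\<lambda>k. if k = 0 then v j else 0)" by (rule ext)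
  have "(\<lambda>k. mexp_term m (\<lambda>_ _. 0) v k j) sums v j"
    unfolding eq by (rule sums_single)
  then show ?thesis by (rule sums_unique2[OF mexp_sums[OF j, of "\<lambda>_ _. 0" v]])
qed

lemma mexp_scale: "j < m \<Longrightarrow> mexp m A (\<lambda>i. c * v i) j = c * mexp m A v j"
proof -
  assume j: "j < m"
  have "mexp_term m A (\<lambda>i. c * v i) k j = c * mexp_term m A v k j" for k j
    by (induction k arbitrary: j) (simp_all add: sum_distrib_left mult.left_commute)
  then have "(\<lambda>k. mexp_term m A (\<lambda>i. c * v i) k j) sums (c * mexp m A v j)"
    using sums_mult[OF mexp_sums[OF j, of A v], of c] by simp
  then show ?thesis by (rule sums_unique2[OF mexp_sums[OF j, of A "\<lambda>i. c * v i"]])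
qed

text \<open>A left eigenvector of \<open>A\<close> for \<open>\<kappa>\<close> is one of \<open>exp(A)\<close> for \<open>exp(\<kappa>)\<close>.  It is used for the evaluation of forms at
  a point, and what matters is that the factor \<open>exp(\<kappa>)\<close> does not vanish.\<close>

lemma mexp_left_eigenvector:
  assumes e: "\<And>l. l < m \<Longrightarrow> (\<Sum>j<m. e j * A j l) = \<kappa> * e l"
  shows "(\<Sum>j<m. e j * mexp m A v j) = exp \<kappa> * (\<Sum>j<m. e j * v j)"
proof -
  have "(\<Sum>j<m. e j * mexp_term m A v k j) = \<kappa> ^ k / fact k * (\<Sum>j<m. e j * v j)" for k
  proof (induction k)
    case (Suc k)
    have "(\<Sum>j<m. e j * mexp_term m A v (Suc k) j)
        = (\<Sum>j<m. \<Sum>l<m. e j * A j l * mexp_term m A v k l) / of_nat (Suc k)"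
      by (simp add: sum_divide_distrib sum_distrib_left mult.assoc del: of_nat_Suc)
    also have "(\<Sum>j<m. \<Sum>l<m. e j * A j l * mexp_term m A v k l)
        = (\<Sum>l<m. (\<Sum>j<m. e j * A j l) * mexp_term m A v k l)"
      by (subst sum.swap) (simp add: sum_distrib_right)
    also have "\<dots> = \<kappa> * (\<Sum>l<m. e l * mexp_term m A v k l)"
      by (simp add: e sum_distrib_left mult.assoc)
    finally show ?case by (simp add: Suc.IH field_simps)
  qed simp
  then have "(\<lambda>k. \<kappa> ^ k / fact k * (\<Sum>j<m. e j * v j)) sums (\<Sum>j<m. e j * mexp m A v j)"
    using sums_sum[of "{..<m}" "\<lambda>j k. e j * mexp_term m A v k j" "\<lambda>j. e j * mexp m A v j"]
    by (simp add: sums_mult[OF mexp_sums])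
  moreover have "(\<lambda>k. \<kappa> ^ k / fact k * (\<Sum>j<m. e j * v j)) sums (exp \<kappa> * (\<Sum>j<m. e j * v j))"
    by (intro sums_mult2 exp_series_sums)
  ultimately show ?thesis by (rule sums_unique2)
qed

lemma mexp_first_order:
  assumes A: "\<And>j l. j < m \<Longrightarrow> l < m \<Longrightarrow> cmod (A j l) \<le> a" and v: "\<And>l. l < m \<Longrightarrow> cmod (v l) \<le> b"
    and ab: "0 \<le> a" "0 \<le> b" and j: "j < m"
  shows "cmod (mexp m A v j - v j - (\<Sum>l<m. A j l * v l)) \<le> b * (real m * a)\<^sup>2 * exp (real m * a)"
proof -
  define x where "x = real m * a"
  have x: "x \<ge> 0" using ab by (simp add: x_def)
  have ex: "(\<lambda>k. x ^ k / fact k) sums exp x" by (rule exp_series_sums)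
  have "(\<lambda>k. mexp_term m A v (k + 2) j) sums (mexp m A v j - (\<Sum>k<2. mexp_term m A v k j))"
    by (rule iffD2[OF sums_iff_shift' mexp_sums[OF j]])
  then have s: "(\<lambda>k. mexp_term m A v (k + 2) j) sums (mexp m A v j - v j - (\<Sum>l<m. A j l * v l))"
    by (simp add: numeral_2_eq_2 diff_diff_eq)
  have bd: "cmod (mexp_term m A v (k + 2) j) \<le> b * x\<^sup>2 * (x ^ k / fact k)" for k
  proof -
    have "cmod (mexp_term m A v (k + 2) j) \<le> b * (x ^ (k + 2) / fact (k + 2))"
      unfolding x_def by (rule mexp_term_bound[OF A v ab j])
    also have "\<dots> \<le> b * (x ^ (k + 2) / fact k)"
      using ab x by (intro mult_left_mono divide_left_mono fact_mono) auto
    also have "\<dots> = b * x\<^sup>2 * (x ^ k / fact k)"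
      by (simp only: power_add mult.assoc times_divide_eq_right mult.commute[of "x ^ k"])
    finally show ?thesis .
  qed
  have sm: "(\<lambda>k. b * x\<^sup>2 * (x ^ k / fact k)) sums (b * x\<^sup>2 * exp x)" by (intro sums_mult ex)
  have "cmod (\<Sum>k. mexp_term m A v (k + 2) j) \<le> (\<Sum>k. b * x\<^sup>2 * (x ^ k / fact k))"
    by (rule norm_suminf_le[OF bd]) (use sm in \<open>auto simp: sums_iff\<close>)
  then show ?thesis using s sm by (simp add: sums_iff x_def)
qed

text \<open>The matrix \<open>t M(t)\<close> is \<open>O(t)\<close>, so the terms of the exponential series from the second order on contribute
  \<open>O(t\<^sup>2)\<close>; the linear term is differentiable at \<open>0\<close> by continuity of \<open>M\<close>.\<close>

lemma mexp_has_derivative_at_0: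
  assumes M: "\<And>j l. j < m \<Longrightarrow> l < m \<Longrightarrow> isCont (\<lambda>t. M t j l) 0" and j: "j < m"
  shows "((\<lambda>t. mexp m (\<lambda>j l. t * M t j l) v j) has_field_derivative (\<Sum>l<m. M 0 j l * v l)) (at 0)"
proof -
  define b where "b = (\<Sum>l<m. cmod (v l))"
  have b: "cmod (v l) \<le> b" if "l < m" for l unfolding b_def using that by (intro member_le_sum) auto
  have b0: "0 \<le> b" by (simp add: b_def sum_nonneg)
  define s where "s = (\<lambda>t. \<Sum>j<m. \<Sum>l<m. cmod (M t j l))"
  have sM: "cmod (M t j l) \<le> s t" if "j < m" "l < m" for t j l
  proof -
    have "cmod (M t j l) \<le> (\<Sum>l<m. cmod (M t j l))" using that by (intro member_le_sum) auto
    also have "\<dots> \<le> s t" unfolding s_def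
      using that by (intro member_le_sum[of j _ "\<lambda>j. \<Sum>l<m. cmod (M t j l)"]) (auto intro: sum_nonneg)
    finally show ?thesis .
  qed
  have s0: "0 \<le> s t" for t by (auto simp: s_def intro!: sum_nonneg)
  define c where "c = s 0 + 1"
  have c: "c > 0" using s0[of 0] by (simp add: c_def)
  have "isCont s 0" unfolding s_def using M by (intro continuous_intros) auto
  then have "eventually (\<lambda>t. s t < c) (nhds 0)"
    unfolding isCont_def tendsto_at_iff_tendsto_nhds by (rule order_tendstoD) (simp add: c_def)
  then obtain d1 where d1: "d1 > 0" "\<And>t. dist t 0 < d1 \<Longrightarrow> s t < c"
    unfolding eventually_nhds_metric by blast
  define K where "K = b * (real m * c)\<^sup>2 * exp (real m * c)"
  have K: "K \<ge> 0" using b0 by (simp add: K_def)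
  define E where "E = (\<lambda>t. mexp m (\<lambda>j l. t * M t j l) v j - v j - (\<Sum>l<m. t * M t j l * v l))"
  have E0: "E 0 = 0" using mexp_zero[OF j] by (simp add: E_def)
  have Eb: "cmod (E t) \<le> K * (cmod t)\<^sup>2" if t: "cmod t < min d1 1" for t
  proof -
    have "cmod (E t) \<le> b * (real m * (cmod t * c))\<^sup>2 * exp (real m * (cmod t * c))"
      unfolding E_def
    proof (rule mexp_first_order[OF _ b _ b0 j])
      show "cmod (t * M t j l) \<le> cmod t * c" if "j < m" "l < m" for j l
        using sM[OF that, of t] d1(2)[of t] t by (auto simp: norm_mult intro!: mult_left_mono)
    qed (use c in auto)
    also have "\<dots> = b * (real m * c)\<^sup>2 * (cmod t)\<^sup>2 * exp (real m * (cmod t * c))"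
      by (simp add: power_mult_distrib mult_ac)
    also have "\<dots> \<le> b * (real m * c)\<^sup>2 * (cmod t)\<^sup>2 * exp (real m * (1 * c))"
      using t c b0 by (intro mult_left_mono) (auto intro!: mult_left_mono mult_right_mono)
    finally show ?thesis by (simp add: K_def mult_ac)
  qed
  have "(E has_derivative (\<lambda>h. 0 * h)) (at 0)"
    unfolding has_derivative_at_alt
  proof (intro conjI allI impI)
    show "bounded_linear (\<lambda>h. 0 * h :: complex)" by (rule bounded_linear_mult_right)
    fix e :: real assume e: "e > 0"
    define d where "d = min (min d1 1) (e / (K + 1))"
    have d: "d > 0" using d1 e K by (simp add: d_def)
    show "\<exists>d>0. \<forall>y. norm (y - 0) < d \<longrightarrow> norm (E y - E 0 - 0 * (y - 0)) \<le> e * norm (y - 0)"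
    proof (intro exI[of _ d] conjI allI impI d)
      fix y :: complex assume "norm (y - 0) < d"
      then have y: "cmod y < min d1 1" "cmod y < e / (K + 1)" by (auto simp: d_def)
      have "cmod (E y) \<le> (K * cmod y) * cmod y" using Eb[OF y(1)] by (simp add: power2_eq_square mult.assoc)
      also have "\<dots> \<le> e * cmod y"
      proof (rule mult_right_mono)
        have "K * cmod y \<le> (K + 1) * cmod y" by (simp add: mult_right_mono)
        also have "\<dots> \<le> e" using y(2) K by (simp add: field_simps)
        finally show "K * cmod y \<le> e" .
      qed simp
      finally show "norm (E y - E 0 - 0 * (y - 0)) \<le> e * norm (y - 0)" by (simp add: E0)
    qed
  qed
  then have "(E has_field_derivative 0) (at 0)" by (simp only: has_field_derivative_def)
  moreover have "((\<lambda>t. \<Sum>l<m. t * M t j l * v l) has_field_derivative (\<Sum>l<m. M 0 j l * v l)) (at 0)"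
  proof (rule iffD2[OF CARAT_DERIV], intro exI[of _ "\<lambda>t. \<Sum>l<m. M t j l * v l"] conjI allI)
    show "isCont (\<lambda>t. \<Sum>l<m. M t j l * v l) 0" using M j by (intro continuous_intros) auto
  qed (simp_all add: sum_distrib_left sum_distrib_right mult_ac)
  ultimately have "((\<lambda>t. E t + v j + (\<Sum>l<m. t * M t j l * v l)) has_field_derivative (0 + 0 + (\<Sum>l<m. M 0 j l * v l))) (at 0)"
    by (intro DERIV_add DERIV_const)
  then show ?thesis by (simp add: E_def)
qed

lemma hol_fun_mexp_term:
  assumes "\<And>j l. j < m \<Longrightarrow> l < m \<Longrightarrow> hol_fun n S (\<lambda>z. A z j l)" "\<And>l. l < m \<Longrightarrow> hol_fun n S (\<lambda>z. v z l)" "j < m"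
  shows "hol_fun n S (\<lambda>z. mexp_term m (A z) (v z) k j)"
  using assms(3)
proof (induction k arbitrary: j)
  case (Suc k)
  have "hol_fun n S (\<lambda>z. (\<Sum>l<m. A z j l * mexp_term m (A z) (v z) k l) / of_nat (Suc k))"
    by (rule hol_fun_divide; (intro hol_fun_sum hol_fun_mult hol_fun_const assms(1) Suc)?)
      (use Suc.prems in \<open>auto simp del: of_nat_Suc\<close>)
  then show ?case by simp
qed (use assms in simp)

lemma hol_fun_mexp:
  assumes S: "openin (Ctop n) S"
    and A: "\<And>j l. j < m \<Longrightarrow> l < m \<Longrightarrow> hol_fun n S (\<lambda>z. A z j l)"
    and v: "\<And>l. l < m \<Longrightarrow> hol_fun n S (\<lambda>z. v z l)" and j: "j < m"
  shows "hol_fun n S (\<lambda>z. mexp m (A z) (v z) j)"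
proof (rule hol_fun_local[OF S])
  fix z0 assume z0: "z0 \<in> S"
  define s where "s = (\<lambda>z. (\<Sum>j<m. \<Sum>l<m. cmod (A z j l)) + (\<Sum>l<m. cmod (v z l)))"
  have nn: "0 \<le> (\<Sum>j<m. \<Sum>l<m. cmod (A z j l))" "0 \<le> (\<Sum>l<m. cmod (v z l))" for z
    by (auto intro!: sum_nonneg)
  have sA: "cmod (A z j l) \<le> s z" if "j < m" "l < m" for z j l
  proof -
    have "cmod (A z j l) \<le> (\<Sum>l<m. cmod (A z j l))" using that by (intro member_le_sum) auto
    also have "\<dots> \<le> (\<Sum>j<m. \<Sum>l<m. cmod (A z j l))"
      using that by (intro member_le_sum[of j _ "\<lambda>j. \<Sum>l<m. cmod (A z j l)"]) (auto intro: sum_nonneg)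
    finally show ?thesis using nn(2)[of z] by (simp add: s_def)
  qed
  have sv: "cmod (v z l) \<le> s z" if "l < m" for z l
  proof -
    have "cmod (v z l) \<le> (\<Sum>l<m. cmod (v z l))" using that by (intro member_le_sum) auto
    then show ?thesis using nn(1)[of z] by (simp add: s_def)
  qed
  define a where "a = s z0 + 1"
  have a: "0 \<le> a" using nn[of z0] by (simp add: a_def s_def)
  have "continuous_on S s" unfolding s_def
    using hol_fun_cont[OF A] hol_fun_cont[OF v] by (intro continuous_intros) auto
  define T where "T = {z \<in> S. s z \<in> {..<a}}"
  have T: "openin (Ctop n) T" unfolding T_def
    by (rule openin_Ctop_continuous_preimage[OF S \<open>continuous_on S s\<close> open_lessThan])
  have TS: "T \<subseteq> S" by (auto simp: T_def)
  have "uniform_limit T (\<lambda>N z. \<Sum>k<N. mexp_term m (A z) (v z) k j) (\<lambda>z. \<Sum>k. mexp_term m (A z) (v z) k j) sequentially"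
  proof (rule Weierstrass_m_test)
    show "norm (mexp_term m (A z) (v z) k j) \<le> a * ((real m * a) ^ k / fact k)" if "z \<in> T" for k z
    proof (rule mexp_term_bound[OF _ _ a a j])
      have "s z \<le> a" using that by (simp add: T_def)
      then show "cmod (A z j l) \<le> a" if "j < m" "l < m" for j l using sA[OF that, of z] by simp
      show "cmod (v z l) \<le> a" if "l < m" for l using sv[OF that, of z] \<open>s z \<le> a\<close> by simp
    qed
    show "summable (\<lambda>k. a * ((real m * a) ^ k / fact k))"
      by (intro summable_mult sums_summable[OF exp_series_sums])
  qed
  then have "hol_fun n T (\<lambda>z. mexp m (A z) (v z) j)"
    unfolding mexp_def
    by (rule hol_fun_uniform_limit[OF T, rotated])
      (intro hol_fun_sum hol_fun_mexp_term j hol_fun_subset[OF A TS] hol_fun_subset[OF v TS])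
  then show "\<exists>T. openin (Ctop n) T \<and> z0 \<in> T \<and> T \<subseteq> S \<and> hol_fun n T (\<lambda>z. mexp m (A z) (v z) j)"
    using T TS z0 by (intro exI[of _ T]) (auto simp: T_def a_def)
qed


section \<open>Bezout matrices of binary cubic forms\<close>

text \<open>The coefficient of \<open>x\<^sup>i \<eta>\<^sup>j\<close> in the Bezoutian \<open>(f(x) g(\<eta>) - f(\<eta>) g(x)) / (x - \<eta>)\<close> of two cubic
  polynomials.\<close>

definition bezout :: "(nat \<Rightarrow> complex) \<Rightarrow> (nat \<Rightarrow> complex) \<Rightarrow> nat \<Rightarrow> nat \<Rightarrow> complex" where
  "bezout f g i j = (\<Sum>k\<le>min i (2 - j). f (j + k + 1) * g (i - k) - f (i - k) * g (j + k + 1))"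

lemma less_3_cases: "i < 3 \<longleftrightarrow> i = 0 \<or> i = 1 \<or> i = (2::nat)" by auto
lemma less_4_cases: "i < 4 \<longleftrightarrow> i = 0 \<or> i = 1 \<or> i = 2 \<or> i = (3::nat)" by auto

lemma sum_lessThan_3: "(\<Sum>i<3. f i) = f 0 + f 1 + (f (2::nat) :: 'a::comm_monoid_add)"
  by (simp add: numeral_eq_Suc)
lemma sum_lessThan_4: "(\<Sum>i<4. f i) = f 0 + f 1 + f 2 + (f (3::nat) :: 'a::comm_monoid_add)"
  by (simp add: numeral_eq_Suc)

lemma bezout_entries:
  "bezout f g 0 0 = f 1 * g 0 - f 0 * g 1"
  "bezout f g 0 1 = f 2 * g 0 - f 0 * g 2"
  "bezout f g 0 2 = f 3 * g 0 - f 0 * g 3"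
  "bezout f g 1 0 = f 2 * g 0 - f 0 * g 2"
  "bezout f g 1 1 = (f 3 * g 0 - f 0 * g 3) + (f 2 * g 1 - f 1 * g 2)"
  "bezout f g 1 2 = f 3 * g 1 - f 1 * g 3"
  "bezout f g 2 0 = f 3 * g 0 - f 0 * g 3"
  "bezout f g 2 1 = f 3 * g 1 - f 1 * g 3"
  "bezout f g 2 2 = f 3 * g 2 - f 2 * g 3"
  by (simp_all add: bezout_def numeral_eq_Suc min_def)

lemmas bezout_entries' = bezout_entries[unfolded One_nat_def]

text \<open>Up to sign the resultant of the two forms.\<close>

definition bez_det :: "(nat \<Rightarrow> complex) \<Rightarrow> (nat \<Rightarrow> complex) \<Rightarrow> complex" where
  "bez_det f g = (let B = bezout f g in
     B 0 0 * (B 1 1 * B 2 2 - B 1 2 * B 2 1) + B 0 1 * (B 1 2 * B 2 0 - B 1 0 * B 2 2)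
     + B 0 2 * (B 1 0 * B 2 1 - B 1 1 * B 2 0))"

text \<open>The adjugate of the Bezout matrix; with cyclic indices no signs are needed.\<close>

definition bez_adj :: "(nat \<Rightarrow> complex) \<Rightarrow> (nat \<Rightarrow> complex) \<Rightarrow> nat \<Rightarrow> nat \<Rightarrow> complex" where
  "bez_adj f g i j = (let B = bezout f g; i1 = (i + 1) mod 3; i2 = (i + 2) mod 3;
      j1 = (j + 1) mod 3; j2 = (j + 2) mod 3 in B j1 i1 * B j2 i2 - B j1 i2 * B j2 i1)"

lemma bez_adj_right: "i < 3 \<Longrightarrow> j < 3 \<Longrightarrow>
   (\<Sum>l<3. bezout f g i l * bez_adj f g l j) = (if i = j then bez_det f g else 0)"
  unfolding less_3_cases sum_lessThan_3
  by (elim disjE) (simp_all add: bez_adj_def bez_det_def Let_def algebra_simps numeral_2_eq_2[symmetric])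

text \<open>The coefficients of \<open>y b + x b'\<close>, where \<open>b\<close> and \<open>b'\<close> are the quadratic forms obtained by contracting the
  Bezoutian of \<open>f\<close> and \<open>g\<close> with the vectors \<open>(a\<^sub>0, a\<^sub>1, a\<^sub>2)\<close> and \<open>(a\<^sub>3, a\<^sub>4, a\<^sub>5)\<close>.  Modulo \<open>g\<close> this is
  multiplication of \<open>f\<close> by a function on the zero scheme of \<open>g\<close>.\<close>

definition bez_op :: "(nat \<Rightarrow> complex) \<Rightarrow> (nat \<Rightarrow> complex) \<Rightarrow> (nat \<Rightarrow> complex) \<Rightarrow> nat \<Rightarrow> complex" where
  "bez_op g a f j =
     (if j < 3 then \<Sum>l<3. bezout f g j l * a l else 0) +
     (if 0 < j then \<Sum>l<3. bezout f g (j - 1) l * a (3 + l) else 0)"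

definition bez_mat :: "(nat \<Rightarrow> complex) \<Rightarrow> (nat \<Rightarrow> complex) \<Rightarrow> nat \<Rightarrow> nat \<Rightarrow> complex" where
  "bez_mat g a j k = bez_op g a (\<lambda>i. if i = k then 1 else 0) j"

text \<open>Every cubic form is \<open>y b + x b'\<close> for quadratic forms \<open>b\<close> and \<open>b'\<close>, and there is a choice that is linear in
  the cubic form: put \<open>r\<^sub>0, r\<^sub>1, r\<^sub>2\<close> into \<open>b\<close> and \<open>r\<^sub>3\<close> into the last coefficient of \<open>b'\<close>.  The vectors to
  contract with are the images of \<open>b\<close> and \<open>b'\<close> under the inverse Bezout matrix.\<close>

definition bez_solve :: "(nat \<Rightarrow> complex) \<Rightarrow> (nat \<Rightarrow> complex) \<Rightarrow> (nat \<Rightarrow> complex) \<Rightarrow> nat \<Rightarrow> complex" where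
  "bez_solve f g r l = (if l < 3 then \<Sum>i<3. bez_adj f g l i * r i else bez_adj f g (l - 3) 2 * r 3) / bez_det f g"

lemma bez_mat_apply: "j < 4 \<Longrightarrow> (\<Sum>k<4. bez_mat g a j k * f k) = bez_op g a f j"
  unfolding less_4_cases sum_lessThan_4
  by (elim disjE)
    (simp_all add: bez_mat_def bez_op_def sum_lessThan_3 bezout_entries' algebra_simps)

lemma bez_op_solve:
  assumes D: "bez_det f g \<noteq> 0" and j: "j < 4"
  shows "bez_op g (bez_solve f g r) f j = r j"
proof -
  have y: "(\<Sum>l<3. bezout f g i l * bez_solve f g r l) = r i" if i: "i < 3" for i
  proof -
    have "(\<Sum>l<3. bezout f g i l * bez_solve f g r l)
        = (\<Sum>l<3. \<Sum>k<3. bezout f g i l * bez_adj f g l k * r k) / bez_det f g"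
      by (simp add: bez_solve_def sum_divide_distrib sum_distrib_left mult.assoc)
    also have "(\<Sum>l<3. \<Sum>k<3. bezout f g i l * bez_adj f g l k * r k)
        = (\<Sum>k<3. (\<Sum>l<3. bezout f g i l * bez_adj f g l k) * r k)"
      by (subst sum.swap) (simp add: sum_distrib_right)
    also have "\<dots> = (\<Sum>k<3. if k = i then bez_det f g * r k else 0)"
      by (rule sum.cong) (use i in \<open>auto simp: bez_adj_right\<close>)
    finally show ?thesis using D i by simp
  qed
  have x: "(\<Sum>l<3. bezout f g i l * bez_solve f g r (3 + l)) = (if i = 2 then r 3 else 0)" if i: "i < 3" for i
  proof -
    have "(\<Sum>l<3. bezout f g i l * bez_solve f g r (3 + l)) = (\<Sum>l<3. bezout f g i l * bez_adj f g l 2) * r 3 / bez_det f g"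
      by (simp add: bez_solve_def sum_divide_distrib sum_distrib_right mult.assoc)
    then show ?thesis using D i by (simp add: bez_adj_right)
  qed
  from j show ?thesis
    unfolding less_4_cases bez_op_def by (elim disjE) (simp_all add: x y)
qed

lemma binary_form_3: "binary_form 3 f x y = f 0 * y^3 + f 1 * x * y^2 + f 2 * x^2 * y + f 3 * x^3"
  by (simp add: binary_form_def numeral_eq_Suc)

text \<open>With \<open>y = 1\<close>, the Bezoutian is \<open>f(x) u(x, \<eta>) - g(x) w(x, \<eta>)\<close> with the difference quotients
  \<open>u = (g(\<eta>) - g(x)) / (x - \<eta>)\<close> and \<open>w = (f(\<eta>) - f(x)) / (x - \<eta>)\<close>, and the second term vanishes at a zero
  \<open>x\<close> of \<open>g\<close>.  The essential point is that \<open>\<kappa>\<close> does not depend on \<open>f\<close>.\<close>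

lemma bezout_at_zero:
  assumes g: "binary_form 3 g x y = 0" and xy: "(x, y) \<noteq> (0, 0)"
  shows "\<exists>\<kappa>. \<forall>f. \<forall>j<3. (\<Sum>i<3. bezout f g i j * (x ^ i * y ^ (2 - i))) = \<kappa> j * binary_form 3 f x y"
proof (cases "y = 0")
  case True
  then have x: "x \<noteq> 0" "g 3 = 0" using xy g by (auto simp: binary_form_3)
  show ?thesis
  proof (intro exI allI impI)
    fix f :: "nat \<Rightarrow> complex" and j :: nat assume "j < 3"
    then show "(\<Sum>i<3. bezout f g i j * (x ^ i * y ^ (2 - i))) = (g j / x) * binary_form 3 f x y"
      unfolding less_3_cases sum_lessThan_3
      by (elim disjE) (use True x in \<open>simp_all add: binary_form_3 bezout_entries bezout_entries' power2_eq_square power3_eq_cube del: One_nat_def\<close>)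
  qed
next
  case False
  \<comment> \<open>\<open>u j\<close> is the coefficient of \<open>\<eta>\<^sup>j\<close> in the difference quotient of \<open>g\<close>, made homogeneous\<close>
  define u where "u j = (if j = 0 then - (g 1 * y^2 + g 2 * x * y + g 3 * x^2)
    else if j = 1 then - (g 2 * y + g 3 * x) else - g 3 :: complex)" for j :: nat
  show ?thesis
  proof (intro exI allI impI)
    fix f :: "nat \<Rightarrow> complex" and j :: nat assume j: "j < 3"
    define w where "w j = (if j = 0 then - (f 1 * y^2 + f 2 * x * y + f 3 * x^2)
      else if j = 1 then - (f 2 * y + f 3 * x) else - f 3 :: complex)" for j :: nat
    have "y ^ (3 - j) * (\<Sum>i<3. bezout f g i j * (x ^ i * y ^ (2 - i)))
        = u j * binary_form 3 f x y - w j * binary_form 3 g x y"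
      using j unfolding less_3_cases sum_lessThan_3 binary_form_3
      by (elim disjE) (simp_all add: u_def w_def bezout_entries' algebra_simps power2_eq_square power3_eq_cube)
    then show "(\<Sum>i<3. bezout f g i j * (x ^ i * y ^ (2 - i))) = (u j / y ^ (3 - j)) * binary_form 3 f x y"
      using False g by (simp add: field_simps)
  qed
qed

lemma bez_op_at_zero:
  assumes g: "binary_form 3 g x y = 0" and xy: "(x, y) \<noteq> (0, 0)"
  shows "\<exists>\<kappa>. \<forall>f. (\<Sum>j<4. x ^ j * y ^ (3 - j) * bez_op g a f j) = \<kappa> * binary_form 3 f x y"
proof -
  obtain \<kappa> where \<kappa>: "\<And>f j. j < 3 \<Longrightarrow>
      (\<Sum>i<3. bezout f g i j * (x ^ i * y ^ (2 - i))) = \<kappa> j * binary_form 3 f x y"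
    using bezout_at_zero[OF assms] by blast
  show ?thesis
  proof (intro exI allI)
    fix f
    have "(\<Sum>j<4. x ^ j * y ^ (3 - j) * bez_op g a f j)
       = (\<Sum>l<3. (\<Sum>i<3. bezout f g i l * (x ^ i * y ^ (2 - i))) * (y * a l + x * a (3 + l)))"
      unfolding sum_lessThan_3 sum_lessThan_4
      by (simp add: bez_op_def sum_lessThan_3 algebra_simps power2_eq_square power3_eq_cube)
    also have "\<dots> = (\<Sum>l<3. (\<kappa> l * binary_form 3 f x y) * (y * a l + x * a (3 + l)))"
      by (intro sum.cong refl) (simp only: \<kappa> lessThan_iff)
    also have "\<dots> = (\<Sum>l<3. \<kappa> l * (y * a l + x * a (3 + l))) * binary_form 3 f x y"
      unfolding sum_distrib_right by (intro sum.cong refl) (simp add: mult_ac)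
    finally show "(\<Sum>j<4. x ^ j * y ^ (3 - j) * bez_op g a f j)
       = (\<Sum>l<3. \<kappa> l * (y * a l + x * a (3 + l))) * binary_form 3 f x y" .
  qed
qed

lemma binary_form_sum: "binary_form 3 f x y = (\<Sum>j<4. x ^ j * y ^ (3 - j) * f j)"
  unfolding sum_lessThan_4 by (simp add: binary_form_3 algebra_simps)

lemma binary_form_mexp_bez_mat:
  assumes g: "binary_form 3 g x y = 0" and xy: "(x, y) \<noteq> (0, 0)"
  shows "\<exists>\<kappa>. binary_form 3 (mexp 4 (bez_mat g a) f) x y = exp \<kappa> * binary_form 3 f x y"
proof -
  obtain \<kappa> where \<kappa>: "\<And>f. (\<Sum>j<4. x ^ j * y ^ (3 - j) * bez_op g a f j) = \<kappa> * binary_form 3 f x y"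
    using bez_op_at_zero[OF assms] by blast
  have "(\<Sum>j<4. x ^ j * y ^ (3 - j) * bez_mat g a j l) = \<kappa> * (x ^ l * y ^ (3 - l))" if "l < 4" for l
  proof -
    have "binary_form 3 (\<lambda>i. if i = l then 1 else 0) x y = x ^ l * y ^ (3 - l)"
      using that unfolding binary_form_sum by (subst sum.remove[of _ l]) (auto intro!: sum.neutral)
    then show ?thesis using \<kappa>[of "\<lambda>i. if i = l then 1 else 0"] by (simp add: bez_mat_def)
  qed
  then show ?thesis
    unfolding binary_form_sum by (intro exI) (rule mexp_left_eigenvector)
qed


text \<open>A common factor of positive degree would have a root.\<close>

lemma dvd_of_no_common_root:
  fixes p q u :: "complex poly"
  assumes "\<And>t. \<not> (poly p t = 0 \<and> poly q t = 0)" "q dvd p * u" "q \<noteq> 0"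
  shows "q dvd u"
proof -
  have "coprime q p"
  proof (rule coprimeI)
    fix c assume c: "c dvd q" "c dvd p"
    have "degree c = 0"
    proof (rule ccontr)
      assume "degree c \<noteq> 0"
      then obtain t where "poly c t = 0"
        using fundamental_theorem_of_algebra[of c] by (auto simp: constant_degree)
      then have "poly p t = 0" "poly q t = 0"
        using c by (auto elim!: dvdE)
      then show False using assms(1) by blast
    qed
    moreover have "c \<noteq> 0" using c(1) assms(3) by auto
    ultimately show "is_unit c" by (simp add: is_unit_iff_degree)
  qed
  then show ?thesis using assms(2) by (simp add: coprime_dvd_mult_right_iff)
qed

lemma bezout_swap: "bezout g f i j = - bezout f g i j"
  unfolding bezout_def sum_negf[symmetric] by (intro sum.cong refl) (simp add: algebra_simps)

lemma bez_det_swap: "bez_det g f = - bez_det f g"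
  by (simp add: bez_det_def Let_def bezout_swap[of g f] algebra_simps)

lemma bez_det_kernel:
  assumes "bez_det f g = 0"
  shows "\<exists>a. (a 0 \<noteq> 0 \<or> a 1 \<noteq> 0 \<or> a 2 \<noteq> 0) \<and> (\<forall>i<3. (\<Sum>l<3. bezout f g i l * a l) = 0)"
proof -
  define B where "B = bezout f g"
  define A :: "complex^3^3" where
    "A = vector [vector [B 0 0, B 0 1, B 0 2], vector [B 1 0, B 1 1, B 1 2], vector [B 2 0, B 2 1, B 2 2]]"
  have "det A = bez_det f g"
    unfolding det_3 A_def bez_det_def Let_def B_def[symmetric] by (simp add: algebra_simps)
  then have "\<not> invertible A" using assms invertible_det_nz[of A] by simp
  then have "\<not> (\<exists>B. B ** A = mat 1)" using invertible_left_inverse[of A] by blast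
  then obtain x where x: "A *v x = 0" "x \<noteq> 0" using matrix_left_invertible_ker[of A] by blast
  define a where "a l = (if l = 0 then vec_nth x 1 else if l = 1 then vec_nth x 2 else vec_nth x 3)" for l :: nat
  have "(\<Sum>l<3. B i l * a l) = 0" if "i < 3" for i
    using that arg_cong[OF x(1), of "\<lambda>y. vec_nth y 1"] arg_cong[OF x(1), of "\<lambda>y. vec_nth y 2"] arg_cong[OF x(1), of "\<lambda>y. vec_nth y 3"]
    unfolding less_3_cases sum_lessThan_3
    by (elim disjE) (simp_all add: matrix_vector_mult_def sum_3 A_def a_def)
  moreover have "a 0 \<noteq> 0 \<or> a 1 \<noteq> 0 \<or> a 2 \<noteq> 0"
    using x(2) by (auto simp: a_def vec_eq_iff forall_3)
  ultimately show ?thesis unfolding B_def by blast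
qed

lemma no_common_zeroD:
  "no_common_zero d p q \<Longrightarrow> (x, y) \<noteq> (0, 0) \<Longrightarrow> binary_form d p x y = 0 \<Longrightarrow> binary_form d q x y \<noteq> 0"
  unfolding no_common_zero_def by blast

text \<open>A vector \<open>a\<close> in the kernel of the Bezout matrix gives a relation \<open>p U = q W\<close> with \<open>U\<close> and \<open>W\<close> of degree
  at most \<open>2\<close>, the contractions of the difference quotients of \<open>q\<close> and \<open>p\<close> with \<open>a\<close>.  Since \<open>q\<close> has degree
  \<open>3\<close> and is coprime to \<open>p\<close>, it follows that \<open>U = 0\<close>.  But \<open>U\<close> depends on \<open>a\<close> through a triangular matrix
  with diagonal entries \<open>g\<^sub>3 \<noteq> 0\<close>.\<close>

lemma bez_det_nonzero_aux:
  assumes ncz: "no_common_zero 3 f g" and g3: "g 3 \<noteq> 0"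
  shows "bez_det f g \<noteq> 0"
proof
  assume "bez_det f g = 0"
  then obtain a where a: "a 0 \<noteq> 0 \<or> a 1 \<noteq> 0 \<or> a 2 \<noteq> 0"
    and ker: "\<And>i. i < 3 \<Longrightarrow> (\<Sum>l<3. bezout f g i l * a l) = 0"
    using bez_det_kernel by blast
  define p where "p = [:f 0, f 1, f 2, f 3:]"
  define q where "q = [:g 0, g 1, g 2, g 3:]"
  define U where "U = [:a 0 * g 1 + a 1 * g 2 + a 2 * g 3, a 0 * g 2 + a 1 * g 3, a 0 * g 3:]"
  define W where "W = [:a 0 * f 1 + a 1 * f 2 + a 2 * f 3, a 0 * f 2 + a 1 * f 3, a 0 * f 3:]"
  have "poly (p * U) t = poly (q * W) t" for t
  proof -
    have "poly (q * W) t - poly (p * U) t = (\<Sum>i<3. t ^ i * (\<Sum>l<3. bezout f g i l * a l))"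
      unfolding sum_lessThan_3 bezout_entries
      by (simp add: p_def q_def U_def W_def algebra_simps power2_eq_square)
    also have "\<dots> = 0" using ker by (intro sum.neutral) auto
    finally show ?thesis by simp
  qed
  then have "p * U = q * W" by (auto simp: poly_eq_poly_eq_iff[symmetric] fun_eq_iff)
  then have qd: "q dvd p * U" by simp
  have ncr: "\<not> (poly p t = 0 \<and> poly q t = 0)" for t
  proof -
    have "poly p t = binary_form 3 f t 1" "poly q t = binary_form 3 g t 1"
      by (simp_all add: p_def q_def binary_form_3 algebra_simps power2_eq_square power3_eq_cube)
    then show ?thesis using no_common_zeroD[OF ncz, of t 1] by auto
  qed
  have dq: "degree q = 3" "q \<noteq> 0" using g3 by (auto simp: q_def)
  have "q dvd U" by (rule dvd_of_no_common_root[OF ncr qd dq(2)])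
  moreover have "degree U \<le> 2" by (simp add: U_def)
  ultimately have "U = 0" using dq(1) dvd_imp_degree_le[of q U] by linarith
  then show False using a g3 by (auto simp: U_def)
qed

text \<open>If \<open>g\<^sub>3 = 0\<close> then \<open>g\<close> vanishes at the point at infinity, so \<open>f\<close> does not, and the two forms can be
  exchanged.  Conversely, at a common zero \<open>(x, y)\<close> the vector \<open>(y\<^sup>2, x y, x\<^sup>2)\<close> is in the left kernel of
  the Bezout matrix.\<close>

theorem bez_det_nonzero_iff: "bez_det f g \<noteq> 0 \<longleftrightarrow> no_common_zero 3 f g"
proof
  assume ncz: "no_common_zero 3 f g"
  show "bez_det f g \<noteq> 0"
  proof (cases "g 3 = 0")
    case False
    then show ?thesis by (rule bez_det_nonzero_aux[OF ncz])
  next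
    case True
    have "binary_form 3 f 1 0 \<noteq> 0 \<or> binary_form 3 g 1 0 \<noteq> 0"
      using no_common_zeroD[OF ncz, of 1 0] by auto
    then have "f 3 \<noteq> 0" using True by (simp add: binary_form_3)
    moreover have "no_common_zero 3 g f" using ncz by (auto simp: no_common_zero_def)
    ultimately show ?thesis using bez_det_nonzero_aux[of g f] bez_det_swap[of g f] by simp
  qed
next
  assume D: "bez_det f g \<noteq> 0"
  show "no_common_zero 3 f g"
    unfolding no_common_zero_def
  proof
    assume "\<exists>x y. (x, y) \<noteq> (0, 0) \<and> binary_form 3 f x y = 0 \<and> binary_form 3 g x y = 0"
    then obtain x y where xy: "(x, y) \<noteq> (0, 0)" and f: "binary_form 3 f x y = 0" and g: "binary_form 3 g x y = 0"
      by blast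
    have z: "(\<Sum>k<3. bezout f g k j * (x ^ k * y ^ (2 - k))) = 0" if "j < 3" for j
      using bezout_at_zero[OF g xy] f that by (metis mult_zero_right)
    have "bez_det f g * (x ^ i * y ^ (2 - i)) = 0" if i: "i < 3" for i
    proof -
      have "bez_det f g * (x ^ i * y ^ (2 - i)) = (\<Sum>k<3. (if k = i then bez_det f g else 0) * (x ^ k * y ^ (2 - k)))"
        using i by (simp add: if_distrib[of "\<lambda>a. a * _"] cong: if_cong)
      also have "\<dots> = (\<Sum>k<3. (\<Sum>j<3. bezout f g k j * bez_adj f g j i) * (x ^ k * y ^ (2 - k)))"
        using i by (intro sum.cong refl) (simp only: bez_adj_right lessThan_iff)
      also have "\<dots> = (\<Sum>j<3. (\<Sum>k<3. bezout f g k j * (x ^ k * y ^ (2 - k))) * bez_adj f g j i)"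
        unfolding sum_distrib_right by (subst sum.swap) (simp add: mult_ac)
      also have "\<dots> = 0" using z by (intro sum.neutral) auto
      finally show ?thesis .
    qed
    from this[of 0] this[of 2] D have "x = 0" "y = 0" by auto
    then show False using xy by simp
  qed
qed

text \<open>Moves \<open>f\<close> with initial velocity \<open>r\<close> while \<open>g\<close> stays fixed.\<close>

definition bez_flow :: "(nat \<Rightarrow> complex) \<Rightarrow> (nat \<Rightarrow> complex) \<Rightarrow> (nat \<Rightarrow> complex) \<Rightarrow> nat \<Rightarrow> complex" where
  "bez_flow f g r j = (if j < 4 then mexp 4 (bez_mat g (bez_solve f g r)) f j else 0)"

lemma binary_form_cong: "(\<And>i. i < 4 \<Longrightarrow> f i = f' i) \<Longrightarrow> binary_form 3 f x y = binary_form 3 f' x y"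
  by (simp add: binary_form_3)

text \<open>At a zero of \<open>g\<close> the values of the new form and of \<open>f\<close> differ by a nonvanishing factor
  (\<open>binary_form_mexp_bez_mat\<close>).\<close>

lemma bez_det_flow:
  assumes "bez_det f g \<noteq> 0"
  shows "bez_det (bez_flow f g r) g \<noteq> 0"
  unfolding bez_det_nonzero_iff no_common_zero_def
proof
  assume "\<exists>x y. (x, y) \<noteq> (0, 0) \<and> binary_form 3 (bez_flow f g r) x y = 0 \<and> binary_form 3 g x y = 0"
  then obtain x y where xy: "(x, y) \<noteq> (0, 0)" and f: "binary_form 3 (bez_flow f g r) x y = 0"
    and g: "binary_form 3 g x y = 0" by blast
  obtain \<kappa> where "binary_form 3 (mexp 4 (bez_mat g (bez_solve f g r)) f) x y = exp \<kappa> * binary_form 3 f x y"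
    using binary_form_mexp_bez_mat[OF g xy] by blast
  then have "binary_form 3 f x y = 0"
    using f binary_form_cong[of "bez_flow f g r" "mexp 4 (bez_mat g (bez_solve f g r)) f" x y]
    by (simp add: bez_flow_def)
  then show False using no_common_zeroD[OF assms[unfolded bez_det_nonzero_iff] xy] g by simp
qed

lemma bez_solve_scale: "bez_solve f g (cscale t r) l = t * bez_solve f g r l"
  by (simp add: bez_solve_def sum_distrib_left mult_ac)

lemma bez_mat_scale: "bez_mat g (\<lambda>l. t * a l) j k = t * bez_mat g a j k"
  by (simp add: bez_mat_def bez_op_def sum_distrib_left mult_ac distrib_left)

lemma bez_flow_zero: "j < 4 \<Longrightarrow> bez_flow f g (\<lambda>_. 0) j = f j"
proof -
  assume j: "j < 4"
  have "bez_solve f g (\<lambda>_. 0) = (\<lambda>_. 0)"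
    by (rule ext) (use bez_solve_scale[of f g 0 "\<lambda>_. 0"] in simp)
  moreover have "bez_mat g (\<lambda>_. 0) = (\<lambda>_ _. 0)"
    by (intro ext) (use bez_mat_scale[of g 0 "\<lambda>_. 0"] in simp)
  ultimately show ?thesis using mexp_zero[OF j] j by (simp add: bez_flow_def)
qed

lemma bezout_hom: "bezout (cscale c f) (cscale c g) i j = c\<^sup>2 * bezout f g i j"
  by (simp add: bezout_def sum_distrib_left power2_eq_square right_diff_distrib mult_ac)

lemma bez_det_hom: "bez_det (cscale c f) (cscale c g) = c ^ 6 * bez_det f g"
proof -
  define k where "k = c\<^sup>2"
  have "c ^ 6 = k * (k * k)" by (simp add: k_def power_add[symmetric])
  then show ?thesis by (simp add: bez_det_def Let_def bezout_hom k_def[symmetric] algebra_simps)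
qed

lemma bez_adj_hom: "bez_adj (cscale c f) (cscale c g) i j = c ^ 4 * bez_adj f g i j"
proof -
  define k where "k = c\<^sup>2"
  have "c ^ 4 = k * k" by (simp add: k_def power_add[symmetric])
  then show ?thesis by (simp add: bez_adj_def Let_def bezout_hom k_def[symmetric] algebra_simps)
qed

lemma bez_solve_hom:
  assumes "c \<noteq> 0"
  shows "bez_solve (cscale c f) (cscale c g) (cscale c r) l = bez_solve f g r l / c"
proof -
  have c5: "c ^ 5 = c * c ^ 4" and c6: "c ^ 6 = c * (c * c ^ 4)" by (simp_all add: eval_nat_numeral)
  have "(\<Sum>i<3. c ^ 4 * bez_adj f g l i * (c * r i)) = c * c ^ 4 * (\<Sum>i<3. bez_adj f g l i * r i)"
    by (simp add: sum_distrib_left mult_ac)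
  then show ?thesis
    using assms unfolding bez_solve_def bez_det_hom bez_adj_hom cscale_apply c6
    by (simp add: field_simps)
qed

lemma bezout_scale_right: "bezout f (cscale c g) i j = c * bezout f g i j"
  by (simp add: bezout_def sum_distrib_left right_diff_distrib mult_ac)

lemma bez_mat_hom:
  assumes "c \<noteq> 0"
  shows "bez_mat (cscale c g) (\<lambda>l. a l / c) j k = bez_mat g a j k"
  using assms by (simp add: bez_mat_def bez_op_def bezout_scale_right)

text \<open>The contraction vectors of \<open>bez_solve\<close> are homogeneous of degree \<open>-1\<close> in \<open>(f, g, r)\<close> and the operators are
  linear in \<open>g\<close>, so the matrix in the exponential does not change under scaling.\<close>

lemma bez_flow_hom:
  assumes "c \<noteq> 0"
  shows "bez_flow (cscale c f) (cscale c g) (cscale c r) = cscale c (bez_flow f g r)"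
proof
  fix j
  have "bez_solve (cscale c f) (cscale c g) (cscale c r) = (\<lambda>l. bez_solve f g r l / c)"
    by (rule ext) (rule bez_solve_hom[OF assms])
  moreover have "bez_mat (cscale c g) (\<lambda>l. bez_solve f g r l / c) = bez_mat g (bez_solve f g r)"
    by (intro ext) (rule bez_mat_hom[OF assms])
  ultimately show "bez_flow (cscale c f) (cscale c g) (cscale c r) j = cscale c (bez_flow f g r) j"
    by (simp add: bez_flow_def cscale_def mexp_scale)
qed

lemma hol_fun_bezout:
  assumes "\<And>i. hol_fun n S (\<lambda>z. f z i)" "\<And>i. hol_fun n S (\<lambda>z. g z i)"
  shows "hol_fun n S (\<lambda>z. bezout (f z) (g z) i j)"
  unfolding bezout_def by (intro hol_fun_sum hol_fun_diff hol_fun_mult assms)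

lemma hol_fun_bez_det:
  assumes "\<And>i. hol_fun n S (\<lambda>z. f z i)" "\<And>i. hol_fun n S (\<lambda>z. g z i)"
  shows "hol_fun n S (\<lambda>z. bez_det (f z) (g z))"
  unfolding bez_det_def Let_def by (intro hol_fun_add hol_fun_diff hol_fun_mult hol_fun_bezout assms)

lemma hol_fun_bez_adj:
  assumes "\<And>i. hol_fun n S (\<lambda>z. f z i)" "\<And>i. hol_fun n S (\<lambda>z. g z i)"
  shows "hol_fun n S (\<lambda>z. bez_adj (f z) (g z) i j)"
  unfolding bez_adj_def Let_def by (intro hol_fun_add hol_fun_diff hol_fun_mult hol_fun_bezout assms)

lemma hol_fun_bez_solve:
  assumes "\<And>i. hol_fun n S (\<lambda>z. f z i)" "\<And>i. hol_fun n S (\<lambda>z. g z i)" "\<And>i. hol_fun n S (\<lambda>z. r z i)"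
    and "\<And>z. z \<in> S \<Longrightarrow> bez_det (f z) (g z) \<noteq> 0"
  shows "hol_fun n S (\<lambda>z. bez_solve (f z) (g z) (r z) l)"
proof (cases "l < 3")
  case True
  have "hol_fun n S (\<lambda>z. (\<Sum>i<3. bez_adj (f z) (g z) l i * r z i) / bez_det (f z) (g z))"
    by (intro hol_fun_divide hol_fun_sum hol_fun_mult hol_fun_bez_adj hol_fun_bez_det assms)
  then show ?thesis using True by (simp add: bez_solve_def)
next
  case False
  have "hol_fun n S (\<lambda>z. bez_adj (f z) (g z) (l - 3) 2 * r z 3 / bez_det (f z) (g z))"
    by (intro hol_fun_divide hol_fun_sum hol_fun_mult hol_fun_bez_adj hol_fun_bez_det assms)
  then show ?thesis using False by (simp add: bez_solve_def)
qed

lemma hol_fun_bez_mat: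
  assumes g: "\<And>i. hol_fun n S (\<lambda>z. g z i)" and a: "\<And>i. hol_fun n S (\<lambda>z. a z i)"
  shows "hol_fun n S (\<lambda>z. bez_mat (g z) (a z) j k)"
proof -
  have 1: "hol_fun n S (\<lambda>z. \<Sum>l<3. bezout (\<lambda>i. if i = k then 1 else 0) (g z) i l * a z (c + l))" for i c
    by (intro hol_fun_sum hol_fun_mult hol_fun_bezout g a hol_fun_const)
  have "hol_fun n S (\<lambda>z. if P then h z else 0)" if "hol_fun n S h" for P h
    using that by (cases P) auto
  then show ?thesis
    unfolding bez_mat_def bez_op_def by (intro hol_fun_add) (use 1[of _ 0] 1[of _ 3] in simp_all)
qed

lemma hol_fun_bez_flow:
  assumes S: "openin (Ctop n) S"
    and "\<And>i. hol_fun n S (\<lambda>z. f z i)" "\<And>i. hol_fun n S (\<lambda>z. g z i)" "\<And>i. hol_fun n S (\<lambda>z. r z i)"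
    and "\<And>z. z \<in> S \<Longrightarrow> bez_det (f z) (g z) \<noteq> 0"
  shows "hol_fun n S (\<lambda>z. bez_flow (f z) (g z) (r z) j)"
proof (cases "j < 4")
  case True
  have "hol_fun n S (\<lambda>z. mexp 4 (bez_mat (g z) (bez_solve (f z) (g z) (r z))) (f z) j)"
    by (intro hol_fun_mexp[OF S] hol_fun_bez_mat hol_fun_bez_solve assms True)
  then show ?thesis using True by (simp add: bez_flow_def)
qed (simp add: bez_flow_def)

text \<open>The form \<open>g\<close> varies with \<open>t\<close> because in \<open>cone_spray\<close> the second form is moved against the first one, which
  has already been moved.\<close>

lemma bez_flow_has_derivative:
  assumes j: "j < 4" and g: "\<And>i. i < 4 \<Longrightarrow> (\<lambda>t. g t i) field_differentiable at 0" and g4: "\<And>t. g t \<in> Cset 4"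
    and nz: "\<And>t. bez_det f (g t) \<noteq> 0"
  shows "((\<lambda>t. bez_flow f (g t) (cscale t r) j) has_field_derivative r j) (at 0)"
proof -
  define M where "M = (\<lambda>t. bez_mat (g t) (bez_solve f (g t) r))"
  have eq: "bez_flow f (g t) (cscale t r) j = mexp 4 (\<lambda>j l. t * M t j l) f j" for t
  proof -
    have "bez_mat (g t) (bez_solve f (g t) (cscale t r)) = (\<lambda>j l. t * M t j l)"
    proof (intro ext)
      fix j l
      have "bez_solve f (g t) (cscale t r) = (\<lambda>l. t * bez_solve f (g t) r l)"
        by (rule ext) (rule bez_solve_scale)
      then show "bez_mat (g t) (bez_solve f (g t) (cscale t r)) j l = t * M t j l"
        by (simp only: M_def bez_mat_scale)
    qed
    then show ?thesis using j by (simp add: bez_flow_def)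
  qed
  have cont: "isCont (\<lambda>t. M t i l) 0" for i l
  proof -
    define V where "V = {z \<in> Cset 4. bez_det f z \<in> - {0}}"
    have h: "hol_fun 4 (Cset 4) (\<lambda>z. bez_det f z)"
      by (intro hol_fun_bez_det hol_fun_const hol_fun_coord)
    have V: "openin (Ctop 4) V" unfolding V_def
      by (rule openin_Ctop_continuous_preimage[OF openin_Ctop_UNIV hol_fun_cont[OF h]]) auto
    have hV: "hol_fun 4 V (\<lambda>z. bez_mat z (bez_solve f z r) i l)"
      by (intro hol_fun_bez_mat hol_fun_bez_solve hol_fun_const hol_fun_coord) (auto simp: V_def)
    have gV: "g t \<in> V" for t using g4 nz by (simp add: V_def)
    have "((\<lambda>t. bez_mat (g t) (bez_solve f (g t) r) i l) has_field_derivative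
        (\<Sum>k<4. deriv (\<lambda>t. bez_mat ((g 0)(k := t)) (bez_solve f ((g 0)(k := t)) r) i l) (g 0 k) * deriv (\<lambda>t. g t k) 0)) (at 0)"
      by (rule hol_fun_curve[OF V hV gV]) (use g gV in \<open>simp_all add: DERIV_deriv_iff_field_differentiable\<close>)
    then show ?thesis unfolding M_def by (rule DERIV_isCont)
  qed
  have "(\<Sum>l<4. M 0 j l * f l) = r j"
    unfolding M_def by (simp add: bez_mat_apply[OF j] bez_op_solve[OF nz j])
  then show ?thesis
    using mexp_has_derivative_at_0[of 4 M, OF cont j, of f] by (simp add: eq)
qed

section \<open>The spray on the cone\<close>

definition denominator :: "(nat \<Rightarrow> complex) \<Rightarrow> nat \<Rightarrow> complex" where
  "denominator v = (\<lambda>i. v (4 + i))"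

definition numerator :: "(nat \<Rightarrow> complex) \<Rightarrow> nat \<Rightarrow> complex" where
  "numerator v = (\<lambda>i. if i < 4 then v i else 0)"

definition resultant :: "(nat \<Rightarrow> complex) \<Rightarrow> complex" where
  "resultant v = bez_det (numerator v) (denominator v)"

definition map_cone :: "(nat \<Rightarrow> complex) set" where
  "map_cone = {v \<in> Cset 8. resultant v \<noteq> 0}"

definition cone_spray :: "(nat \<Rightarrow> complex) \<Rightarrow> (nat \<Rightarrow> complex) \<Rightarrow> nat \<Rightarrow> complex" where
  "cone_spray v r = (let p = bez_flow (numerator v) (denominator v) (numerator r) in
     (\<lambda>j. if j < 4 then p j else if j < 8 then bez_flow (denominator v) p (denominator r) (j - 4) else 0))"

lemma numerator_apply [simp]: "i < 4 \<Longrightarrow> numerator v i = v i"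
  by (simp add: numerator_def)

lemma denominator_apply [simp]: "denominator v i = v (4 + i)"
  by (simp add: denominator_def)

lemma bez_flow_Cset [simp]: "bez_flow f g r \<in> Cset 4"
  by (simp add: Cset_def bez_flow_def)

lemma numerator_cone_spray: "numerator (cone_spray v r) = bez_flow (numerator v) (denominator v) (numerator r)"
  by (rule ext) (simp add: numerator_def cone_spray_def Let_def bez_flow_def)

lemma denominator_cone_spray: "denominator (cone_spray v r) = bez_flow (denominator v) (numerator (cone_spray v r)) (denominator r)"
  unfolding numerator_cone_spray by (rule ext) (simp add: cone_spray_def Let_def bez_flow_def)

lemma cone_spray_Cset: "cone_spray v r \<in> Cset 8"
  by (simp add: Cset_def cone_spray_def Let_def)

lemma bez_det_flow_swapped:
  assumes "v \<in> map_cone"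
  shows "bez_det (denominator v) (bez_flow (numerator v) (denominator v) r) \<noteq> 0"
  using bez_det_flow[of "numerator v" "denominator v" r] assms bez_det_swap[of "denominator v"]
  by (simp add: map_cone_def resultant_def)

lemma cone_spray_cone:
  assumes "v \<in> map_cone"
  shows "cone_spray v r \<in> map_cone"
proof -
  have "bez_det (denominator (cone_spray v r)) (numerator (cone_spray v r)) \<noteq> 0"
    unfolding denominator_cone_spray using bez_det_flow_swapped[OF assms] by (intro bez_det_flow) (simp add: numerator_cone_spray)
  then show ?thesis
    using bez_det_swap[of "denominator (cone_spray v r)"] by (simp add: map_cone_def resultant_def cone_spray_Cset)
qed

lemma cone_spray_zero: "v \<in> Cset 8 \<Longrightarrow> cone_spray v (\<lambda>_. 0) = v"
proof
  fix j assume v: "v \<in> Cset 8"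
  have t0: "numerator (\<lambda>_. 0) = (\<lambda>_. 0)" "denominator (\<lambda>_. 0) = (\<lambda>_. 0)" by (auto simp: numerator_def denominator_def)
  show "cone_spray v (\<lambda>_. 0) j = v j"
    using v by (auto simp: cone_spray_def Let_def t0 bez_flow_zero Cset_def)
qed

lemma numerator_cscale: "numerator (cscale c v) = cscale c (numerator v)"
  by (auto simp: numerator_def)

lemma denominator_cscale: "denominator (cscale c v) = cscale c (denominator v)"
  by (auto simp: denominator_def)

lemma cone_spray_hom: "c \<noteq> 0 \<Longrightarrow> cone_spray (cscale c v) (cscale c r) = cscale c (cone_spray v r)"
  by (rule ext) (simp add: cone_spray_def Let_def numerator_cscale denominator_cscale bez_flow_hom)

lemma resultant_hom: "resultant (cscale c v) = c ^ 6 * resultant v"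
  by (simp add: resultant_def numerator_cscale denominator_cscale bez_det_hom)

lemma cone_cscale: "c \<noteq> 0 \<Longrightarrow> cscale c v \<in> map_cone \<longleftrightarrow> v \<in> map_cone"
  by (auto simp: map_cone_def resultant_hom Cset_def)

lemma hol_fun_numerator:
  assumes "\<And>i. hol_fun n S (\<lambda>z. f z i)"
  shows "hol_fun n S (\<lambda>z. numerator (f z) i)"
  using assms by (cases "i < 4") (auto simp: numerator_def)

lemma hol_fun_resultant:
  assumes "\<And>i. hol_fun n S (\<lambda>z. f z i)"
  shows "hol_fun n S (\<lambda>z. resultant (f z))"
  unfolding resultant_def by (intro hol_fun_bez_det hol_fun_numerator) (simp_all add: assms)

lemma openin_cone: "openin (Ctop 8) map_cone"
proof -
  have h: "hol_fun 8 (Cset 8) (\<lambda>z. resultant z)" by (rule hol_fun_resultant) simp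
  have "openin (Ctop 8) {z \<in> Cset 8. resultant z \<in> - {0}}"
    by (rule openin_Ctop_continuous_preimage[OF openin_Ctop_UNIV hol_fun_cont[OF h]]) auto
  then show ?thesis by (simp add: map_cone_def)
qed

lemma hol_fun_cone_spray:
  assumes S: "openin (Ctop n) S"
    and v: "\<And>i. hol_fun n S (\<lambda>z. v z i)" and r: "\<And>i. hol_fun n S (\<lambda>z. r z i)"
    and map_cone: "\<And>z. z \<in> S \<Longrightarrow> v z \<in> map_cone"
  shows "hol_fun n S (\<lambda>z. cone_spray (v z) (r z) j)"
proof -
  have p: "hol_fun n S (\<lambda>z. bez_flow (numerator (v z)) (denominator (v z)) (numerator (r z)) i)" for i
    by (intro hol_fun_bez_flow[OF S] hol_fun_numerator) (use v r map_cone in \<open>auto simp: map_cone_def resultant_def\<close>)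
  have q: "hol_fun n S (\<lambda>z. bez_flow (denominator (v z)) (bez_flow (numerator (v z)) (denominator (v z)) (numerator (r z))) (denominator (r z)) i)" for i
    by (intro hol_fun_bez_flow[OF S] p) (use v r bez_det_flow_swapped[OF map_cone] in simp_all)
  show ?thesis
    unfolding cone_spray_def Let_def using p[of j] q[of "j - 4"] by (cases "j < 4"; cases "j < 8") auto
qed

lemma cone_spray_has_derivative:
  assumes v: "v \<in> map_cone" and j: "j < 8"
  shows "((\<lambda>t. cone_spray v (cscale t r) j) has_field_derivative r j) (at 0)"
proof -
  have D: "bez_det (numerator v) (denominator v) \<noteq> 0" using v by (simp add: map_cone_def resultant_def)
  define p where "p = (\<lambda>t. bez_flow (numerator v) (denominator v) (cscale t (numerator r)))"
  have bot4: "denominator v \<in> Cset 4" using v by (simp add: map_cone_def Cset_def)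
  have p': "((\<lambda>t. p t i) has_field_derivative r i) (at 0)" if "i < 4" for i
    using bez_flow_has_derivative[of i "\<lambda>_. denominator v" "numerator v" "numerator r"] D that bot4
    by (simp add: p_def)
  show ?thesis
  proof (cases "j < 4")
    case True
    then show ?thesis using p'[OF True] by (simp add: cone_spray_def Let_def p_def numerator_cscale)
  next
    case False
    have nz: "bez_det (denominator v) (p t) \<noteq> 0" for t
      unfolding p_def by (rule bez_det_flow_swapped[OF v])
    have "((\<lambda>t. bez_flow (denominator v) (p t) (cscale t (denominator r)) (j - 4)) has_field_derivative denominator r (j - 4)) (at 0)"
      by (rule bez_flow_has_derivative) (use nz p' j False in \<open>auto simp: p_def field_differentiable_def\<close>)
    then show ?thesis using False j by (simp add: cone_spray_def Let_def p_def numerator_cscale denominator_cscale)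
  qed
qed

section \<open>Normalization of representatives\<close>

text \<open>A linear functional of \<open>u\<close> that depends holomorphically on \<open>v\<close> and takes the value \<open>1\<close> at \<open>u = v\<close>: replace
  \<open>p\<close> by the numerator of \<open>u\<close> in the first row of the Bezout matrix in the expansion of its determinant.  For a line
  near that of \<open>v\<close>, the point \<open>u\<close> of the line where the functional is \<open>1\<close> is a representative that varies
  holomorphically.\<close>

definition normalizer :: "(nat \<Rightarrow> complex) \<Rightarrow> (nat \<Rightarrow> complex) \<Rightarrow> complex" where
  "normalizer v u = (\<Sum>j<3. bezout u (denominator v) 0 j * bez_adj (numerator v) (denominator v) j 0) / resultant v"

lemma bezout_cong: "(\<And>i. i < 4 \<Longrightarrow> f i = f' i) \<Longrightarrow> j < 3 \<Longrightarrow> bezout f g 0 j = bezout f' g 0 j"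
  unfolding less_3_cases by (auto simp: bezout_entries bezout_entries')

lemma normalizer_self: "v \<in> map_cone \<Longrightarrow> normalizer v v = 1"
proof -
  assume v: "v \<in> map_cone"
  have "(\<Sum>j<3. bezout v (denominator v) 0 j * bez_adj (numerator v) (denominator v) j 0)
      = (\<Sum>j<3. bezout (numerator v) (denominator v) 0 j * bez_adj (numerator v) (denominator v) j 0)"
    by (intro sum.cong refl arg_cong2[where f = "(*)"] bezout_cong) auto
  then show ?thesis using v by (simp add: normalizer_def bez_adj_right map_cone_def resultant_def)
qed

lemma normalizer_scale: "normalizer v (cscale c u) = c * normalizer v u"
proof -
  have "bezout (cscale c u) g 0 j = c * bezout u g 0 j" for g j
    by (simp add: bezout_def right_diff_distrib mult_ac)
  then show ?thesis by (simp add: normalizer_def sum_distrib_left mult_ac)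
qed

lemma normalizer_scale_left:
  assumes "c \<noteq> 0"
  shows "normalizer (cscale c v) u = normalizer v u / c"
proof -
  have c5: "c ^ 5 = c * c ^ 4" by (simp add: eval_nat_numeral)
  have "c ^ 6 = c ^ 5 * c" by (simp add: eval_nat_numeral)
  moreover have "(\<Sum>j<3. bezout u (denominator (cscale c v)) 0 j * bez_adj (numerator (cscale c v)) (denominator (cscale c v)) j 0)
     = c ^ 5 * (\<Sum>j<3. bezout u (denominator v) 0 j * bez_adj (numerator v) (denominator v) j 0)"
    by (simp add: sum_distrib_left numerator_cscale denominator_cscale bez_adj_hom bezout_scale_right c5 mult_ac)
  ultimately show ?thesis using assms by (simp add: normalizer_def resultant_hom)
qed

lemma hol_fun_normalizer:
  assumes "\<And>i. hol_fun n S (\<lambda>z. v z i)" "\<And>i. hol_fun n S (\<lambda>z. u z i)" "\<And>z. z \<in> S \<Longrightarrow> v z \<in> map_cone"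
  shows "hol_fun n S (\<lambda>z. normalizer (v z) (u z))"
  unfolding normalizer_def
  by (intro hol_fun_divide hol_fun_sum hol_fun_mult hol_fun_bezout hol_fun_bez_adj hol_fun_numerator hol_fun_resultant)
    (use assms in \<open>auto simp: map_cone_def\<close>)


section \<open>Complex manifolds\<close>

lemma topspace_Ctop [simp]: "topspace (Ctop n) = Cset n"
  by (simp add: Ctop_def)

lemma continuous_map_into_Ctop:
  "continuous_map X (Ctop n) f \<longleftrightarrow>
     f ` topspace X \<subseteq> Cset n \<and> (\<forall>i<n. continuous_map X euclidean (\<lambda>x. f x i))"
proof -
  have "continuous_map X (Ctop n) f \<longleftrightarrow> f ` topspace X \<subseteq> Cset n \<and> continuous_map X euclidean f"
    unfolding Ctop_def by (auto simp: continuous_map_in_subtopology)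
  also have "continuous_map X euclidean f \<longleftrightarrow> (\<forall>i. continuous_map X euclidean (\<lambda>x. f x i))"
    unfolding euclidean_product_topology[symmetric] by (rule continuous_map_componentwise_UNIV)
  finally have 1: "continuous_map X (Ctop n) f \<longleftrightarrow> f ` topspace X \<subseteq> Cset n \<and> (\<forall>i. continuous_map X euclidean (\<lambda>x. f x i))" .
  have "continuous_map X euclidean (\<lambda>x. f x i)" if "f ` topspace X \<subseteq> Cset n" "\<not> i < n" for i
  proof (rule continuous_map_eq)
    show "continuous_map X euclidean (\<lambda>x. 0 :: complex)" by simp
    show "0 = f x i" if "x \<in> topspace X" for x
      using that \<open>f ` topspace X \<subseteq> Cset n\<close> \<open>\<not> i < n\<close> by (fastforce simp: Cset_def)
  qed
  then show ?thesis unfolding 1 by blast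
qed

lemma continuous_map_Ctop_coord: "continuous_map (Ctop n) euclidean (\<lambda>z. z i)"
  unfolding Ctop_def
  by (intro continuous_map_from_subtopology) (simp add: continuous_on_product_coordinates)

lemma complex_manifoldD:
  assumes "complex_manifold M"
  shows "Hausdorff_space (cm_top M)" "second_countable (cm_top M)"
    "(\<Union>c\<in>cm_atlas M. fst c) = topspace (cm_top M)"
    "\<And>c. c \<in> cm_atlas M \<Longrightarrow> openin (cm_top M) (fst c)"
    "\<And>c. c \<in> cm_atlas M \<Longrightarrow> openin (Ctop (cm_dim M)) (snd c ` fst c)"
    "\<And>c. c \<in> cm_atlas M \<Longrightarrow> homeomorphic_map (subtopology (cm_top M) (fst c))
        (subtopology (Ctop (cm_dim M)) (snd c ` fst c)) (snd c)"
    "\<And>c d. c \<in> cm_atlas M \<Longrightarrow> d \<in> cm_atlas M \<Longrightarrow>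
        holo_on (cm_dim M) (cm_dim M) (snd c ` (fst c \<inter> fst d)) (in_chart c (snd d))"
  using assms unfolding complex_manifold_def by (auto simp: case_prod_beta)

context
  fixes M :: "'a cmanifold" and c :: "'a cchart"
  assumes M: "complex_manifold M" and c: "c \<in> cm_atlas M"
begin

lemma chart_subset: "fst c \<subseteq> topspace (cm_top M)"
  using complex_manifoldD(4)[OF M c] openin_subset by blast

lemma chart_inj: "inj_on (snd c) (fst c)"
proof -
  have "inj_on (snd c) (topspace (subtopology (cm_top M) (fst c)))"
    using complex_manifoldD(6)[OF M c] unfolding homeomorphic_eq_everything_map by blast
  then show ?thesis using chart_subset by (simp add: inf.absorb2)
qed

lemma in_chart_apply: "x \<in> fst c \<Longrightarrow> in_chart c G (snd c x) = G x"
  using chart_inj by (simp add: in_chart_def)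

lemma chart_in_Cset: "x \<in> fst c \<Longrightarrow> snd c x \<in> Cset (cm_dim M)"
  using openin_Ctop_subset[OF complex_manifoldD(5)[OF M c]] by auto

lemma chart_continuous: "continuous_map (subtopology (cm_top M) (fst c)) (Ctop (cm_dim M)) (snd c)"
  using homeomorphic_imp_continuous_map[OF complex_manifoldD(6)[OF M c]]
  by (auto simp: continuous_map_in_subtopology)

lemma chart_image_open:
  assumes "openin (cm_top M) T" "T \<subseteq> fst c"
  shows "openin (Ctop (cm_dim M)) (snd c ` T)"
proof -
  have "openin (subtopology (cm_top M) (fst c)) T"
    using assms by (metis openin_subtopology inf.absorb1)
  then have "openin (subtopology (Ctop (cm_dim M)) (snd c ` fst c)) (snd c ` T)"
    using homeomorphic_imp_open_map[OF complex_manifoldD(6)[OF M c]] unfolding open_map_def by blast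
  then show ?thesis using complex_manifoldD(5)[OF M c] by (rule openin_trans_full)
qed

end

text \<open>Holomorphy may be checked coordinate by coordinate in charts, by \<open>holo_on_iff_hol_fun\<close>; the sets in
  question are open because \<open>f\<close> is continuous.\<close>

lemma holomorphic_mapI:
  assumes M: "complex_manifold M" and N: "complex_manifold N" and f: "continuous_map (cm_top M) (cm_top N) f"
    and loc: "\<And>c d j. c \<in> cm_atlas M \<Longrightarrow> d \<in> cm_atlas N \<Longrightarrow> j < cm_dim N \<Longrightarrow>
       hol_fun (cm_dim M) (snd c ` {x \<in> fst c. f x \<in> fst d}) (\<lambda>z. in_chart c (snd d \<circ> f) z j)"
  shows "holomorphic_map M N f"
  unfolding holomorphic_map_def
proof (intro conjI ballI f)
  fix c d assume c: "c \<in> cm_atlas M" and d: "d \<in> cm_atlas N"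
  have "openin (cm_top M) {x \<in> topspace (cm_top M). f x \<in> fst d}"
    by (rule openin_continuous_map_preimage[OF f complex_manifoldD(4)[OF N d]])
  then have "openin (cm_top M) (fst c \<inter> {x \<in> topspace (cm_top M). f x \<in> fst d})"
    by (rule openin_Int[OF complex_manifoldD(4)[OF M c]])
  moreover have "fst c \<inter> {x \<in> topspace (cm_top M). f x \<in> fst d} = {x \<in> fst c. f x \<in> fst d}"
    using chart_subset[OF M c] by auto
  ultimately have "openin (Ctop (cm_dim M)) (snd c ` {x \<in> fst c. f x \<in> fst d})"
    by (intro chart_image_open[OF M c]) auto
  then show "holo_on (cm_dim M) (cm_dim N) (snd c ` {x \<in> fst c. f x \<in> fst d}) (in_chart c (snd d \<circ> f))"
    using loc[OF c d] chart_in_Cset[OF N d]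
    by (subst holo_on_iff_hol_fun) (auto simp: in_chart_apply[OF M c])
qed

lemma holomorphic_mapD:
  assumes M: "complex_manifold M" and N: "complex_manifold N" and f: "holomorphic_map M N f"
    and c: "c \<in> cm_atlas M" and d: "d \<in> cm_atlas N"
  shows "continuous_map (cm_top M) (cm_top N) f"
    "openin (cm_top M) {x \<in> fst c. f x \<in> fst d}"
    "openin (Ctop (cm_dim M)) (snd c ` {x \<in> fst c. f x \<in> fst d})"
    "\<And>j. j < cm_dim N \<Longrightarrow>
       hol_fun (cm_dim M) (snd c ` {x \<in> fst c. f x \<in> fst d}) (\<lambda>z. in_chart c (snd d \<circ> f) z j)"
proof -
  show f': "continuous_map (cm_top M) (cm_top N) f" using f by (simp add: holomorphic_map_def)
  have "openin (cm_top M) {x \<in> topspace (cm_top M). f x \<in> fst d}"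
    by (rule openin_continuous_map_preimage[OF f' complex_manifoldD(4)[OF N d]])
  then have "openin (cm_top M) (fst c \<inter> {x \<in> topspace (cm_top M). f x \<in> fst d})"
    by (rule openin_Int[OF complex_manifoldD(4)[OF M c]])
  moreover have "fst c \<inter> {x \<in> topspace (cm_top M). f x \<in> fst d} = {x \<in> fst c. f x \<in> fst d}"
    using chart_subset[OF M c] by auto
  ultimately show "openin (cm_top M) {x \<in> fst c. f x \<in> fst d}" by simp
  then show o: "openin (Ctop (cm_dim M)) (snd c ` {x \<in> fst c. f x \<in> fst d})"
    by (intro chart_image_open[OF M c]) auto
  show "hol_fun (cm_dim M) (snd c ` {x \<in> fst c. f x \<in> fst d}) (\<lambda>z. in_chart c (snd d \<circ> f) z j)"
    if "j < cm_dim N" for j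
    using f c d that holo_on_iff_hol_fun[OF o] unfolding holomorphic_map_def by blast
qed

lemma transition_hol_fun:
  assumes M: "complex_manifold M" and c: "c \<in> cm_atlas M" and d: "d \<in> cm_atlas M"
  shows "openin (Ctop (cm_dim M)) (snd c ` (fst c \<inter> fst d))"
    "\<And>j. j < cm_dim M \<Longrightarrow> hol_fun (cm_dim M) (snd c ` (fst c \<inter> fst d)) (\<lambda>z. in_chart c (snd d) z j)"
proof -
  show o: "openin (Ctop (cm_dim M)) (snd c ` (fst c \<inter> fst d))"
    by (intro chart_image_open[OF M c] openin_Int complex_manifoldD(4)[OF M] c d) auto
  show "hol_fun (cm_dim M) (snd c ` (fst c \<inter> fst d)) (\<lambda>z. in_chart c (snd d) z j)" if "j < cm_dim M" for j
    using complex_manifoldD(7)[OF M c d] that holo_on_iff_hol_fun[OF o] by blast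
qed

lemma complex_manifoldI:
  assumes "Hausdorff_space (cm_top M)" "second_countable (cm_top M)"
    and cov: "(\<Union>c\<in>cm_atlas M. fst c) = topspace (cm_top M)"
    and op: "\<And>c. c \<in> cm_atlas M \<Longrightarrow> openin (cm_top M) (fst c)"
    and op': "\<And>c. c \<in> cm_atlas M \<Longrightarrow> openin (Ctop (cm_dim M)) (snd c ` fst c)"
    and hom: "\<And>c. c \<in> cm_atlas M \<Longrightarrow> homeomorphic_map (subtopology (cm_top M) (fst c))
        (subtopology (Ctop (cm_dim M)) (snd c ` fst c)) (snd c)"
    and trans: "\<And>c d j. c \<in> cm_atlas M \<Longrightarrow> d \<in> cm_atlas M \<Longrightarrow> j < cm_dim M \<Longrightarrow>
        openin (Ctop (cm_dim M)) (snd c ` (fst c \<inter> fst d)) \<Longrightarrow>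
        hol_fun (cm_dim M) (snd c ` (fst c \<inter> fst d)) (\<lambda>z. in_chart c (snd d) z j)"
  shows "complex_manifold M"
  unfolding complex_manifold_def
proof (intro conjI ballI)
  fix c d assume c: "c \<in> cm_atlas M" and d: "d \<in> cm_atlas M"
  have "openin (subtopology (cm_top M) (fst c)) (fst c \<inter> fst d)"
    using op[OF d] by (metis inf_commute openin_subtopology)
  then have "openin (subtopology (Ctop (cm_dim M)) (snd c ` fst c)) (snd c ` (fst c \<inter> fst d))"
    using homeomorphic_imp_open_map[OF hom[OF c]] unfolding open_map_def by blast
  then have o: "openin (Ctop (cm_dim M)) (snd c ` (fst c \<inter> fst d))"
    using op'[OF c] by (rule openin_trans_full)
  have "inj_on (snd c) (topspace (subtopology (cm_top M) (fst c)))"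
    using hom[OF c] unfolding homeomorphic_eq_everything_map by blast
  then have inj: "inj_on (snd c) (fst c)"
    using openin_subset[OF op[OF c]] by (simp add: inf.absorb2)
  have "in_chart c (snd d) ` snd c ` (fst c \<inter> fst d) \<subseteq> Cset (cm_dim M)"
    using openin_Ctop_subset[OF op'[OF d]] inj by (auto simp: in_chart_def)
  then show "holo_on (cm_dim M) (cm_dim M) (snd c ` (fst c \<inter> fst d)) (in_chart c (snd d))"
    using trans[OF c d _ o] by (subst holo_on_iff_hol_fun[OF o]) auto
qed (use assms in \<open>auto simp: case_prod_beta\<close>)

lemma second_countable_Ctop: "second_countable (Ctop n)"
proof -
  obtain B :: "(nat \<Rightarrow> complex) set set" where "countable B" "topological_basis B"
    using ex_countable_basis by blast
  then have "second_countable (euclidean :: (nat \<Rightarrow> complex) topology)"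
    unfolding second_countable_def
    by (metis open_openin topological_basisE topological_basis_open)
  then show ?thesis unfolding Ctop_def by (rule second_countable_subtopology)
qed

lemma Hausdorff_space_Ctop: "Hausdorff_space (Ctop n)"
  unfolding Ctop_def by (rule Hausdorff_space_subtopology) simp

lemma complex_manifold_complex_space: "complex_manifold (complex_space n)"
proof (rule complex_manifoldI)
  show "homeomorphic_map (subtopology (cm_top (complex_space n)) (fst c))
        (subtopology (Ctop (cm_dim (complex_space n))) (snd c ` fst c)) (snd c)"
    if "c \<in> cm_atlas (complex_space n)" for c
    using that by (auto simp: complex_space_def)
  show "hol_fun (cm_dim (complex_space n)) (snd c ` (fst c \<inter> fst d)) (\<lambda>z. in_chart c (snd d) z j)"
    if "c \<in> cm_atlas (complex_space n)" "d \<in> cm_atlas (complex_space n)" "j < cm_dim (complex_space n)" for c d j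
  proof -
    have "hol_fun n (Cset n) (\<lambda>z. in_chart (Cset n, id) id z j)"
      by (rule hol_fun_cong[OF hol_fun_coord openin_Ctop_UNIV]) (simp add: in_chart_def)
    then show ?thesis using that by (auto simp: complex_space_def)
  qed
qed (auto simp: complex_space_def second_countable_Ctop Hausdorff_space_Ctop)

lemma complex_manifold_open_submanifold:
  assumes M: "complex_manifold M" and W: "openin (cm_top M) W"
  shows "complex_manifold (open_submanifold M W)"
proof (rule complex_manifoldI)
  let ?N = "open_submanifold M W"
  have atl: "\<exists>c'\<in>cm_atlas M. c = (fst c' \<inter> W, snd c')" if "c \<in> cm_atlas ?N" for c
    using that by (auto simp: open_submanifold_def case_prod_beta)
  have Wsub: "W \<subseteq> topspace (cm_top M)" by (rule openin_subset[OF W])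
  show "Hausdorff_space (cm_top ?N)" "second_countable (cm_top ?N)"
    using complex_manifoldD(1,2)[OF M]
    by (simp_all add: open_submanifold_def Hausdorff_space_subtopology second_countable_subtopology)
  show "(\<Union>c\<in>cm_atlas ?N. fst c) = topspace (cm_top ?N)"
  proof -
    have "(\<Union>c\<in>cm_atlas ?N. fst c) = (\<Union>c\<in>cm_atlas M. fst c) \<inter> W"
      by (auto simp: open_submanifold_def case_prod_beta)
    then show ?thesis unfolding complex_manifoldD(3)[OF M] by (simp add: open_submanifold_def)
  qed
  fix c assume "c \<in> cm_atlas ?N"
  then obtain c' where c': "c' \<in> cm_atlas M" "c = (fst c' \<inter> W, snd c')" using atl by blast
  have o: "openin (cm_top M) (fst c' \<inter> W)" using complex_manifoldD(4)[OF M c'(1)] W by (rule openin_Int)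
  show "openin (cm_top ?N) (fst c)"
    using o c'(2) complex_manifoldD(4)[OF M c'(1)] by (auto simp: open_submanifold_def openin_subtopology)
  show "openin (Ctop (cm_dim ?N)) (snd c ` fst c)"
    using chart_image_open[OF M c'(1) o] c'(2) by (simp add: open_submanifold_def)
  have "homeomorphic_map (subtopology (subtopology (cm_top M) (fst c')) (fst c' \<inter> W))
     (subtopology (subtopology (Ctop (cm_dim M)) (snd c' ` fst c')) (snd c' ` (fst c' \<inter> W))) (snd c')"
  proof (rule homeomorphic_map_subtopologies[OF complex_manifoldD(6)[OF M c'(1)]])
    show "snd c' ` (topspace (subtopology (cm_top M) (fst c')) \<inter> (fst c' \<inter> W)) =
      topspace (subtopology (Ctop (cm_dim M)) (snd c' ` fst c')) \<inter> snd c' ` (fst c' \<inter> W)"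
      using chart_subset[OF M c'(1)] chart_in_Cset[OF M c'(1)] by auto
  qed
  moreover have "fst c' \<inter> (fst c' \<inter> W) = W \<inter> (fst c' \<inter> W)" by auto
  moreover have "snd c' ` fst c' \<inter> snd c' ` (fst c' \<inter> W) = snd c' ` (fst c' \<inter> W)" by auto
  ultimately show "homeomorphic_map (subtopology (cm_top ?N) (fst c))
        (subtopology (Ctop (cm_dim ?N)) (snd c ` fst c)) (snd c)"
    using c'(2) by (simp add: open_submanifold_def subtopology_subtopology)
  fix d j assume "d \<in> cm_atlas ?N" and j: "j < cm_dim ?N"
    and o2: "openin (Ctop (cm_dim ?N)) (snd c ` (fst c \<inter> fst d))"
  then obtain d' where d': "d' \<in> cm_atlas M" "d = (fst d' \<inter> W, snd d')" using atl by blast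
  have "hol_fun (cm_dim M) (snd c ` (fst c \<inter> fst d)) (\<lambda>z. in_chart c' (snd d') z j)"
    by (rule hol_fun_subset[OF transition_hol_fun(2)[OF M c'(1) d'(1)]])
      (use j c'(2) d'(2) in \<open>auto simp: open_submanifold_def\<close>)
  then have "hol_fun (cm_dim M) (snd c ` (fst c \<inter> fst d)) (\<lambda>z. in_chart c (snd d) z j)"
  proof (rule hol_fun_cong)
    show "openin (Ctop (cm_dim M)) (snd c ` (fst c \<inter> fst d))" using o2 by (simp add: open_submanifold_def)
    have inj: "inj_on (snd c') (fst c' \<inter> W)" using chart_inj[OF M c'(1)] by (rule inj_on_subset) auto
    show "in_chart c' (snd d') z j = in_chart c (snd d) z j" if "z \<in> snd c ` (fst c \<inter> fst d)" for z
      using that c'(2) d'(2) inj chart_inj[OF M c'(1)] by (auto simp: in_chart_def)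
  qed
  then show "hol_fun (cm_dim ?N) (snd c ` (fst c \<inter> fst d)) (\<lambda>z. in_chart c (snd d) z j)"
    by (simp add: open_submanifold_def)
qed

lemma open_submanifold_topspace:
  assumes "complex_manifold M"
  shows "open_submanifold M (topspace (cm_top M)) = M"
proof -
  have "(\<lambda>(U, \<phi>). (U \<inter> topspace (cm_top M), \<phi>)) ` cm_atlas M = (\<lambda>c. c) ` cm_atlas M"
  proof (rule image_cong[OF refl])
    fix c assume "c \<in> cm_atlas M"
    then show "(case c of (U, \<phi>) \<Rightarrow> (U \<inter> topspace (cm_top M), \<phi>)) = c"
      using chart_subset[OF assms, of c] by (cases c) auto
  qed
  then show ?thesis by (simp add: open_submanifold_def)
qed

section \<open>Products\<close>

definition split1 :: "nat \<Rightarrow> (nat \<Rightarrow> complex) \<Rightarrow> nat \<Rightarrow> complex" where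
  "split1 m z = (\<lambda>i. if i < m then z i else 0)"

definition split2 :: "nat \<Rightarrow> (nat \<Rightarrow> complex) \<Rightarrow> nat \<Rightarrow> complex" where
  "split2 m z = (\<lambda>i. z (m + i))"

definition join :: "nat \<Rightarrow> (nat \<Rightarrow> complex) \<Rightarrow> (nat \<Rightarrow> complex) \<Rightarrow> nat \<Rightarrow> complex" where
  "join m x y = (\<lambda>i. if i < m then x i else y (i - m))"

lemma split_join: "x \<in> Cset m \<Longrightarrow> split1 m (join m x y) = x" "split2 m (join m x y) = y"
  by (auto simp: split1_def split2_def join_def Cset_def)

lemma join_split: "join m (split1 m z) (split2 m z) = z"
  by (auto simp: split1_def split2_def join_def)

lemma split_Cset: "split1 m z \<in> Cset m" "z \<in> Cset (m + n) \<Longrightarrow> split2 m z \<in> Cset n"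
  by (auto simp: split1_def split2_def Cset_def)

lemma join_Cset: "x \<in> Cset m \<Longrightarrow> y \<in> Cset n \<Longrightarrow> join m x y \<in> Cset (m + n)"
  by (auto simp: join_def Cset_def)

lemma hol_fun_split: "hol_fun n S (\<lambda>z. split1 m z i)" "hol_fun n S (\<lambda>z. split2 m z i)"
  by (cases "i < m"; simp add: split1_def) (simp add: split2_def)

lemma openin_join:
  assumes A: "openin (Ctop m) A" and B: "openin (Ctop n) B"
  shows "openin (Ctop (m + n)) {z \<in> Cset (m + n). split1 m z \<in> A \<and> split2 m z \<in> B}"
proof -
  have 1: "openin (Ctop (m + n)) {z \<in> Cset (m + n). split1 m z \<in> A}"
    by (rule openin_Ctop_preimage[OF openin_Ctop_UNIV A hol_fun_cont[OF hol_fun_split(1)[where n = 0]]])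
      (rule split_Cset)
  have 2: "openin (Ctop (m + n)) {z \<in> Cset (m + n). split2 m z \<in> B}"
    by (rule openin_Ctop_preimage[OF openin_Ctop_UNIV B hol_fun_cont[OF hol_fun_split(2)[where n = 0]]])
      (rule split_Cset)
  have "{z \<in> Cset (m + n). split1 m z \<in> A \<and> split2 m z \<in> B}
     = {z \<in> Cset (m + n). split1 m z \<in> A} \<inter> {z \<in> Cset (m + n). split2 m z \<in> B}" by auto
  then show ?thesis using openin_Int[OF 1 2] by simp
qed

text \<open>The charts of a product manifold, written with \<open>join\<close> so that \<open>split1\<close> and \<open>split2\<close> recover the two
  coordinate vectors.\<close>

definition prod_chart :: "nat \<Rightarrow> 'a cchart \<Rightarrow> 'b cchart \<Rightarrow> ('a \<times> 'b) cchart" where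
  "prod_chart m c d = (fst c \<times> fst d, \<lambda>(x, y). join m (snd c x) (snd d y))"

lemma product_manifold_simps:
  fixes M :: "'a cmanifold" and N :: "'b cmanifold"
  shows "cm_top (product_manifold M N) = prod_topology (cm_top M) (cm_top N)"
  "cm_dim (product_manifold M N) = cm_dim M + cm_dim N"
  "cm_atlas (product_manifold M N) = {prod_chart (cm_dim M) c d | c d. c \<in> cm_atlas M \<and> d \<in> cm_atlas N}"
proof -
  have "(\<lambda>(x, y) i. if i < cm_dim M then \<phi> x i else \<psi> y (i - cm_dim M)) = (\<lambda>(x, y). join (cm_dim M) (\<phi> x) (\<psi> y))"
    for \<phi> :: "'a \<Rightarrow> nat \<Rightarrow> complex" and \<psi> :: "'b \<Rightarrow> nat \<Rightarrow> complex"
    by (auto simp: join_def fun_eq_iff)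
  then have "cm_atlas (product_manifold M N) =
      {prod_chart (cm_dim M) (U, \<phi>) (W, \<psi>) | U \<phi> W \<psi>. (U, \<phi>) \<in> cm_atlas M \<and> (W, \<psi>) \<in> cm_atlas N}"
    by (simp add: product_manifold_def prod_chart_def)
  then show "cm_atlas (product_manifold M N) = {prod_chart (cm_dim M) c d | c d. c \<in> cm_atlas M \<and> d \<in> cm_atlas N}"
    by (simp add: split_paired_Ex)
qed (simp_all add: product_manifold_def)

lemma prod_chart_image:
  assumes "snd c ` fst c \<subseteq> Cset m" "snd d ` fst d \<subseteq> Cset n" "A \<subseteq> fst c" "B \<subseteq> fst d"
  shows "snd (prod_chart m c d) ` (A \<times> B) = {z \<in> Cset (m + n). split1 m z \<in> snd c ` A \<and> split2 m z \<in> snd d ` B}"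
proof (intro equalityI subsetI)
  fix z assume "z \<in> snd (prod_chart m c d) ` (A \<times> B)"
  then obtain x y where xy: "x \<in> A" "y \<in> B" "z = join m (snd c x) (snd d y)" by (auto simp: prod_chart_def)
  then have "snd c x \<in> Cset m" "snd d y \<in> Cset n" using assms by blast+
  then show "z \<in> {z \<in> Cset (m + n). split1 m z \<in> snd c ` A \<and> split2 m z \<in> snd d ` B}"
    using xy by (simp add: split_join join_Cset)
next
  fix z assume "z \<in> {z \<in> Cset (m + n). split1 m z \<in> snd c ` A \<and> split2 m z \<in> snd d ` B}"
  then obtain x y where "x \<in> A" "y \<in> B" "split1 m z = snd c x" "split2 m z = snd d y" by auto
  then have "z = join m (snd c x) (snd d y)" using join_split[of m z] by simp
  then show "z \<in> snd (prod_chart m c d) ` (A \<times> B)"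
    using \<open>x \<in> A\<close> \<open>y \<in> B\<close> by (auto simp: prod_chart_def intro!: image_eqI[of _ _ "(x, y)"])
qed

lemma second_countable_prod_topology:
  assumes "second_countable X" "second_countable Y"
  shows "second_countable (prod_topology X Y)"
proof -
  obtain A where A: "countable A" "\<forall>V\<in>A. openin X V"
    "\<forall>U x. openin X U \<and> x \<in> U \<longrightarrow> (\<exists>V\<in>A. x \<in> V \<and> V \<subseteq> U)"
    using assms(1) unfolding second_countable_def by (elim exE conjE) (rule that)
  obtain B where B: "countable B" "\<forall>V\<in>B. openin Y V"
    "\<forall>U x. openin Y U \<and> x \<in> U \<longrightarrow> (\<exists>V\<in>B. x \<in> V \<and> V \<subseteq> U)"
    using assms(2) unfolding second_countable_def by (elim exE conjE) (rule that)
  show ?thesis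
    unfolding second_countable_def
  proof (intro exI[of _ "(\<lambda>(U, V). U \<times> V) ` (A \<times> B)"] conjI allI impI ballI)
    show "countable ((\<lambda>(U, V). U \<times> V) ` (A \<times> B))" using A(1) B(1) by blast
    show "openin (prod_topology X Y) W" if "W \<in> (\<lambda>(U, V). U \<times> V) ` (A \<times> B)" for W
      using that A(2) B(2) by (auto simp: openin_prod_Times_iff)
    fix U z assume U: "openin (prod_topology X Y) U \<and> z \<in> U"
    then obtain S T where ST: "openin X S" "openin Y T" "fst z \<in> S" "snd z \<in> T" "S \<times> T \<subseteq> U"
      unfolding openin_prod_topology_alt by (metis prod.collapse)
    obtain S' where "S' \<in> A" "fst z \<in> S'" "S' \<subseteq> S" using A(3) ST(1,3) by blast
    moreover obtain T' where "T' \<in> B" "snd z \<in> T'" "T' \<subseteq> T" using B(3) ST(2,4) by blast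
    ultimately show "\<exists>V\<in>(\<lambda>(U, V). U \<times> V) ` (A \<times> B). z \<in> V \<and> V \<subseteq> U"
      using ST(5) by (intro bexI[of _ "S' \<times> T'"]) (auto simp: mem_Times_iff)
  qed
qed

lemma homeomorphic_map_inverse_continuous:
  assumes "homeomorphic_map X Y f"
  shows "continuous_map Y X (inv_into (topspace X) f)"
proof -
  obtain g where g: "homeomorphic_maps X Y f g" using assms homeomorphic_map_maps by blast
  have inj: "inj_on f (topspace X)" using assms unfolding homeomorphic_eq_everything_map by blast
  have "continuous_map Y X g" using g by (simp add: homeomorphic_maps_def)
  then show ?thesis
  proof (rule continuous_map_eq)
    fix y assume y: "y \<in> topspace Y"
    then have "g y \<in> topspace X" "f (g y) = y"
      using g by (auto simp: homeomorphic_maps_def continuous_map_def)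
    then show "g y = inv_into (topspace X) f y" using inj by (metis inv_into_f_f)
  qed
qed

lemma complex_manifold_product:
  assumes M: "complex_manifold M" and N: "complex_manifold N"
  shows "complex_manifold (product_manifold M N)"
proof (rule complex_manifoldI)
  let ?P = "product_manifold M N"
  let ?m = "cm_dim M" and ?n = "cm_dim N"
  show "Hausdorff_space (cm_top ?P)" "second_countable (cm_top ?P)"
    using complex_manifoldD(1,2)[OF M] complex_manifoldD(1,2)[OF N]
    by (simp_all add: product_manifold_simps Hausdorff_space_prod_topology second_countable_prod_topology)
  show "(\<Union>c\<in>cm_atlas ?P. fst c) = topspace (cm_top ?P)"
  proof -
    have "cm_atlas ?P = (\<lambda>(c, d). prod_chart ?m c d) ` (cm_atlas M \<times> cm_atlas N)"
      by (auto simp: product_manifold_simps)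
    then have "(\<Union>p\<in>cm_atlas ?P. fst p) = (\<Union>(c, d)\<in>cm_atlas M \<times> cm_atlas N. fst c \<times> fst d)"
      by (simp add: prod_chart_def case_prod_beta)
    also have "\<dots> = (\<Union>c\<in>cm_atlas M. fst c) \<times> (\<Union>d\<in>cm_atlas N. fst d)"
      by (intro set_eqI) (simp add: case_prod_beta mem_Times_iff Bex_def split_paired_Ex, blast)
    finally have "(\<Union>c\<in>cm_atlas ?P. fst c) = (\<Union>c\<in>cm_atlas M. fst c) \<times> (\<Union>d\<in>cm_atlas N. fst d)" .
    then show ?thesis
      unfolding complex_manifoldD(3)[OF M] complex_manifoldD(3)[OF N] by (simp add: product_manifold_simps)
  qed
  fix p assume "p \<in> cm_atlas ?P"
  then obtain c d where c: "c \<in> cm_atlas M" and d: "d \<in> cm_atlas N" and p: "p = prod_chart ?m c d"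
    by (auto simp: product_manifold_simps)
  have cC: "snd c ` fst c \<subseteq> Cset ?m" and dC: "snd d ` fst d \<subseteq> Cset ?n"
    using chart_in_Cset[OF M c] chart_in_Cset[OF N d] by auto
  have fp: "fst p = fst c \<times> fst d" by (simp add: p prod_chart_def)
  show "openin (cm_top ?P) (fst p)"
    using complex_manifoldD(4)[OF M c] complex_manifoldD(4)[OF N d]
    by (simp add: fp product_manifold_simps openin_prod_Times_iff)
  have im: "snd p ` fst p = {z \<in> Cset (?m + ?n). split1 ?m z \<in> snd c ` fst c \<and> split2 ?m z \<in> snd d ` fst d}"
    unfolding fp unfolding p by (rule prod_chart_image[OF cC dC]) auto
  show "openin (Ctop (cm_dim ?P)) (snd p ` fst p)"
    unfolding im product_manifold_simps
    by (rule openin_join[OF complex_manifoldD(5)[OF M c] complex_manifoldD(5)[OF N d]])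
  define g where "g = (\<lambda>z. (inv_into (fst c) (snd c) (split1 ?m z), inv_into (fst d) (snd d) (split2 ?m z)))"
  have tc: "topspace (subtopology (cm_top M) (fst c)) = fst c" and td: "topspace (subtopology (cm_top N) (fst d)) = fst d"
    using chart_subset[OF M c] chart_subset[OF N d] by auto
  have "homeomorphic_maps (subtopology (cm_top ?P) (fst p)) (subtopology (Ctop (?m + ?n)) (snd p ` fst p)) (snd p) g"
    unfolding homeomorphic_maps_def
  proof (intro conjI ballI)
    have st: "subtopology (cm_top ?P) (fst p) = prod_topology (subtopology (cm_top M) (fst c)) (subtopology (cm_top N) (fst d))"
      by (simp add: fp product_manifold_simps subtopology_Times)
    have "continuous_map (subtopology (cm_top ?P) (fst p)) (Ctop (?m + ?n)) (snd p)"
      unfolding continuous_map_into_Ctop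
    proof (intro conjI allI impI)
      show "snd p ` topspace (subtopology (cm_top ?P) (fst p)) \<subseteq> Cset (?m + ?n)" using im by auto
      fix i assume "i < ?m + ?n"
      show "continuous_map (subtopology (cm_top ?P) (fst p)) euclidean (\<lambda>x. snd p x i)"
      proof (cases "i < ?m")
        case True
        have "continuous_map (subtopology (cm_top ?P) (fst p)) euclidean ((\<lambda>x. snd c x i) \<circ> fst)"
          unfolding st using chart_continuous[OF M c, unfolded continuous_map_into_Ctop] True
          by (intro continuous_map_compose[OF continuous_map_fst]) auto
        then show ?thesis using True by (simp add: p prod_chart_def join_def o_def case_prod_beta)
      next
        case False
        have "continuous_map (subtopology (cm_top ?P) (fst p)) euclidean ((\<lambda>x. snd d x (i - ?m)) \<circ> snd)"
          unfolding st using chart_continuous[OF N d, unfolded continuous_map_into_Ctop] False \<open>i < ?m + ?n\<close>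
          by (intro continuous_map_compose[OF continuous_map_snd]) auto
        then show ?thesis using False by (simp add: p prod_chart_def join_def o_def case_prod_beta)
      qed
    qed
    then show "continuous_map (subtopology (cm_top ?P) (fst p)) (subtopology (Ctop (?m + ?n)) (snd p ` fst p)) (snd p)"
      by (auto simp: continuous_map_in_subtopology)
    have s1: "continuous_map (subtopology (Ctop (?m + ?n)) (snd p ` fst p)) (subtopology (Ctop ?m) (snd c ` fst c)) (split1 ?m)"
      unfolding continuous_map_in_subtopology continuous_map_into_Ctop
      by (intro conjI allI impI continuous_map_from_subtopology)
        (auto simp: im split1_def continuous_map_Ctop_coord Cset_def)
    have s2: "continuous_map (subtopology (Ctop (?m + ?n)) (snd p ` fst p)) (subtopology (Ctop ?n) (snd d ` fst d)) (split2 ?m)"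
      unfolding continuous_map_in_subtopology continuous_map_into_Ctop
      by (intro conjI allI impI continuous_map_from_subtopology)
        (auto simp: im split2_def continuous_map_Ctop_coord Cset_def)
    show "continuous_map (subtopology (Ctop (?m + ?n)) (snd p ` fst p)) (subtopology (cm_top ?P) (fst p)) g"
      unfolding st g_def continuous_map_pairwise o_def fst_conv snd_conv
      using continuous_map_compose[OF s1 homeomorphic_map_inverse_continuous[OF complex_manifoldD(6)[OF M c]]]
        continuous_map_compose[OF s2 homeomorphic_map_inverse_continuous[OF complex_manifoldD(6)[OF N d]]]
      unfolding tc td o_def by blast
    fix x assume "x \<in> topspace (subtopology (cm_top ?P) (fst p))"
    then obtain a b where x: "x = (a, b)" "a \<in> fst c" "b \<in> fst d" using fp by auto
    then show "g (snd p x) = x"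
      using chart_inj[OF M c] chart_inj[OF N d] chart_in_Cset[OF M c]
      by (simp add: g_def p prod_chart_def split_join)
  next
    fix z assume "z \<in> topspace (subtopology (Ctop (?m + ?n)) (snd p ` fst p))"
    then have "split1 ?m z \<in> snd c ` fst c" "split2 ?m z \<in> snd d ` fst d" using im by auto
    then show "snd p (g z) = z"
      by (simp add: g_def p prod_chart_def f_inv_into_f join_split)
  qed
  then show "homeomorphic_map (subtopology (cm_top ?P) (fst p))
        (subtopology (Ctop (cm_dim ?P)) (snd p ` fst p)) (snd p)"
    unfolding product_manifold_simps homeomorphic_map_maps by blast
  have injp: "inj_on (snd p) (fst p)"
    using chart_inj[OF M c] chart_inj[OF N d] chart_in_Cset[OF M c]
    by (intro inj_on_inverseI[of _ g]) (auto simp: g_def p prod_chart_def split_join)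
  fix p' j assume "p' \<in> cm_atlas ?P" and j: "j < cm_dim ?P"
    and o: "openin (Ctop (cm_dim ?P)) (snd p ` (fst p \<inter> fst p'))"
  then obtain c' d' where c': "c' \<in> cm_atlas M" and d': "d' \<in> cm_atlas N" and p': "p' = prod_chart ?m c' d'"
    by (auto simp: product_manifold_simps)
  have im2: "snd p ` (fst p \<inter> fst p') =
     {z \<in> Cset (?m + ?n). split1 ?m z \<in> snd c ` (fst c \<inter> fst c') \<and> split2 ?m z \<in> snd d ` (fst d \<inter> fst d')}"
  proof -
    have "fst p \<inter> fst p' = (fst c \<inter> fst c') \<times> (fst d \<inter> fst d')" by (auto simp: p p' prod_chart_def)
    then show ?thesis unfolding p by (simp only: prod_chart_image[OF cC dC Int_lower1 Int_lower1])
  qed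
  have o': "openin (Ctop (?m + ?n)) (snd p ` (fst p \<inter> fst p'))" using o by (simp add: product_manifold_simps)
  have val: "in_chart p (snd p') z = join ?m (in_chart c (snd c') (split1 ?m z)) (in_chart d (snd d') (split2 ?m z))"
    if z: "z \<in> snd p ` (fst p \<inter> fst p')" for z
  proof -
    obtain a b where ab: "(a, b) \<in> fst p" "z = snd p (a, b)" using z by auto
    then have "a \<in> fst c" "b \<in> fst d" using fp by auto
    moreover have "in_chart p (snd p') z = snd p' (a, b)" using ab injp by (simp add: in_chart_def)
    moreover have "split1 ?m z = snd c a" "split2 ?m z = snd d b"
      using ab(2) chart_in_Cset[OF M c \<open>a \<in> fst c\<close>] by (simp_all add: p prod_chart_def split_join)
    ultimately show ?thesis
      by (simp add: in_chart_apply[OF M c] in_chart_apply[OF N d] p' prod_chart_def)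
  qed
  have "hol_fun (?m + ?n) (snd p ` (fst p \<inter> fst p')) (\<lambda>z. in_chart p (snd p') z j)"
  proof (cases "j < ?m")
    case True
    have "hol_fun (?m + ?n) (snd p ` (fst p \<inter> fst p')) (\<lambda>z. in_chart c (snd c') (split1 ?m z) j)"
      by (rule hol_fun_compose[OF o' transition_hol_fun(1)[OF M c c'] transition_hol_fun(2)[OF M c c' True] hol_fun_split(1)]) (simp add: im2)
    then show ?thesis by (rule hol_fun_cong[OF _ o']) (simp add: val True join_def)
  next
    case False
    have j': "j - ?m < ?n" using j False by (simp add: product_manifold_simps)
    have "hol_fun (?m + ?n) (snd p ` (fst p \<inter> fst p')) (\<lambda>z. in_chart d (snd d') (split2 ?m z) (j - ?m))"
      by (rule hol_fun_compose[OF o' transition_hol_fun(1)[OF N d d'] transition_hol_fun(2)[OF N d d' j'] hol_fun_split(2)]) (simp add: im2)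
    then show ?thesis by (rule hol_fun_cong[OF _ o']) (simp add: val False join_def)
  qed
  then show "hol_fun (cm_dim ?P) (snd p ` (fst p \<inter> fst p')) (\<lambda>z. in_chart p (snd p') z j)"
    by (simp add: product_manifold_simps)
qed


lemma holomorphic_map_id:
  assumes M: "complex_manifold M"
  shows "holomorphic_map M M (\<lambda>x. x)"
proof (rule holomorphic_mapI[OF M M])
  fix c d j assume c: "c \<in> cm_atlas M" and d: "d \<in> cm_atlas M" and j: "j < cm_dim M"
  have "{x \<in> fst c. x \<in> fst d} = fst c \<inter> fst d" by auto
  then show "hol_fun (cm_dim M) (snd c ` {x \<in> fst c. x \<in> fst d}) (\<lambda>z. in_chart c (snd d \<circ> (\<lambda>x. x)) z j)"
    using transition_hol_fun(2)[OF M c d j] by (simp add: o_def)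
qed simp

section \<open>Trivial bundles\<close>

definition trivial_bundle :: "'a cmanifold \<Rightarrow> nat \<Rightarrow> ('a, 'a \<times> (nat \<Rightarrow> complex)) cbundle" where
  "trivial_bundle M r = \<lparr>vb_total = product_manifold M (complex_space r), vb_proj = fst, vb_rank = r,
     vb_zero = \<lambda>x. (x, \<lambda>_. 0), vb_add = \<lambda>e e'. (fst e, \<lambda>i. snd e i + snd e' i),
     vb_scale = \<lambda>a e. (fst e, cscale a (snd e))\<rparr>"

lemma trivial_bundle_simps [simp]:
  "vb_total (trivial_bundle M r) = product_manifold M (complex_space r)"
  "vb_proj (trivial_bundle M r) = fst" "vb_rank (trivial_bundle M r) = r"
  "vb_zero (trivial_bundle M r) x = (x, \<lambda>_. 0)"
  "vb_add (trivial_bundle M r) e e' = (fst e, \<lambda>i. snd e i + snd e' i)"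
  "vb_scale (trivial_bundle M r) a e = (fst e, cscale a (snd e))"
  by (simp_all add: trivial_bundle_def)

lemma complex_space_simps [simp]:
  "cm_top (complex_space r) = Ctop r" "cm_dim (complex_space r) = r"
  "cm_atlas (complex_space r) = {(Cset r, id)}"
  by (simp_all add: complex_space_def)

lemma fibre_trivial_bundle:
  "x \<in> topspace (cm_top M) \<Longrightarrow> fibre (trivial_bundle M r) x = {x} \<times> Cset r"
  by (auto simp: fibre_def product_manifold_simps)

lemma atlas_product_complex_space:
  "cm_atlas (product_manifold M (complex_space r)) = (\<lambda>c. prod_chart (cm_dim M) c (Cset r, id)) ` cm_atlas M"
  by (auto simp: product_manifold_simps)

lemma hol_fun_in_prod_chart:
  assumes M: "complex_manifold M" and c: "c \<in> cm_atlas M"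
    and A: "openin (prod_topology (cm_top M) (Ctop r)) A" "A \<subseteq> fst c \<times> Cset r"
    and F: "hol_fun (cm_dim M + r) (snd (prod_chart (cm_dim M) c (Cset r, id)) ` A) F"
    and FG: "\<And>x w. (x, w) \<in> A \<Longrightarrow> F (join (cm_dim M) (snd c x) w) = G (x, w) j"
  shows "hol_fun (cm_dim M + r) (snd (prod_chart (cm_dim M) c (Cset r, id)) ` A)
     (\<lambda>z. in_chart (prod_chart (cm_dim M) c (Cset r, id)) G z j)"
proof (rule hol_fun_cong[OF F])
  let ?P = "product_manifold M (complex_space r)"
  let ?p = "prod_chart (cm_dim M) c (Cset r, id)"
  have P: "complex_manifold ?P" by (rule complex_manifold_product[OF M complex_manifold_complex_space])
  have p: "?p \<in> cm_atlas ?P" using c by (auto simp: atlas_product_complex_space)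
  show "openin (Ctop (cm_dim M + r)) (snd ?p ` A)"
    using chart_image_open[OF P p, of A] A by (simp add: product_manifold_simps prod_chart_def)
  fix z assume "z \<in> snd ?p ` A"
  then obtain x w where xw: "(x, w) \<in> A" "z = snd ?p (x, w)" by auto
  then have "in_chart ?p G z = G (x, w)"
    using A(2) in_chart_apply[OF P p, of "(x, w)"] by (auto simp: prod_chart_def)
  then show "F z = in_chart ?p G z j" using FG[OF xw(1)] xw(2) by (simp add: prod_chart_def)
qed

lemma holomorphic_vector_bundle_trivial:
  assumes M: "complex_manifold M"
  shows "holomorphic_vector_bundle M (trivial_bundle M r)"
proof -
  let ?E = "trivial_bundle M r" and ?P = "product_manifold M (complex_space r)"
  have P: "complex_manifold ?P" by (rule complex_manifold_product[OF M complex_manifold_complex_space])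
  have proj: "holomorphic_map ?P M fst"
  proof (rule holomorphic_mapI[OF P M])
    show "continuous_map (cm_top ?P) (cm_top M) fst" by (simp add: product_manifold_simps continuous_map_fst)
    fix p d j assume "p \<in> cm_atlas ?P" and d: "d \<in> cm_atlas M" and j: "j < cm_dim M"
    then obtain c where c: "c \<in> cm_atlas M" and p: "p = prod_chart (cm_dim M) c (Cset r, id)"
      by (auto simp: atlas_product_complex_space)
    have eq: "{x \<in> fst p. fst x \<in> fst d} = (fst c \<inter> fst d) \<times> Cset r" by (auto simp: p prod_chart_def)
    have im: "snd p ` ((fst c \<inter> fst d) \<times> Cset r)
       = {z \<in> Cset (cm_dim M + r). split1 (cm_dim M) z \<in> snd c ` (fst c \<inter> fst d) \<and> split2 (cm_dim M) z \<in> id ` Cset r}"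
      unfolding p using prod_chart_image[of c "cm_dim M" "(Cset r, id)" r "fst c \<inter> fst d" "Cset r"]
        chart_in_Cset[OF M c] by auto
    have op: "openin (cm_top M) (fst c \<inter> fst d)"
      by (intro openin_Int complex_manifoldD(4)[OF M] c d)
    have "hol_fun (cm_dim M + r) (snd (prod_chart (cm_dim M) c (Cset r, id)) ` ((fst c \<inter> fst d) \<times> Cset r))
      (\<lambda>z. in_chart (prod_chart (cm_dim M) c (Cset r, id)) (snd d \<circ> fst) z j)"
    proof (rule hol_fun_in_prod_chart[OF M c])
      show "openin (prod_topology (cm_top M) (Ctop r)) ((fst c \<inter> fst d) \<times> Cset r)"
        using op by (simp add: openin_prod_Times_iff)
      show "hol_fun (cm_dim M + r) (snd (prod_chart (cm_dim M) c (Cset r, id)) ` ((fst c \<inter> fst d) \<times> Cset r))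
          (\<lambda>z. in_chart c (snd d) (split1 (cm_dim M) z) j)"
      proof (rule hol_fun_compose[OF _ transition_hol_fun(1)[OF M c d] transition_hol_fun(2)[OF M c d j] hol_fun_split(1)])
        show "openin (Ctop (cm_dim M + r)) (snd (prod_chart (cm_dim M) c (Cset r, id)) ` ((fst c \<inter> fst d) \<times> Cset r))"
          unfolding p[symmetric] im image_id id_apply
          by (rule openin_join[OF transition_hol_fun(1)[OF M c d] openin_Ctop_UNIV])
        show "split1 (cm_dim M) z \<in> snd c ` (fst c \<inter> fst d)"
          if "z \<in> snd (prod_chart (cm_dim M) c (Cset r, id)) ` ((fst c \<inter> fst d) \<times> Cset r)" for z
          using that unfolding p[symmetric] im by blast
      qed
      show "in_chart c (snd d) (split1 (cm_dim M) (join (cm_dim M) (snd c x) w)) j = (snd d \<circ> fst) (x, w) j"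
        if "(x, w) \<in> (fst c \<inter> fst d) \<times> Cset r" for x w
        using that chart_in_Cset[OF M c, of x] by (simp add: split_join in_chart_apply[OF M c])
    qed auto
    then show "hol_fun (cm_dim ?P) (snd p ` {x \<in> fst p. fst x \<in> fst d}) (\<lambda>z. in_chart p (snd d \<circ> fst) z j)"
      unfolding eq by (simp add: product_manifold_simps p)
  qed
  have U: "(\<Union>x\<in>topspace (cm_top M). fibre ?E x) = topspace (cm_top ?P)"
    by (auto simp: fibre_trivial_bundle product_manifold_simps)
  have triv: "local_trivialization M ?E (topspace (cm_top M)) (\<lambda>e. e)"
    unfolding local_trivialization_def
  proof (intro conjI ballI)
    show "biholomorphic_map (open_submanifold (vb_total ?E) (\<Union>x\<in>topspace (cm_top M). fibre ?E x))
      (product_manifold (open_submanifold M (topspace (cm_top M))) (complex_space (vb_rank ?E))) (\<lambda>e. e)"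
      unfolding U trivial_bundle_simps open_submanifold_topspace[OF P] open_submanifold_topspace[OF M] biholomorphic_map_def
      using holomorphic_map_id[OF P] by auto
  qed (auto simp: fibre_trivial_bundle cscale_def)
  show ?thesis
    unfolding holomorphic_vector_bundle_def
  proof (intro conjI ballI allI)
    show "\<exists>U \<theta>. openin (cm_top M) U \<and> x \<in> U \<and> local_trivialization M ?E U \<theta>" if "x \<in> topspace (cm_top M)" for x
      using triv that openin_topspace by blast
  qed (use M P proj in \<open>auto simp: fibre_trivial_bundle Cset_def\<close>)
qed

section \<open>Velocities\<close>

text \<open>Curves with a velocity at \<open>0\<close>.  Differentiability is only required at \<open>0\<close>, where alone it matters for
  \<open>velocity\<close>.\<close>

definition holomorphic_curve :: "'a cmanifold \<Rightarrow> (complex \<Rightarrow> 'a) \<Rightarrow> bool" where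
  "holomorphic_curve M \<gamma> \<longleftrightarrow> \<gamma> 0 \<in> topspace (cm_top M) \<and>
     (\<forall>W. openin (cm_top M) W \<and> \<gamma> 0 \<in> W \<longrightarrow> (\<forall>\<^sub>F t in nhds 0. \<gamma> t \<in> W)) \<and>
     (\<forall>c\<in>charts_at M (\<gamma> 0). \<forall>i<cm_dim M. (\<lambda>t. snd c (\<gamma> t) i) field_differentiable at 0)"

lemma charts_at_nonempty:
  assumes M: "complex_manifold M" and x: "x \<in> topspace (cm_top M)"
  shows "\<exists>c. c \<in> charts_at M x"
  using x unfolding complex_manifoldD(3)[OF M, symmetric] charts_at_def by blast

lemma chain_rule_chart:
  assumes M: "complex_manifold M" and N: "complex_manifold N" and f: "holomorphic_map M N f"
    and \<gamma>: "holomorphic_curve M \<gamma>" and c: "c \<in> charts_at M (\<gamma> 0)" and d: "d \<in> charts_at N (f (\<gamma> 0))"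
    and j: "j < cm_dim N"
  shows "((\<lambda>t. snd d (f (\<gamma> t)) j) has_field_derivative
     (\<Sum>i<cm_dim M. jacobian (in_chart c (snd d \<circ> f)) (snd c (\<gamma> 0)) j i * velocity M \<gamma> c i)) (at 0)"
proof -
  have c': "c \<in> cm_atlas M" "\<gamma> 0 \<in> fst c" and d': "d \<in> cm_atlas N" "f (\<gamma> 0) \<in> fst d"
    using c d by (auto simp: charts_at_def)
  let ?A = "{x \<in> fst c. f x \<in> fst d}"
  note H = holomorphic_mapD[OF M N f c'(1) d'(1)]
  have ev: "\<forall>\<^sub>F t in nhds 0. \<gamma> t \<in> ?A"
    using \<gamma> H(2) c'(2) d'(2) unfolding holomorphic_curve_def by blast
  have D: "((\<lambda>t. in_chart c (snd d \<circ> f) (snd c (\<gamma> t)) j) has_field_derivative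
     (\<Sum>i<cm_dim M. deriv (\<lambda>t. in_chart c (snd d \<circ> f) ((snd c (\<gamma> 0))(i := t)) j) (snd c (\<gamma> 0) i) *
        deriv (\<lambda>t. snd c (\<gamma> t) i) 0)) (at 0)"
  proof (rule hol_fun_curve[OF H(3) H(4)[OF j]])
    show "snd c (\<gamma> 0) \<in> snd c ` ?A" using c' d' by auto
    show "\<forall>\<^sub>F t in nhds 0. snd c (\<gamma> t) \<in> snd c ` ?A" using ev by (rule eventually_mono) auto
    show "((\<lambda>t. snd c (\<gamma> t) i) has_field_derivative deriv (\<lambda>t. snd c (\<gamma> t) i) 0) (at 0)" if "i < cm_dim M" for i
      using \<gamma> c that unfolding holomorphic_curve_def DERIV_deriv_iff_field_differentiable by blast
  qed
  have ev2: "\<forall>\<^sub>F t in nhds 0. in_chart c (snd d \<circ> f) (snd c (\<gamma> t)) j = snd d (f (\<gamma> t)) j"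
    using ev by (rule eventually_mono) (simp add: in_chart_apply[OF M c'(1)])
  have "((\<lambda>t. snd d (f (\<gamma> t)) j) has_field_derivative
     (\<Sum>i<cm_dim M. deriv (\<lambda>t. in_chart c (snd d \<circ> f) ((snd c (\<gamma> 0))(i := t)) j) (snd c (\<gamma> 0) i) *
        deriv (\<lambda>t. snd c (\<gamma> t) i) 0)) (at 0)"
    by (rule iffD1[OF DERIV_cong_ev[OF refl ev2 refl] D])
  then show ?thesis using c by (simp add: jacobian_def velocity_def)
qed

lemma velocity_outside:
  assumes N: "complex_manifold N" and \<gamma>: "holomorphic_curve N \<gamma>" and j: "\<not> j < cm_dim N"
  shows "velocity N \<gamma> d j = 0"
proof (cases "d \<in> charts_at N (\<gamma> 0)")
  case True
  then have d: "d \<in> cm_atlas N" "\<gamma> 0 \<in> fst d" by (auto simp: charts_at_def)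
  have "\<forall>\<^sub>F t in nhds 0. \<gamma> t \<in> fst d"
    using \<gamma> d complex_manifoldD(4)[OF N d(1)] unfolding holomorphic_curve_def by blast
  then have "\<forall>\<^sub>F t in nhds 0. snd d (\<gamma> t) j = 0"
  proof (rule eventually_mono)
    fix t assume "\<gamma> t \<in> fst d"
    then show "snd d (\<gamma> t) j = 0" using chart_in_Cset[OF N d(1)] j by (auto simp: Cset_def)
  qed
  then have "deriv (\<lambda>t. snd d (\<gamma> t) j) 0 = deriv (\<lambda>t. 0) 0" by (rule deriv_cong_ev) simp
  then show ?thesis by (simp add: velocity_def)
qed (simp add: velocity_def)

lemma holomorphic_curve_image:
  assumes M: "complex_manifold M" and N: "complex_manifold N" and f: "holomorphic_map M N f"
    and \<gamma>: "holomorphic_curve M \<gamma>"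
  shows "holomorphic_curve N (\<lambda>t. f (\<gamma> t))"
proof -
  have cont: "continuous_map (cm_top M) (cm_top N) f" using f by (simp add: holomorphic_map_def)
  have g0: "\<gamma> 0 \<in> topspace (cm_top M)" using \<gamma> by (simp add: holomorphic_curve_def)
  then obtain c where c: "c \<in> charts_at M (\<gamma> 0)" using charts_at_nonempty[OF M] by blast
  show ?thesis
    unfolding holomorphic_curve_def
  proof (intro conjI allI impI ballI)
    show "f (\<gamma> 0) \<in> topspace (cm_top N)" using cont g0 by (auto simp: continuous_map_def)
    show "\<forall>\<^sub>F t in nhds 0. f (\<gamma> t) \<in> W" if "openin (cm_top N) W \<and> f (\<gamma> 0) \<in> W" for W
    proof -
      have "openin (cm_top M) {x \<in> topspace (cm_top M). f x \<in> W}"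
        using cont that by (blast intro: openin_continuous_map_preimage)
      then have "\<forall>\<^sub>F t in nhds 0. \<gamma> t \<in> {x \<in> topspace (cm_top M). f x \<in> W}"
        using \<gamma> g0 that unfolding holomorphic_curve_def by blast
      then show ?thesis by (rule eventually_mono) simp
    qed
    show "(\<lambda>t. snd d (f (\<gamma> t)) i) field_differentiable at 0"
      if "d \<in> charts_at N (f (\<gamma> 0))" "i < cm_dim N" for d i
      using chain_rule_chart[OF M N f \<gamma> c that] unfolding field_differentiable_def by blast
  qed
qed

text \<open>The chain rule.  It reduces the differential of a spray at the zero section to the velocities of the
  curves \<open>t \<mapsto> s(t e)\<close>.\<close>

lemma differential_velocity:
  assumes M: "complex_manifold M" and N: "complex_manifold N" and f: "holomorphic_map M N f"
    and \<gamma>: "holomorphic_curve M \<gamma>"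
  shows "differential M N f (\<gamma> 0) (velocity M \<gamma>) = velocity N (\<lambda>t. f (\<gamma> t))"
proof (intro ext)
  fix d j
  define c where "c = (SOME c. c \<in> charts_at M (\<gamma> 0))"
  have "\<gamma> 0 \<in> topspace (cm_top M)" using \<gamma> by (simp add: holomorphic_curve_def)
  then have "\<exists>c. c \<in> charts_at M (\<gamma> 0)" by (rule charts_at_nonempty[OF M])
  then have c: "c \<in> charts_at M (\<gamma> 0)" unfolding c_def by (rule someI_ex)
  show "differential M N f (\<gamma> 0) (velocity M \<gamma>) d j = velocity N (\<lambda>t. f (\<gamma> t)) d j"
  proof (cases "d \<in> charts_at N (f (\<gamma> 0))")
    case False
    then show ?thesis by (simp add: differential_def velocity_def)
  next
    case True
    show ?thesis
    proof (cases "j < cm_dim N")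
      case j: True
      then show ?thesis
        using DERIV_imp_deriv[OF chain_rule_chart[OF M N f \<gamma> c True j]] True
        by (simp add: differential_def velocity_def[of N] Let_def c_def[symmetric])
    next
      case False
      then show ?thesis
        using velocity_outside[OF N holomorphic_curve_image[OF M N f \<gamma>]] True
        by (simp add: differential_def Let_def)
    qed
  qed
qed

lemma velocity_tangent:
  assumes M: "complex_manifold M" and \<gamma>: "holomorphic_curve M \<gamma>"
  shows "velocity M \<gamma> \<in> tangent_space M (\<gamma> 0)"
  unfolding tangent_space_def
proof (intro CollectI conjI ballI allI impI)
  show "velocity M \<gamma> c \<in> Cset (cm_dim M)" for c
    using velocity_outside[OF M \<gamma>] by (simp add: Cset_def)
  show "velocity M \<gamma> d j = (\<Sum>i<cm_dim M. jacobian (in_chart c (snd d)) (snd c (\<gamma> 0)) j i * velocity M \<gamma> c i)"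
    if "c \<in> charts_at M (\<gamma> 0)" "d \<in> charts_at M (\<gamma> 0)" "j < cm_dim M" for c d j
    using DERIV_imp_deriv[OF chain_rule_chart[OF M M holomorphic_map_id[OF M] \<gamma> that]] that(2)
    by (simp add: velocity_def[of M \<gamma> d] o_def)
  show "velocity M \<gamma> c = (\<lambda>_. 0)" if "c \<notin> charts_at M (\<gamma> 0)" for c
    using that by (simp add: velocity_def)
qed

text \<open>One coordinate vector determines all the others by the transition rule.\<close>

lemma tangent_space_eqI:
  assumes v: "v \<in> tangent_space M x" and w: "w \<in> tangent_space M x" and c: "c \<in> charts_at M x"
    and eq: "\<And>i. i < cm_dim M \<Longrightarrow> v c i = w c i"
  shows "v = w"
proof (intro ext)
  fix d j
  show "v d j = w d j"
  proof (cases "d \<in> charts_at M x")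
    case False
    then have "v d = (\<lambda>_. 0)" "w d = (\<lambda>_. 0)" using v w unfolding tangent_space_def by blast+
    then show ?thesis by simp
  next
    case d: True
    show ?thesis
    proof (cases "j < cm_dim M")
      case True
      have "v d j = (\<Sum>i<cm_dim M. jacobian (in_chart c (snd d)) (snd c x) j i * v c i)"
        "w d j = (\<Sum>i<cm_dim M. jacobian (in_chart c (snd d)) (snd c x) j i * w c i)"
        using v w c d True unfolding tangent_space_def by blast+
      then show ?thesis using eq by simp
    next
      case False
      have "v d \<in> Cset (cm_dim M)" "w d \<in> Cset (cm_dim M)" using v w d unfolding tangent_space_def by blast+
      then show ?thesis using False by (simp add: Cset_def)
    qed
  qed
qed


section \<open>Projective spaces\<close>

lemma mem_proj_point: "w \<in> proj_point z \<longleftrightarrow> (\<exists>a. a \<noteq> 0 \<and> w = cscale a z)"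
  by (auto simp: proj_point_def cscale_def)

lemma proj_point_self: "z \<in> proj_point z"
  unfolding mem_proj_point by (intro exI[of _ 1]) simp

lemma cscale_cscale: "cscale a (cscale b z) = cscale (a * b) z"
  by (simp add: cscale_def mult.assoc)

lemma proj_point_cscale:
  assumes "a \<noteq> 0"
  shows "proj_point (cscale a z) = proj_point z"
proof (intro set_eqI iffI)
  fix w assume "w \<in> proj_point (cscale a z)"
  then obtain b where "b \<noteq> 0" "w = cscale b (cscale a z)" unfolding mem_proj_point by blast
  then show "w \<in> proj_point z"
    unfolding mem_proj_point using assms by (intro exI[of _ "b * a"]) (simp add: cscale_cscale)
next
  fix w assume "w \<in> proj_point z"
  then obtain b where "b \<noteq> 0" "w = cscale b z" unfolding mem_proj_point by blast
  then show "w \<in> proj_point (cscale a z)"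
    unfolding mem_proj_point using assms by (intro exI[of _ "b / a"]) (simp add: cscale_cscale)
qed

lemma proj_point_eqD: "proj_point z = proj_point w \<Longrightarrow> \<exists>a. a \<noteq> 0 \<and> w = cscale a z"
  using proj_point_self[of w] mem_proj_point by blast

definition punctured :: "nat \<Rightarrow> (nat \<Rightarrow> complex) set" where
  "punctured n = Cset (Suc n) - {\<lambda>_. 0}"

lemma openin_punctured: "openin (Ctop (Suc n)) (punctured n)"
proof -
  have "openin (Ctop (Suc n)) {z \<in> Cset (Suc n). z \<in> - {\<lambda>_. 0}}"
    by (rule openin_Ctop_continuous_preimage[OF openin_Ctop_UNIV continuous_on_id]) (simp add: open_Compl)
  moreover have "{z \<in> Cset (Suc n). z \<in> - {\<lambda>_. 0}} = punctured n" by (auto simp: punctured_def)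
  ultimately show ?thesis by simp
qed

lemma openin_proj_top:
  "openin (proj_top n) W \<longleftrightarrow> W \<subseteq> proj_points n \<and> openin (Ctop (Suc n)) {z \<in> punctured n. proj_point z \<in> W}"
proof -
  have "istopology (\<lambda>W. W \<subseteq> proj_points n \<and> openin (Ctop (Suc n)) {z \<in> punctured n. proj_point z \<in> W})"
    unfolding istopology_def
  proof (intro conjI allI impI)
    fix S T assume "S \<subseteq> proj_points n \<and> openin (Ctop (Suc n)) {z \<in> punctured n. proj_point z \<in> S}"
      and "T \<subseteq> proj_points n \<and> openin (Ctop (Suc n)) {z \<in> punctured n. proj_point z \<in> T}"
    moreover have "{z \<in> punctured n. proj_point z \<in> S \<inter> T}
      = {z \<in> punctured n. proj_point z \<in> S} \<inter> {z \<in> punctured n. proj_point z \<in> T}" by auto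
    ultimately show "S \<inter> T \<subseteq> proj_points n" "openin (Ctop (Suc n)) {z \<in> punctured n. proj_point z \<in> S \<inter> T}"
      by (auto intro: openin_Int)
  next
    fix K assume K: "\<forall>S\<in>K. S \<subseteq> proj_points n \<and> openin (Ctop (Suc n)) {z \<in> punctured n. proj_point z \<in> S}"
    then show "\<Union> K \<subseteq> proj_points n" by auto
    have "{z \<in> punctured n. proj_point z \<in> \<Union> K} = (\<Union>S\<in>K. {z \<in> punctured n. proj_point z \<in> S})" by auto
    then show "openin (Ctop (Suc n)) {z \<in> punctured n. proj_point z \<in> \<Union> K}" using K by (auto intro: openin_Union)
  qed
  then show ?thesis
    unfolding proj_top_def punctured_def[symmetric] by (subst topology_inverse') auto
qed

lemma proj_points_alt: "proj_points n = proj_point ` punctured n"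
  by (simp add: proj_points_def punctured_def)

lemma topspace_proj_top [simp]: "topspace (proj_top n) = proj_points n"
proof -
  have "{z \<in> punctured n. proj_point z \<in> proj_points n} = punctured n" by (auto simp: proj_points_alt)
  then have "openin (proj_top n) (proj_points n)" using openin_punctured by (simp add: openin_proj_top)
  then show ?thesis by (metis openin_proj_top openin_subset openin_topspace subset_antisym)
qed

text \<open>The preimage of the image is the union of all multiples of \<open>T\<close>.\<close>

lemma openin_proj_point_image:
  assumes T: "openin (Ctop (Suc n)) T" "T \<subseteq> punctured n"
  shows "openin (proj_top n) (proj_point ` T)"
proof -
  have "{z \<in> punctured n. proj_point z \<in> proj_point ` T} = (\<Union>a\<in>-{0}. {z \<in> Cset (Suc n). cscale a z \<in> T})"
  proof (intro set_eqI iffI)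
    fix z assume "z \<in> {z \<in> punctured n. proj_point z \<in> proj_point ` T}"
    then obtain t where t: "z \<in> punctured n" "t \<in> T" "proj_point z = proj_point t" by auto
    then obtain a where "a \<noteq> 0" "t = cscale a z" using proj_point_eqD by blast
    then show "z \<in> (\<Union>a\<in>-{0}. {z \<in> Cset (Suc n). cscale a z \<in> T})" using t by (auto simp: punctured_def)
  next
    fix z assume "z \<in> (\<Union>a\<in>-{0}. {z \<in> Cset (Suc n). cscale a z \<in> T})"
    then obtain a where a: "a \<noteq> 0" "z \<in> Cset (Suc n)" "cscale a z \<in> T" by auto
    then have "z \<noteq> (\<lambda>_. 0)" using T(2) by (auto simp: punctured_def cscale_def)
    then show "z \<in> {z \<in> punctured n. proj_point z \<in> proj_point ` T}"
      using a proj_point_cscale[OF a(1), of z] by (auto simp: punctured_def intro!: image_eqI[of _ _ "cscale a z"])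
  qed
  moreover have "openin (Ctop (Suc n)) (\<Union>a\<in>-{0}. {z \<in> Cset (Suc n). cscale a z \<in> T})"
  proof (intro openin_Union ballI)
    fix S assume "S \<in> (\<lambda>a. {z \<in> Cset (Suc n). cscale a z \<in> T}) ` (- {0})"
    then obtain a where S: "S = {z \<in> Cset (Suc n). cscale a z \<in> T}" by auto
    have "hol_fun (Suc n) (Cset (Suc n)) (\<lambda>z. cscale a z j)" for j by (simp add: hol_fun_mult)
    then show "openin (Ctop (Suc n)) S"
      unfolding S by (intro openin_Ctop_preimage[OF openin_Ctop_UNIV T(1)] hol_fun_cont) auto
  qed
  ultimately show ?thesis using T(2) by (auto simp: openin_proj_top proj_points_alt)
qed

lemma continuous_map_proj_point:
  assumes g: "continuous_map X (Ctop (Suc n)) g" and "g ` topspace X \<subseteq> punctured n"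
  shows "continuous_map X (proj_top n) (\<lambda>x. proj_point (g x))"
  unfolding continuous_map
proof (intro conjI allI impI)
  show "(\<lambda>x. proj_point (g x)) ` topspace X \<subseteq> topspace (proj_top n)"
    using assms(2) by (auto simp: proj_points_alt)
  fix W assume "openin (proj_top n) W"
  then have "openin (Ctop (Suc n)) {z \<in> punctured n. proj_point z \<in> W}" by (simp add: openin_proj_top)
  from openin_continuous_map_preimage[OF g this]
  have "openin X {x \<in> topspace X. g x \<in> {z \<in> punctured n. proj_point z \<in> W}}" .
  moreover have "{x \<in> topspace X. g x \<in> {z \<in> punctured n. proj_point z \<in> W}} = {x \<in> topspace X. proj_point (g x) \<in> W}"
    using assms(2) by auto
  ultimately show "openin X {x \<in> topspace X. proj_point (g x) \<in> W}" by simp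
qed

definition skip :: "nat \<Rightarrow> nat \<Rightarrow> nat" where
  "skip k j = (if j < k then j else Suc j)"

text \<open>The representative of the point with affine coordinates \<open>y\<close> whose entry \<open>k\<close> is \<open>1\<close>.\<close>

definition insert_one :: "nat \<Rightarrow> (nat \<Rightarrow> complex) \<Rightarrow> nat \<Rightarrow> complex" where
  "insert_one k y = (\<lambda>i. if i < k then y i else if i = k then 1 else y (i - 1))"

lemma affine_chart_apply:
  assumes "z k \<noteq> 0"
  shows "snd (affine_chart n k) (proj_point z) = (\<lambda>j. z (skip k j) / z k)"
proof -
  define w where "w = (SOME w. w \<in> proj_point z)"
  have "w \<in> proj_point z" unfolding w_def by (rule someI[of _ z]) (rule proj_point_self)
  then obtain a where "a \<noteq> 0" "w = cscale a z" unfolding mem_proj_point by blast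
  moreover have "snd (affine_chart n k) (proj_point z) = (\<lambda>j. w (skip k j) / w k)"
    by (simp add: affine_chart_def Let_def w_def skip_def)
  ultimately show ?thesis by simp
qed

lemma affine_chart_domain:
  assumes "z \<in> Cset (Suc n)"
  shows "proj_point z \<in> fst (affine_chart n k) \<longleftrightarrow> z k \<noteq> 0"
proof
  assume "proj_point z \<in> fst (affine_chart n k)"
  then obtain w where w: "w k \<noteq> 0" "proj_point z = proj_point w" by (auto simp: affine_chart_def)
  then obtain a where "a \<noteq> 0" "w = cscale a z" using proj_point_eqD by blast
  then show "z k \<noteq> 0" using w by auto
qed (use assms in \<open>auto simp: affine_chart_def\<close>)

lemma insert_one_skip [simp]: "insert_one k y k = 1" "insert_one k y (skip k j) = y j"
  by (auto simp: insert_one_def skip_def)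

lemma insert_one_Cset: "y \<in> Cset n \<Longrightarrow> k \<le> n \<Longrightarrow> insert_one k y \<in> Cset (Suc n)"
  by (auto simp: insert_one_def Cset_def)

lemma insert_one_quotients:
  assumes "z k \<noteq> 0"
  shows "insert_one k (\<lambda>j. z (skip k j) / z k) = cscale (1 / z k) z"
proof
  fix i
  consider "i < k" | "i = k" | "k < i" by linarith
  then show "insert_one k (\<lambda>j. z (skip k j) / z k) i = cscale (1 / z k) z i"
    by cases (use assms in \<open>auto simp: insert_one_def skip_def\<close>)
qed

lemma hol_fun_insert_one: "(\<And>i. hol_fun n S (\<lambda>z. y z i)) \<Longrightarrow> hol_fun n S (\<lambda>z. insert_one k (y z) i)"
  by (cases "i < k"; cases "i = k"; simp add: insert_one_def)

lemma quotients_Cset: "z \<in> Cset (Suc n) \<Longrightarrow> k \<le> n \<Longrightarrow> (\<lambda>j. z (skip k j) / z k) \<in> Cset n"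
  by (auto simp: Cset_def skip_def)

lemma affine_chart_range: "k \<le> n \<Longrightarrow> snd (affine_chart n k) ` fst (affine_chart n k) = Cset n"
proof (intro equalityI subsetI)
  assume k: "k \<le> n"
  fix y assume "y \<in> snd (affine_chart n k) ` fst (affine_chart n k)"
  then obtain z where z: "z \<in> Cset (Suc n)" "z k \<noteq> 0" "y = snd (affine_chart n k) (proj_point z)"
    by (auto simp: affine_chart_def)
  then have "y = (\<lambda>j. z (skip k j) / z k)" by (simp add: affine_chart_apply)
  then show "y \<in> Cset n" using quotients_Cset[OF z(1) k] by simp
next
  assume k: "k \<le> n"
  fix y assume y: "y \<in> Cset n"
  have "y = snd (affine_chart n k) (proj_point (insert_one k y))" by (simp add: affine_chart_apply)
  moreover have "proj_point (insert_one k y) \<in> fst (affine_chart n k)"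
    using affine_chart_domain[OF insert_one_Cset[OF y k]] by simp
  ultimately show "y \<in> snd (affine_chart n k) ` fst (affine_chart n k)" by blast
qed

lemma proj_point_insert_one_chart:
  assumes "L \<in> fst (affine_chart n k)"
  shows "proj_point (insert_one k (snd (affine_chart n k) L)) = L"
proof -
  obtain z where z: "z \<in> Cset (Suc n)" "z k \<noteq> 0" "L = proj_point z" using assms by (auto simp: affine_chart_def)
  then show ?thesis by (simp add: affine_chart_apply insert_one_quotients proj_point_cscale)
qed

lemma affine_chart_open: "k \<le> n \<Longrightarrow> openin (proj_top n) (fst (affine_chart n k))"
proof -
  have "openin (Ctop (Suc n)) {z \<in> Cset (Suc n). z k \<in> - {0}}"
    by (rule openin_Ctop_continuous_preimage[OF openin_Ctop_UNIV hol_fun_cont[OF hol_fun_coord[where n = 0]]]) (simp add: open_Compl)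
  then have "openin (Ctop (Suc n)) {z \<in> Cset (Suc n). z k \<noteq> 0}" by simp
  then show ?thesis
    unfolding affine_chart_def fst_conv by (rule openin_proj_point_image) (auto simp: punctured_def)
qed

lemma affine_chart_homeomorphic:
  assumes k: "k \<le> n"
  shows "homeomorphic_map (subtopology (proj_top n) (fst (affine_chart n k))) (Ctop n) (snd (affine_chart n k))"
proof -
  let ?U = "fst (affine_chart n k)" and ?\<phi> = "snd (affine_chart n k)"
  have top: "topspace (subtopology (proj_top n) ?U) = ?U"
    using openin_subset[OF affine_chart_open[OF k]] by auto
  have inv: "?\<phi> (proj_point (insert_one k y)) = y" for y by (simp add: affine_chart_apply)
  have "homeomorphic_maps (subtopology (proj_top n) ?U) (Ctop n) ?\<phi> (\<lambda>y. proj_point (insert_one k y))"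
    unfolding homeomorphic_maps_def top
  proof (intro conjI ballI)
    show "continuous_map (subtopology (proj_top n) ?U) (Ctop n) ?\<phi>"
      unfolding continuous_map top
    proof (intro conjI allI impI)
      show "?\<phi> ` ?U \<subseteq> topspace (Ctop n)" using affine_chart_range[OF k] by simp
      fix V assume V: "openin (Ctop n) V"
      define A where "A = {z \<in> Cset (Suc n). z k \<in> - {0}}"
      have A: "openin (Ctop (Suc n)) A" unfolding A_def
        by (rule openin_Ctop_continuous_preimage[OF openin_Ctop_UNIV hol_fun_cont[OF hol_fun_coord[where n = 0]]]) (simp add: open_Compl)
      have h: "hol_fun (Suc n) A (\<lambda>z. z (skip k j) / z k)" for j
        by (intro hol_fun_divide hol_fun_coord) (simp add: A_def)
      have "openin (Ctop (Suc n)) {z \<in> A. (\<lambda>j. z (skip k j) / z k) \<in> V}"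
        by (rule openin_Ctop_preimage[OF A V hol_fun_cont[OF h]]) (auto simp: A_def intro: quotients_Cset k)
      then have "openin (proj_top n) (proj_point ` {z \<in> A. (\<lambda>j. z (skip k j) / z k) \<in> V})"
        by (rule openin_proj_point_image) (auto simp: A_def punctured_def)
      moreover have "proj_point ` {z \<in> A. (\<lambda>j. z (skip k j) / z k) \<in> V} = {x \<in> ?U. ?\<phi> x \<in> V}"
        by (auto simp: A_def affine_chart_def[of n k] affine_chart_apply[unfolded affine_chart_def snd_conv]
            intro!: image_eqI)
      ultimately have "openin (proj_top n) {x \<in> ?U. ?\<phi> x \<in> V}" by simp
      moreover have "{x \<in> ?U. ?\<phi> x \<in> V} \<inter> ?U = {x \<in> ?U. ?\<phi> x \<in> V}" by auto
      ultimately show "openin (subtopology (proj_top n) ?U) {x \<in> ?U. ?\<phi> x \<in> V}"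
        unfolding openin_subtopology by (intro exI[of _ "{x \<in> ?U. ?\<phi> x \<in> V}"]) simp
    qed
    have "continuous_map (Ctop n) (proj_top n) (\<lambda>y. proj_point (insert_one k y))"
    proof (rule continuous_map_proj_point)
      have "continuous_map (Ctop n) euclidean (\<lambda>y. insert_one k y i)" for i
        by (simp add: insert_one_def continuous_map_Ctop_coord)
      then show "continuous_map (Ctop n) (Ctop (Suc n)) (insert_one k)"
        using insert_one_Cset[OF _ k] by (auto simp: continuous_map_into_Ctop)
      have "insert_one k y \<noteq> (\<lambda>_. 0)" for y
      proof
        assume "insert_one k y = (\<lambda>_. 0)"
        then have "insert_one k y k = 0" by simp
        then show False by simp
      qed
      then show "insert_one k ` topspace (Ctop n) \<subseteq> punctured n"
        using insert_one_Cset[OF _ k] by (auto simp: punctured_def)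
    qed
    then show "continuous_map (Ctop n) (subtopology (proj_top n) ?U) (\<lambda>y. proj_point (insert_one k y))"
      using affine_chart_domain[OF insert_one_Cset[OF _ k]] by (auto simp: continuous_map_in_subtopology)
    show "proj_point (insert_one k (?\<phi> x)) = x" if "x \<in> ?U" for x
      by (rule proj_point_insert_one_chart[OF that])
    show "?\<phi> (proj_point (insert_one k y)) = y" for y by (rule inv)
  qed
  then show ?thesis using homeomorphic_map_maps by blast
qed

text \<open>Distinct lines are separated by a continuous function: the sum of the absolute values of the \<open>2 \<times> 2\<close>
  minors of the pair \<open>(z, w)\<close>, divided by the sum norm of \<open>z\<close>, only depends on the line of \<open>z\<close>.\<close>

lemma Hausdorff_proj_top: "Hausdorff_space (proj_top n)"
  unfolding Hausdorff_space_def
proof (intro allI impI)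
  fix L L' assume L: "L \<in> topspace (proj_top n) \<and> L' \<in> topspace (proj_top n) \<and> L \<noteq> L'"
  then obtain w where w: "w \<in> punctured n" "L = proj_point w" by (auto simp: proj_points_alt)
  obtain w' where w': "w' \<in> punctured n" "L' = proj_point w'" using L by (auto simp: proj_points_alt)
  \<comment> \<open>the minors of the matrix with rows \<open>z\<close> and \<open>w\<close> vanish exactly on the line of \<open>w\<close>\<close>
  define D where "D = (\<lambda>z::nat \<Rightarrow> complex. \<Sum>i\<le>n. \<Sum>j\<le>n. cmod (z i * w j - z j * w i))"
  define h where "h = (\<lambda>z. D z / (\<Sum>i\<le>n. cmod (z i)))"
  have pos: "(\<Sum>i\<le>n. cmod (z i)) > 0" if z: "z \<in> punctured n" for z
  proof -
    obtain i where i: "z i \<noteq> 0" using z by (auto simp: punctured_def)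
    then have "i \<le> n" using z by (force simp: punctured_def Cset_def not_less_eq_eq)
    then show ?thesis using i by (intro sum_pos2[of _ i]) auto
  qed
  have hc: "continuous_on (punctured n) h"
    unfolding h_def D_def using pos
    by (intro continuous_intros continuous_on_subset[OF continuous_on_product_coordinates]) (force+)
  have hs: "h (cscale a z) = h z" if "a \<noteq> 0" for a z
  proof -
    have "D (cscale a z) = cmod a * D z"
      by (simp add: D_def norm_mult[symmetric] sum_distrib_left right_diff_distrib mult.assoc)
    moreover have "(\<Sum>i\<le>n. cmod (cscale a z i)) = cmod a * (\<Sum>i\<le>n. cmod (z i))"
      by (simp add: norm_mult sum_distrib_left)
    ultimately show ?thesis using that by (simp add: h_def)
  qed
  have op: "openin (proj_top n) (proj_point ` {z \<in> punctured n. h z \<in> B})" if "open B" for B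
    by (rule openin_proj_point_image[OF openin_Ctop_continuous_preimage[OF openin_punctured hc that]]) auto
  have h0: "h w = 0" by (simp add: h_def D_def mult.commute)
  have D': "D w' > 0"
  proof (rule ccontr)
    assume "\<not> D w' > 0"
    moreover have "D w' \<ge> 0" by (simp add: D_def sum_nonneg)
    ultimately have "D w' = 0" by simp
    then have z: "w' i * w j = w' j * w i" if "i \<le> n" "j \<le> n" for i j
      using that unfolding D_def by (simp add: sum_nonneg_eq_0_iff sum_nonneg)
    obtain i where i: "w i \<noteq> 0" using w by (auto simp: punctured_def)
    then have "i \<le> n" using w by (force simp: punctured_def Cset_def not_less_eq_eq)
    have "w' = cscale (w' i / w i) w"
    proof
      fix j show "w' j = cscale (w' i / w i) w j"
      proof (cases "j \<le> n")
        case True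
        then show ?thesis using z[OF True \<open>i \<le> n\<close>] i by (simp add: field_simps)
      next
        case False
        then show ?thesis using w(1) w'(1) by (simp add: punctured_def Cset_def)
      qed
    qed
    moreover from this have "w' i / w i \<noteq> 0" using w'(1) by (auto simp: punctured_def cscale_def)
    ultimately have "L = L'" using w w' proj_point_cscale by metis
    then show False using L by simp
  qed
  then have h': "h w' > 0" using pos[OF w'(1)] by (simp add: h_def)
  show "\<exists>U V. openin (proj_top n) U \<and> openin (proj_top n) V \<and> L \<in> U \<and> L' \<in> V \<and> disjnt U V"
  proof (intro exI conjI)
    show "openin (proj_top n) (proj_point ` {z \<in> punctured n. h z \<in> {..<h w' / 2}})" by (intro op open_lessThan)
    show "openin (proj_top n) (proj_point ` {z \<in> punctured n. h z \<in> {h w' / 2<..}})" by (intro op open_greaterThan)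
    show "L \<in> proj_point ` {z \<in> punctured n. h z \<in> {..<h w' / 2}}" using w h0 h' by auto
    show "L' \<in> proj_point ` {z \<in> punctured n. h z \<in> {h w' / 2<..}}" using w' h' by auto
    show "disjnt (proj_point ` {z \<in> punctured n. h z \<in> {..<h w' / 2}}) (proj_point ` {z \<in> punctured n. h z \<in> {h w' / 2<..}})"
      unfolding disjnt_iff
    proof (intro allI notI)
      fix x assume "x \<in> proj_point ` {z \<in> punctured n. h z \<in> {..<h w' / 2}} \<and> x \<in> proj_point ` {z \<in> punctured n. h z \<in> {h w' / 2<..}}"
      then obtain z z' where zz: "h z < h w' / 2" "h z' > h w' / 2" "proj_point z = proj_point z'" by auto
      then obtain a where "a \<noteq> 0" "z' = cscale a z" using proj_point_eqD by blast
      then show False using hs[of a z] zz by simp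
    qed
  qed
qed

lemma second_countable_proj_top: "second_countable (proj_top n)"
proof (rule second_countable_open_map_image[where X = "subtopology (Ctop (Suc n)) (punctured n)" and f = proj_point])
  have t: "topspace (subtopology (Ctop (Suc n)) (punctured n)) = punctured n" by (auto simp: punctured_def)
  show "continuous_map (subtopology (Ctop (Suc n)) (punctured n)) (proj_top n) proj_point"
    using continuous_map_proj_point[of "subtopology (Ctop (Suc n)) (punctured n)" n "\<lambda>z. z"]
    unfolding t by (simp add: continuous_map_from_subtopology)
  show "open_map (subtopology (Ctop (Suc n)) (punctured n)) (proj_top n) proj_point"
    unfolding open_map_def
  proof (intro allI impI openin_proj_point_image)
    fix U assume U: "openin (subtopology (Ctop (Suc n)) (punctured n)) U"
    show "openin (Ctop (Suc n)) U" by (rule openin_trans_full[OF U openin_punctured])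
    show "U \<subseteq> punctured n" using openin_subset[OF U] unfolding t .
  qed
  show "proj_point ` topspace (subtopology (Ctop (Suc n)) (punctured n)) = topspace (proj_top n)"
    unfolding t topspace_proj_top proj_points_alt ..
  show "second_countable (subtopology (Ctop (Suc n)) (punctured n))"
    by (rule second_countable_subtopology[OF second_countable_Ctop])
qed

lemma complex_manifold_projective_space: "complex_manifold (projective_space n)"
proof (rule complex_manifoldI)
  let ?M = "projective_space n"
  have simps [simp]: "cm_top ?M = proj_top n" "cm_dim ?M = n" "cm_atlas ?M = affine_chart n ` {..n}"
    by (simp_all add: projective_space_def)
  show "Hausdorff_space (cm_top ?M)" "second_countable (cm_top ?M)"
    by (simp_all add: Hausdorff_proj_top second_countable_proj_top)
  show "(\<Union>c\<in>cm_atlas ?M. fst c) = topspace (cm_top ?M)"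
  proof (intro equalityI subsetI)
    fix L assume "L \<in> (\<Union>c\<in>cm_atlas ?M. fst c)"
    then obtain k where "k \<le> n" "L \<in> fst (affine_chart n k)" by auto
    then show "L \<in> topspace (cm_top ?M)" using openin_subset[OF affine_chart_open] by auto
  next
    fix L assume "L \<in> topspace (cm_top ?M)"
    then obtain z where z: "z \<in> punctured n" "L = proj_point z" by (auto simp: proj_points_alt)
    then obtain k where k: "z k \<noteq> 0" by (auto simp: punctured_def)
    then have "k \<le> n" using z by (force simp: punctured_def Cset_def not_less_eq_eq)
    then show "L \<in> (\<Union>c\<in>cm_atlas ?M. fst c)" using z k affine_chart_domain[of z n k] by (auto simp: punctured_def)
  qed
  fix c assume "c \<in> cm_atlas ?M"
  then obtain k where k: "k \<le> n" and c: "c = affine_chart n k" by auto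
  show "openin (cm_top ?M) (fst c)" using affine_chart_open[OF k] by (simp add: c)
  show "openin (Ctop (cm_dim ?M)) (snd c ` fst c)" using affine_chart_range[OF k] by (simp add: c)
  show "homeomorphic_map (subtopology (cm_top ?M) (fst c)) (subtopology (Ctop (cm_dim ?M)) (snd c ` fst c)) (snd c)"
    using affine_chart_homeomorphic[OF k] subtopology_topspace[of "Ctop n"] by (simp add: c affine_chart_range[OF k])
  fix d j assume "d \<in> cm_atlas ?M" and j: "j < cm_dim ?M"
    and o: "openin (Ctop (cm_dim ?M)) (snd c ` (fst c \<inter> fst d))"
  then obtain l where l: "l \<le> n" and d: "d = affine_chart n l" by auto
  have inj: "inj_on (snd c) (fst c)"
    unfolding c by (rule inj_on_inverseI[where g = "\<lambda>y. proj_point (insert_one k y)"]) (rule proj_point_insert_one_chart)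
  have key: "insert_one k y l \<noteq> 0 \<and> in_chart c (snd d) y j = insert_one k y (skip l j) / insert_one k y l"
    if y: "y \<in> snd c ` (fst c \<inter> fst d)" for y
  proof -
    obtain x where x: "x \<in> fst c" "x \<in> fst d" "y = snd c x" using y by auto
    have yC: "y \<in> Cset n" using x affine_chart_range[OF k] c by auto
    have xp: "x = proj_point (insert_one k y)" using proj_point_insert_one_chart[of x n k] x c by simp
    have l0: "insert_one k y l \<noteq> 0"
      using affine_chart_domain[OF insert_one_Cset[OF yC k], of l] x(2) xp d by simp
    moreover have "in_chart c (snd d) y = snd d x" using inj x by (simp add: in_chart_def)
    ultimately show ?thesis unfolding xp d by (simp add: affine_chart_apply)
  qed
  have "hol_fun n (snd c ` (fst c \<inter> fst d)) (\<lambda>y. insert_one k y (skip l j) / insert_one k y l)"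
    by (intro hol_fun_divide hol_fun_insert_one hol_fun_coord) (use key in blast)
  then have "hol_fun n (snd c ` (fst c \<inter> fst d)) (\<lambda>y. in_chart c (snd d) y j)"
    by (rule hol_fun_cong) (use o key in auto)
  then show "hol_fun (cm_dim ?M) (snd c ` (fst c \<inter> fst d)) (\<lambda>z. in_chart c (snd d) z j)" by simp
qed


section \<open>The space of cubic rational maps\<close>

lemma cone_punctured: "map_cone \<subseteq> punctured 7"
proof
  fix v assume v: "v \<in> map_cone"
  then have "v \<noteq> cscale 0 v" using resultant_hom[of 0 v] by (auto simp: map_cone_def)
  then show "v \<in> punctured 7" using v by (auto simp: punctured_def map_cone_def)
qed

text \<open>The defining condition of the space, to have no common zero, becomes the nonvanishing of the resultant.\<close>

lemma rational_map_space_3: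
  "rational_map_space 3 = open_submanifold (projective_space 7) (proj_point ` map_cone)"
proof -
  have pp: "pair_point 3 p q = proj_point (join 4 p q)" for p q
    unfolding pair_point_def join_def by (rule arg_cong[of _ _ proj_point]) (auto simp: less_Suc_eq_le)
  have tb: "numerator (join 4 p q) = p" "denominator (join 4 p q) = q" if "p \<in> Cset 4" for p q
    using that by (auto simp: numerator_def denominator_def join_def Cset_def)
  have "{pair_point 3 p q | p q. p \<in> Cset (Suc 3) \<and> q \<in> Cset (Suc 3) \<and> no_common_zero 3 p q} = proj_point ` map_cone"
  proof (intro equalityI subsetI)
    fix L assume "L \<in> {pair_point 3 p q | p q. p \<in> Cset (Suc 3) \<and> q \<in> Cset (Suc 3) \<and> no_common_zero 3 p q}"
    then obtain p q where pq: "p \<in> Cset 4" "q \<in> Cset 4" "no_common_zero 3 p q" "L = proj_point (join 4 p q)"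
      by (auto simp: pp)
    moreover have "join 4 p q \<in> map_cone"
      using pq join_Cset[OF pq(1,2)] by (simp add: map_cone_def resultant_def tb bez_det_nonzero_iff)
    ultimately show "L \<in> proj_point ` map_cone" by blast
  next
    fix L assume "L \<in> proj_point ` map_cone"
    then obtain v where v: "v \<in> map_cone" "L = proj_point v" by blast
    have "v = join 4 (numerator v) (denominator v)" by (auto simp: join_def numerator_def denominator_def)
    moreover have "numerator v \<in> Cset 4" "denominator v \<in> Cset 4" using v by (auto simp: map_cone_def Cset_def numerator_def)
    moreover have "no_common_zero 3 (numerator v) (denominator v)" using v by (simp add: map_cone_def resultant_def bez_det_nonzero_iff)
    moreover have "L = pair_point 3 (numerator v) (denominator v)"
      unfolding pp v(2) by (rule arg_cong[of _ _ proj_point]) fact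
    ultimately show "L \<in> {pair_point 3 p q | p q. p \<in> Cset (Suc 3) \<and> q \<in> Cset (Suc 3) \<and> no_common_zero 3 p q}"
      by auto
  qed
  then show ?thesis by (simp add: rational_map_space_def)
qed

abbreviation RM :: "(nat \<Rightarrow> complex) set cmanifold" where
  "RM \<equiv> rational_map_space 3"

definition rchart :: "nat \<Rightarrow> (nat \<Rightarrow> complex) set cchart" where
  "rchart k = (fst (affine_chart 7 k) \<inter> proj_point ` map_cone, snd (affine_chart 7 k))"

lemma RM_simps:
  "cm_top RM = subtopology (proj_top 7) (proj_point ` map_cone)" "cm_dim RM = 7" "cm_atlas RM = rchart ` {..7}"
  by (simp_all add: rational_map_space_3 open_submanifold_def projective_space_def rchart_def image_image case_prod_beta)

lemma openin_RM: "openin (proj_top 7) (proj_point ` map_cone)"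
  using openin_proj_point_image[of 7 map_cone] openin_cone cone_punctured by simp

lemma complex_manifold_RM: "complex_manifold RM"
  unfolding rational_map_space_3
  by (rule complex_manifold_open_submanifold[OF complex_manifold_projective_space])
    (simp add: projective_space_def openin_RM)

lemma topspace_RM: "topspace (cm_top RM) = proj_point ` map_cone"
  using openin_subset[OF openin_RM] by (auto simp: RM_simps)

lemma cone_Cset: "v \<in> map_cone \<Longrightarrow> v \<in> Cset 8"
  by (simp add: map_cone_def)

lemma rchart_domain: "v \<in> map_cone \<Longrightarrow> proj_point v \<in> fst (rchart k) \<longleftrightarrow> v k \<noteq> 0"
  using affine_chart_domain[of v 7 k] by (simp add: rchart_def cone_Cset)

lemma rchart_apply: "v k \<noteq> 0 \<Longrightarrow> snd (rchart k) (proj_point v) = (\<lambda>j. v (skip k j) / v k)"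
  by (simp add: rchart_def affine_chart_apply)

lemma proj_point_insert_one_rchart:
  assumes "L \<in> fst (rchart k)"
  shows "proj_point (insert_one k (snd (rchart k) L)) = L" "insert_one k (snd (rchart k) L) \<in> map_cone"
proof -
  obtain v where v: "v \<in> map_cone" "L = proj_point v" "v k \<noteq> 0"
    using assms rchart_domain by (auto simp: rchart_def)
  have "insert_one k (snd (rchart k) L) = cscale (1 / v k) v"
    unfolding v(2) rchart_apply[of v k, OF v(3)] by (rule insert_one_quotients[of v k, OF v(3)])
  then show "proj_point (insert_one k (snd (rchart k) L)) = L" "insert_one k (snd (rchart k) L) \<in> map_cone"
    using v by (simp_all add: proj_point_cscale cone_cscale)
qed

text \<open>Maps into the quotient are holomorphic when they lift to the cone in each chart of the source; the
  lifts in different charts may differ by nonvanishing factors.\<close>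

lemma holomorphic_map_into_RM:
  assumes P: "complex_manifold P"
    and g: "\<And>c i. c \<in> cm_atlas P \<Longrightarrow> hol_fun (cm_dim P) (snd c ` fst c) (\<lambda>z. g c z i)"
    and gc: "\<And>c x. c \<in> cm_atlas P \<Longrightarrow> x \<in> fst c \<Longrightarrow> g c (snd c x) \<in> map_cone"
    and f: "\<And>c x. c \<in> cm_atlas P \<Longrightarrow> x \<in> fst c \<Longrightarrow> f x = proj_point (g c (snd c x))"
  shows "holomorphic_map P RM f"
proof (rule holomorphic_mapI[OF P complex_manifold_RM])
  have fin: "f x \<in> proj_point ` map_cone" if "c \<in> cm_atlas P" "x \<in> fst c" for c x
    using f[OF that] gc[OF that] by blast
  have gcont: "continuous_map (subtopology (cm_top P) (fst c)) (proj_top 7) (\<lambda>x. proj_point (g c (snd c x)))"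
    if c: "c \<in> cm_atlas P" for c
  proof (rule continuous_map_proj_point)
    have t: "topspace (subtopology (cm_top P) (fst c)) = fst c" using chart_subset[OF P c] by auto
    have cc: "continuous_map (subtopology (cm_top P) (fst c)) (subtopology (Ctop (cm_dim P)) (snd c ` fst c)) (snd c)"
      by (rule homeomorphic_imp_continuous_map[OF complex_manifoldD(6)[OF P c]])
    have "subtopology (Ctop (cm_dim P)) (snd c ` fst c) = top_of_set (snd c ` fst c)"
      using chart_in_Cset[OF P c] by (simp add: Ctop_def subtopology_subtopology inf.absorb2 image_subset_iff)
    then have "continuous_map (subtopology (cm_top P) (fst c)) euclidean ((\<lambda>z. g c z i) \<circ> snd c)" for i
      using hol_fun_cont[OF g[OF c]] by (intro continuous_map_compose[OF cc]) simp
    then show "continuous_map (subtopology (cm_top P) (fst c)) (Ctop (Suc 7)) (\<lambda>x. g c (snd c x))"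
      unfolding continuous_map_into_Ctop t using gc[OF c] cone_Cset by (auto simp: o_def)
    show "(\<lambda>x. g c (snd c x)) ` topspace (subtopology (cm_top P) (fst c)) \<subseteq> punctured 7"
      unfolding t using gc[OF c] cone_punctured by auto
  qed
  show "continuous_map (cm_top P) (cm_top RM) f"
    unfolding RM_simps continuous_map_in_subtopology
  proof (intro conjI)
    show "continuous_map (cm_top P) (proj_top 7) f"
      unfolding continuous_map
    proof (intro conjI allI impI)
      show "f ` topspace (cm_top P) \<subseteq> topspace (proj_top 7)"
        unfolding complex_manifoldD(3)[OF P, symmetric] using fin openin_subset[OF openin_RM] by auto
      fix V assume V: "openin (proj_top 7) V"
      have "{x \<in> topspace (cm_top P). f x \<in> V} = (\<Union>c\<in>cm_atlas P. {x \<in> fst c. proj_point (g c (snd c x)) \<in> V})"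
        unfolding complex_manifoldD(3)[OF P, symmetric] using f by auto
      moreover have "openin (cm_top P) {x \<in> fst c. proj_point (g c (snd c x)) \<in> V}" if c: "c \<in> cm_atlas P" for c
      proof -
        have t: "topspace (subtopology (cm_top P) (fst c)) = fst c" using chart_subset[OF P c] by auto
        from openin_continuous_map_preimage[OF gcont[OF c] V]
        have "openin (subtopology (cm_top P) (fst c)) {x \<in> fst c. proj_point (g c (snd c x)) \<in> V}" unfolding t .
        then show ?thesis by (rule openin_trans_full[OF _ complex_manifoldD(4)[OF P c]])
      qed
      ultimately show "openin (cm_top P) {x \<in> topspace (cm_top P). f x \<in> V}" by auto
    qed
    show "f \<in> topspace (cm_top P) \<rightarrow> proj_point ` map_cone"
      unfolding complex_manifoldD(3)[OF P, symmetric] using fin by auto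
  qed
  then have cont: "continuous_map (cm_top P) (cm_top RM) f" .
  fix c d j assume c: "c \<in> cm_atlas P" and d: "d \<in> cm_atlas RM" and j: "j < cm_dim RM"
  then obtain k where k: "k \<le> 7" "d = rchart k" by (auto simp: RM_simps)
  have "openin (cm_top P) {x \<in> topspace (cm_top P). f x \<in> fst d}"
    by (rule openin_continuous_map_preimage[OF cont complex_manifoldD(4)[OF complex_manifold_RM d]])
  then have "openin (cm_top P) (fst c \<inter> {x \<in> topspace (cm_top P). f x \<in> fst d})"
    by (rule openin_Int[OF complex_manifoldD(4)[OF P c]])
  moreover have "fst c \<inter> {x \<in> topspace (cm_top P). f x \<in> fst d} = {x \<in> fst c. f x \<in> fst d}"
    using chart_subset[OF P c] by auto
  ultimately have o: "openin (Ctop (cm_dim P)) (snd c ` {x \<in> fst c. f x \<in> fst d})"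
    by (intro chart_image_open[OF P c]) auto
  have nz: "g c z k \<noteq> 0 \<and> in_chart c (snd d \<circ> f) z j = g c z (skip k j) / g c z k"
    if z: "z \<in> snd c ` {x \<in> fst c. f x \<in> fst d}" for z
  proof -
    obtain x where x: "x \<in> fst c" "f x \<in> fst d" "z = snd c x" using z by auto
    have "g c z k \<noteq> 0" using x f[OF c x(1)] rchart_domain[OF gc[OF c x(1)]] k by simp
    moreover have "in_chart c (snd d \<circ> f) z = snd d (f x)" using in_chart_apply[OF P c x(1), of "snd d \<circ> f"] x(3) by simp
    ultimately show ?thesis using f[OF c x(1)] x(3) k by (simp add: rchart_apply)
  qed
  have "hol_fun (cm_dim P) (snd c ` {x \<in> fst c. f x \<in> fst d}) (\<lambda>z. g c z (skip k j) / g c z k)"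
    by (intro hol_fun_divide hol_fun_subset[OF g[OF c]]) (use nz in auto)
  then show "hol_fun (cm_dim P) (snd c ` {x \<in> fst c. f x \<in> fst d}) (\<lambda>z. in_chart c (snd d \<circ> f) z j)"
    by (rule hol_fun_cong) (use o nz in auto)
qed

lemma holomorphic_map_proj_point:
  assumes "\<And>i. hol_fun n (Cset n) (\<lambda>z. g z i)" "\<And>z. z \<in> Cset n \<Longrightarrow> g z \<in> map_cone"
  shows "holomorphic_map (complex_space n) RM (\<lambda>z. proj_point (g z))"
  by (rule holomorphic_map_into_RM[OF complex_manifold_complex_space, where g = "\<lambda>_. g"]) (use assms in auto)

section \<open>The dominating spray\<close>

text \<open>Square matrices of size \<open>8\<close> are encoded as vectors of length \<open>64\<close>, row by row.\<close>

definition mat_act :: "(nat \<Rightarrow> complex) \<Rightarrow> (nat \<Rightarrow> complex) \<Rightarrow> nat \<Rightarrow> complex" where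
  "mat_act e v i = (if i < 8 then \<Sum>l<8. e (8 * i + l) * v l else 0)"

lemma mat_act_cscale: "mat_act e (cscale c v) = cscale c (mat_act e v)" "mat_act (cscale c e) v = cscale c (mat_act e v)"
  by (auto simp: mat_act_def sum_distrib_left mult_ac)

lemma hol_fun_mat_act:
  assumes "\<And>i. hol_fun n S (\<lambda>z. e z i)" "\<And>i. hol_fun n S (\<lambda>z. v z i)"
  shows "hol_fun n S (\<lambda>z. mat_act (e z) (v z) i)"
proof (cases "i < 8")
  case True
  have "hol_fun n S (\<lambda>z. \<Sum>l<8. e z (8 * i + l) * v z l)" by (intro hol_fun_sum hol_fun_mult assms)
  then show ?thesis using True by (simp add: mat_act_def)
qed (simp add: mat_act_def)

text \<open>The choice of the representative \<open>v\<close> is immaterial by \<open>cone_spray_hom\<close>, see \<open>spray_proj_point\<close>.\<close>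

definition spray :: "(nat \<Rightarrow> complex) set \<times> (nat \<Rightarrow> complex) \<Rightarrow> (nat \<Rightarrow> complex) set" where
  "spray = (\<lambda>(L, e). let v = (SOME v. v \<in> L) in proj_point (cone_spray v (mat_act e v)))"

lemma spray_proj_point: "spray (proj_point v, e) = proj_point (cone_spray v (mat_act e v))"
proof -
  define w where "w = (SOME w. w \<in> proj_point v)"
  have "w \<in> proj_point v" unfolding w_def by (rule someI[of _ v]) (rule proj_point_self)
  then obtain a where a: "a \<noteq> 0" "w = cscale a v" unfolding mem_proj_point by blast
  have "spray (proj_point v, e) = proj_point (cone_spray w (mat_act e w))" by (simp add: spray_def Let_def w_def)
  also have "\<dots> = proj_point (cone_spray v (mat_act e v))"
    unfolding a(2) mat_act_cscale cone_spray_hom[OF a(1)] proj_point_cscale[OF a(1)] ..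
  finally show ?thesis .
qed

lemma holomorphic_spray_RM: "holomorphic_spray RM (trivial_bundle RM 64) spray"
  unfolding holomorphic_spray_def
proof (intro conjI ballI)
  let ?P = "product_manifold RM (complex_space 64)"
  have P: "complex_manifold ?P" by (rule complex_manifold_product[OF complex_manifold_RM complex_manifold_complex_space])
  show "holomorphic_vector_bundle RM (trivial_bundle RM 64)" by (rule holomorphic_vector_bundle_trivial[OF complex_manifold_RM])
  \<comment> \<open>the local lift of the spray in the chart \<open>p\<close>; the index \<open>k\<close> of the affine chart is recovered from \<open>p\<close>\<close>
  define G where "G = (\<lambda>(p :: ((nat \<Rightarrow> complex) set \<times> (nat \<Rightarrow> complex)) cchart) z.
     let k = (SOME k. k \<le> 7 \<and> p = prod_chart 7 (rchart k) (Cset 64, id)); v = insert_one k (split1 7 z)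
     in cone_spray v (mat_act (split2 7 z) v))"
  have main: "\<exists>k\<le>7. p = prod_chart 7 (rchart k) (Cset 64, id) \<and>
      (\<forall>z. G p z = cone_spray (insert_one k (split1 7 z)) (mat_act (split2 7 z) (insert_one k (split1 7 z))))"
    if "p \<in> cm_atlas ?P" for p
  proof -
    have ex: "\<exists>k. k \<le> 7 \<and> p = prod_chart 7 (rchart k) (Cset 64, id)"
      using that by (auto simp: atlas_product_complex_space RM_simps)
    from someI_ex[OF ex] show ?thesis unfolding G_def Let_def by blast
  qed
  have "holomorphic_map ?P RM spray"
  proof (rule holomorphic_map_into_RM[OF P, where g = G])
    fix p assume p: "p \<in> cm_atlas ?P"
    obtain k where k: "k \<le> 7" "p = prod_chart 7 (rchart k) (Cset 64, id)"
      and G: "\<And>z. G p z = cone_spray (insert_one k (split1 7 z)) (mat_act (split2 7 z) (insert_one k (split1 7 z)))"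
      using main[OF p] by blast
    have c: "rchart k \<in> cm_atlas RM" using k by (auto simp: RM_simps)
    have split: "split1 7 (snd p (x, e)) = snd (rchart k) x" "split2 7 (snd p (x, e)) = e" if "x \<in> fst (rchart k)" for x e
      using chart_in_Cset[OF complex_manifold_RM c that] by (simp_all add: k(2) prod_chart_def split_join RM_simps)
    have map_cone: "insert_one k (split1 7 (snd p y)) \<in> map_cone" if "y \<in> fst p" for y
      using that proj_point_insert_one_rchart(2)[of "fst y" k] split[of "fst y" "snd y"]
      by (auto simp: k(2) prod_chart_def)
    show "hol_fun (cm_dim ?P) (snd p ` fst p) (\<lambda>z. G p z i)" for i
      unfolding G
      by (intro hol_fun_cone_spray hol_fun_mat_act hol_fun_insert_one hol_fun_split complex_manifoldD(5)[OF P p]) (use map_cone in auto)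
    show "G p (snd p y) \<in> map_cone" if "y \<in> fst p" for y
      unfolding G by (rule cone_spray_cone[OF map_cone[OF that]])
    show "spray y = proj_point (G p (snd p y))" if "y \<in> fst p" for y
    proof -
      obtain x e where y: "y = (x, e)" "x \<in> fst (rchart k)" using \<open>y \<in> fst p\<close> by (auto simp: k(2) prod_chart_def)
      show ?thesis
        unfolding G y(1) split[OF y(2)]
        using spray_proj_point[of "insert_one k (snd (rchart k) x)" e] proj_point_insert_one_rchart(1)[OF y(2)] by simp
    qed
  qed
  then show "holomorphic_map (vb_total (trivial_bundle RM 64)) RM spray" by simp
  fix x assume "x \<in> topspace (cm_top RM)"
  then obtain v where v: "v \<in> map_cone" "x = proj_point v" by (auto simp: topspace_RM)
  have "mat_act (\<lambda>_. 0) v = (\<lambda>_. 0)" by (auto simp: mat_act_def)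
  then show "spray (vb_zero (trivial_bundle RM 64) x) = x"
    using v by (simp add: spray_proj_point cone_spray_zero cone_Cset)
qed

lemma holomorphic_curve_fibre:
  assumes M: "complex_manifold M" and x: "x \<in> topspace (cm_top M)" and e: "e \<in> Cset r"
  shows "holomorphic_curve (product_manifold M (complex_space r)) (\<lambda>t. (x, cscale t e))"
proof -
  let ?P = "product_manifold M (complex_space r)"
  have cc: "continuous_map euclidean (Ctop r) (\<lambda>t. cscale t e)"
    unfolding continuous_map_into_Ctop using e by (auto intro!: continuous_intros)
  have cont: "continuous_map euclidean (cm_top ?P) (\<lambda>t. (x, cscale t e))"
    unfolding product_manifold_simps complex_space_simps continuous_map_pairwise o_def fst_conv snd_conv
    using x cc by simp
  show ?thesis
    unfolding holomorphic_curve_def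
  proof (intro conjI allI impI ballI)
    show "(x, cscale 0 e) \<in> topspace (cm_top ?P)" using x by (simp add: product_manifold_simps)
    show "\<forall>\<^sub>F t in nhds 0. (x, cscale t e) \<in> W" if W: "openin (cm_top ?P) W \<and> (x, cscale 0 e) \<in> W" for W
    proof -
      have "openin euclidean {t \<in> topspace euclidean. (x, cscale t e) \<in> W}"
        using W by (intro openin_continuous_map_preimage[OF cont]) auto
      then have "open {t. (x, cscale t e) \<in> W}" by simp
      then show ?thesis using W eventually_nhds_in_open[of "{t. (x, cscale t e) \<in> W}" 0] by simp
    qed
    show "(\<lambda>t. snd p (x, cscale t e) i) field_differentiable at 0"
      if p: "p \<in> charts_at ?P (x, cscale 0 e)" and i: "i < cm_dim ?P" for p i
    proof -
      obtain c where "p = prod_chart (cm_dim M) c (Cset r, id)"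
        using p by (auto simp: charts_at_def atlas_product_complex_space)
      then have "(\<lambda>t. snd p (x, cscale t e) i) = (\<lambda>t. if i < cm_dim M then snd c x i else t * e (i - cm_dim M))"
        by (auto simp: prod_chart_def join_def)
      moreover have "(\<lambda>t. t * a) field_differentiable at 0" for a :: complex
        by (intro field_differentiable_mult field_differentiable_ident field_differentiable_const)
      ultimately show ?thesis by (cases "i < cm_dim M") auto
    qed
  qed
qed

text \<open>In the affine chart \<open>k\<close>, represent the point by \<open>v\<close> with \<open>v\<^sub>k = 1\<close>.  A tangent vector with coordinates \<open>u\<close>
  is the image of the vector \<open>\<rho>\<close> of \<open>\<complex>\<^sup>8\<close> obtained from \<open>u\<close> by inserting \<open>0\<close> at position \<open>k\<close>, and \<open>\<rho> = E v\<close> for the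
  matrix \<open>E\<close> with column \<open>k\<close> equal to \<open>\<rho>\<close> and all other columns zero.\<close>

theorem dominating_spray_RM: "dominating_spray RM (trivial_bundle RM 64) spray"
  unfolding dominating_spray_def
proof (intro conjI ballI)
  let ?P = "product_manifold RM (complex_space 64)" and ?E = "trivial_bundle RM 64"
  have P: "complex_manifold ?P" by (rule complex_manifold_product[OF complex_manifold_RM complex_manifold_complex_space])
  show "holomorphic_spray RM ?E spray" by (rule holomorphic_spray_RM)
  have sp: "holomorphic_map ?P RM spray" using holomorphic_spray_RM by (simp add: holomorphic_spray_def)
  fix x assume x: "x \<in> topspace (cm_top RM)"
  have fib: "fibre ?E x = {x} \<times> Cset 64" by (rule fibre_trivial_bundle[OF x])
  have curve: "holomorphic_curve ?P (\<lambda>t. (x, cscale t e))" if "e \<in> Cset 64" for e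
    by (rule holomorphic_curve_fibre[OF complex_manifold_RM x that])
  have diff: "differential ?P RM spray (x, \<lambda>_. 0) (vertical_vector ?E (x, e)) = velocity RM (\<lambda>t. spray (x, cscale t e))"
    if "e \<in> Cset 64" for e
    using differential_velocity[OF P complex_manifold_RM sp curve[OF that]] by (simp add: vertical_vector_def)
  have scurve: "holomorphic_curve RM (\<lambda>t. spray (x, cscale t e))" if "e \<in> Cset 64" for e
    by (rule holomorphic_curve_image[OF P complex_manifold_RM sp curve[OF that]])
  have s0: "spray (x, cscale 0 e) = x" for e
    using holomorphic_spray_RM x by (simp add: holomorphic_spray_def)
  have tan: "velocity RM (\<lambda>t. spray (x, cscale t e)) \<in> tangent_space RM x" if "e \<in> Cset 64" for e
    using velocity_tangent[OF complex_manifold_RM scurve[OF that]] by (simp only: s0)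
  have surj: "\<exists>e\<in>Cset 64. u = velocity RM (\<lambda>t. spray (x, cscale t e))" if u: "u \<in> tangent_space RM x" for u
  proof -
    obtain w where w: "w \<in> map_cone" "x = proj_point w" using x by (auto simp: topspace_RM)
    have "w \<in> punctured 7" using w cone_punctured by auto
    then obtain k where k: "w k \<noteq> 0" by (auto simp: punctured_def)
    have k7: "k \<le> 7" using k cone_Cset[OF w(1)] by (force simp: Cset_def not_less_eq_eq)
    define v where "v = cscale (1 / w k) w"
    have v: "v \<in> map_cone" "x = proj_point v" "v k = 1"
      using w k by (simp_all add: v_def cone_cscale proj_point_cscale)
    define c where "c = rchart k"
    have c: "c \<in> charts_at RM x"
      using k7 rchart_domain[OF v(1), of k] v by (auto simp: charts_at_def RM_simps c_def)
    \<comment> \<open>the tangent vector of the cone at \<open>v\<close> with zero component \<open>k\<close> that lies over \<open>u\<close>\<close>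
    define \<rho> where "\<rho> i = (if i < k then u c i else if i = k then 0 else u c (i - 1))" for i
    define e where "e = (\<lambda>m. if m < 64 \<and> m mod 8 = k then \<rho> (m div 8) else 0)"
    have e: "e \<in> Cset 64" by (simp add: e_def Cset_def)
    have act: "mat_act e v i = \<rho> i" if "i < 8" for i
    proof -
      have "(\<Sum>l<8. e (8 * i + l) * v l) = (\<Sum>l<8. if l = k then \<rho> i else 0)"
        using that v(3) by (intro sum.cong refl) (auto simp: e_def)
      then show ?thesis using that k7 by (simp add: mat_act_def)
    qed
    have vel: "velocity RM (\<lambda>t. spray (x, cscale t e)) c j = u c j" if j: "j < 7" for j
    proof -
      define h where "h = (\<lambda>t. cone_spray v (cscale t (mat_act e v)))"
      have spr: "spray (x, cscale t e) = proj_point (h t)" for t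
        unfolding v(2) spray_proj_point mat_act_cscale h_def ..
      have h': "((\<lambda>t. h t i) has_field_derivative \<rho> i) (at 0)" if "i < 8" for i
        unfolding h_def using cone_spray_has_derivative[OF v(1) that, of "mat_act e v"] by (simp add: act[OF that])
      have h0: "h 0 = v" by (simp add: h_def cone_spray_zero cone_Cset[OF v(1)])
      have sk: "skip k j < 8" "skip k j \<noteq> k" using j by (auto simp: skip_def)
      have D: "((\<lambda>t. h t (skip k j) / h t k) has_field_derivative \<rho> (skip k j)) (at 0)"
        using DERIV_divide[OF h'[OF sk(1)] h'[of k]] k7 v(3) by (simp add: h0 \<rho>_def)
      have ev: "\<forall>\<^sub>F t in nhds 0. h t (skip k j) / h t k = snd c (spray (x, cscale t e)) j"
      proof -
        have "isCont (\<lambda>t. h t k) 0" using h'[of k] k7 by (intro DERIV_isCont) simp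
        then have "((\<lambda>t. h t k) \<longlongrightarrow> h 0 k) (nhds 0)"
          using tendsto_at_iff_tendsto_nhds[of "\<lambda>t. h t k" 0] by (simp add: isCont_def)
        then have "\<forall>\<^sub>F t in nhds 0. h t k \<noteq> 0"
          by (rule tendsto_imp_eventually_ne) (simp add: h0 v(3))
        then show ?thesis
          by (rule eventually_mono) (simp add: spr c_def rchart_apply)
      qed
      have "((\<lambda>t. snd c (spray (x, cscale t e)) j) has_field_derivative \<rho> (skip k j)) (at 0)"
        by (rule iffD1[OF DERIV_cong_ev[OF refl ev refl] D])
      moreover have "\<rho> (skip k j) = u c j" by (auto simp: \<rho>_def skip_def)
      moreover have "c \<in> charts_at RM (spray (x, cscale 0 e))" using c by (simp only: s0)
      ultimately show ?thesis by (simp add: velocity_def DERIV_imp_deriv)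
    qed
    have "u = velocity RM (\<lambda>t. spray (x, cscale t e))"
      by (rule tangent_space_eqI[OF u tan[OF e] c]) (simp add: vel RM_simps)
    then show ?thesis using e by blast
  qed
  show "(\<lambda>e. differential (vb_total ?E) RM spray (vb_zero ?E x) (vertical_vector ?E e)) ` fibre ?E x = tangent_space RM x"
  proof (intro equalityI subsetI)
    fix u assume "u \<in> (\<lambda>e. differential (vb_total ?E) RM spray (vb_zero ?E x) (vertical_vector ?E e)) ` fibre ?E x"
    then obtain e where "e \<in> Cset 64" "u = differential ?P RM spray (x, \<lambda>_. 0) (vertical_vector ?E (x, e))"
      unfolding fib by auto
    then show "u \<in> tangent_space RM x" using diff tan by simp
  next
    fix u assume "u \<in> tangent_space RM x"
    then obtain e where e: "e \<in> Cset 64" "u = velocity RM (\<lambda>t. spray (x, cscale t e))" using surj by blast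
    then have "u = differential (vb_total ?E) RM spray (vb_zero ?E x) (vertical_vector ?E (x, e))"
      using diff[OF e(1)] by simp
    moreover have "(x, e) \<in> fibre ?E x" using e unfolding fib by simp
    ultimately show "u \<in> (\<lambda>e. differential (vb_total ?E) RM spray (vb_zero ?E x) (vertical_vector ?E e)) ` fibre ?E x"
      by blast
  qed
qed


section \<open>Approximation by entire maps into the cone\<close>

lemma compact_coord_bound:
  fixes f :: "'a::topological_space \<Rightarrow> complex"
  assumes "compact K" "continuous_on K f"
  shows "\<exists>B\<ge>0. \<forall>x\<in>K. cmod (f x) \<le> B"
proof -
  have "bounded (f ` K)" by (rule compact_imp_bounded[OF compact_continuous_image[OF assms(2,1)]])
  then obtain B where "\<forall>y\<in>f ` K. cmod y \<le> B" unfolding bounded_iff by blast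
  then show ?thesis by (intro exI[of _ "max B 0"]) (auto simp: le_max_iff_disj)
qed

text \<open>The Taylor expansion of \<open>t \<mapsto> S(v, t \<rho>)\<close> at \<open>0\<close> begins with \<open>v + t \<rho>\<close>, and by Cauchy's estimate its remainder
  is at most \<open>8 M t\<^sup>2\<close> when \<open>M\<close> bounds \<open>S\<close> on \<open>C\<close> times the unit polydisc.\<close>

lemma cone_spray_error:
  assumes C: "compact C" "C \<subseteq> map_cone"
  obtains \<delta> where "\<delta> > 0"
    "\<And>v r \<eta> j. v \<in> C \<Longrightarrow> r \<in> Cset 8 \<Longrightarrow> 0 < \<eta> \<Longrightarrow> \<eta> \<le> \<delta> \<Longrightarrow> (\<And>i. i < 8 \<Longrightarrow> cmod (r i) \<le> \<eta>) \<Longrightarrow> j < 8 \<Longrightarrow>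
       cmod (cone_spray v r j - v j - r j) \<le> \<eta> / 4"
proof -
  define Q where "Q = {\<rho> \<in> Cset 8. \<forall>j<8. cmod (\<rho> j - 0) \<le> 1}"
  have Q: "compact Q" unfolding Q_def by (rule compact_closed_polydisc[of "\<lambda>_. 0"]) simp
  define S where "S = {z \<in> Cset (8 + 8). split1 8 z \<in> map_cone \<and> split2 8 z \<in> Cset 8}"
  have S: "openin (Ctop (8 + 8)) S" unfolding S_def by (rule openin_join[OF openin_cone openin_Ctop_UNIV])
  have F: "hol_fun (8 + 8) S (\<lambda>z. cone_spray (split1 8 z) (split2 8 z) j)" for j
    by (intro hol_fun_cone_spray[OF S] hol_fun_split) (simp add: S_def)
  have jc: "continuous_on (C \<times> Q) (\<lambda>p. join 8 (fst p) (snd p))"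
  proof (rule continuous_on_coordinatewise_then_product)
    fix i show "continuous_on (C \<times> Q) (\<lambda>p. join 8 (fst p) (snd p) i)"
      by (cases "i < 8")
        (simp_all add: join_def continuous_on_product_then_coordinatewise[OF continuous_on_fst[OF continuous_on_id]]
          continuous_on_product_then_coordinatewise[OF continuous_on_snd[OF continuous_on_id]])
  qed
  have sj: "split1 8 (join 8 v \<rho>) = v" "split2 8 (join 8 v \<rho>) = \<rho>" if "v \<in> C" for v \<rho>
    using that C(2) cone_Cset by (auto simp: split_join)
  have sc: "continuous_on (C \<times> Q) (\<lambda>p. cone_spray (fst p) (snd p) j)" for j
  proof -
    have "continuous_on (C \<times> Q) (\<lambda>p. cone_spray (split1 8 (join 8 (fst p) (snd p))) (split2 8 (join 8 (fst p) (snd p))) j)"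
    proof (rule continuous_on_compose2[OF hol_fun_cont[OF F] jc])
      show "(\<lambda>p. join 8 (fst p) (snd p)) ` (C \<times> Q) \<subseteq> S"
      proof (rule image_subsetI)
        fix p assume "p \<in> C \<times> Q"
        then have p: "fst p \<in> C" "snd p \<in> Cset 8" by (auto simp: Q_def)
        then have "join 8 (fst p) (snd p) \<in> Cset (8 + 8)" using C(2) cone_Cset by (intro join_Cset) auto
        then show "join 8 (fst p) (snd p) \<in> S" using p C(2) by (auto simp: S_def sj)
      qed
    qed
    then show ?thesis by (rule continuous_on_eq) (auto simp: sj)
  qed
  have "\<exists>B\<ge>0. \<forall>p\<in>C \<times> Q. cmod (cone_spray (fst p) (snd p) j) \<le> B" for j
    by (rule compact_coord_bound[OF compact_Times[OF C(1) Q] sc])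
  from choice[OF allI[OF this]] obtain b where
    "\<forall>j. b j \<ge> 0 \<and> (\<forall>p\<in>C \<times> Q. cmod (cone_spray (fst p) (snd p) j) \<le> b j)" by (rule exE)
  then have b: "\<And>j. b j \<ge> 0" "\<And>j p. p \<in> C \<times> Q \<Longrightarrow> cmod (cone_spray (fst p) (snd p) j) \<le> b j" by blast+
  define M where "M = (\<Sum>j<8. b j)"
  have M0: "M \<ge> 0" unfolding M_def by (intro sum_nonneg b(1))
  have M: "cmod (cone_spray v \<rho> j) \<le> M" if "v \<in> C" "\<rho> \<in> Q" "j < 8" for v \<rho> j
  proof -
    have "cmod (cone_spray v \<rho> j) \<le> b j" using b(2)[of "(v, \<rho>)" j] that by simp
    also have "b j \<le> M" unfolding M_def using that b(1) by (intro member_le_sum) auto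
    finally show ?thesis .
  qed
  define \<delta> where "\<delta> = min (1/4) (1 / (32 * M + 1))"
  have \<delta>: "\<delta> > 0" "\<delta> \<le> 1/4" "\<delta> \<le> 1 / (32 * M + 1)" using M0 by (auto simp: \<delta>_def)
  show ?thesis
  proof (rule that[OF \<delta>(1)])
    fix v r \<eta> j
    assume v: "v \<in> C" and r: "r \<in> Cset 8" and \<eta>: "0 < \<eta>" "\<eta> \<le> \<delta>" and rb: "\<And>i. i < 8 \<Longrightarrow> cmod (r i) \<le> \<eta>" and j: "j < (8::nat)"
    define \<rho> where "\<rho> = cscale (complex_of_real (1 / \<eta>)) r"
    have \<rho>Q: "cscale t \<rho> \<in> Q" if "cmod t \<le> 1" for t
    proof -
      have "cmod (\<rho> i) \<le> 1" if "i < 8" for i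
        using rb[OF that] \<eta>(1) by (simp add: \<rho>_def norm_mult norm_divide field_simps)
      then have "cmod (t * \<rho> i) \<le> 1" if "i < 8" for i
        using mult_mono[OF \<open>cmod t \<le> 1\<close> \<open>i < 8 \<Longrightarrow> cmod (\<rho> i) \<le> 1\<close>] that by (simp add: norm_mult)
      then show ?thesis using r by (simp add: Q_def \<rho>_def)
    qed
    define h where "h = (\<lambda>t. cone_spray v (cscale t \<rho>) j)"
    have vc: "v \<in> map_cone" using v C by auto
    have h_hol: "h holomorphic_on UNIV"
    proof -
      have "hol_fun 1 (Cset 1) (\<lambda>z. cone_spray v (cscale (z 0) \<rho>) j)"
        by (intro hol_fun_cone_spray openin_Ctop_UNIV) (auto intro: hol_fun_intros vc)
      from hol_fun_line[OF this, of 0 "\<lambda>_. 0"]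
      have "h holomorphic_on {t. (\<lambda>_. 0)(0 := t) \<in> Cset 1}" by (simp add: h_def)
      moreover have "{t. (\<lambda>_. 0)(0 := t) \<in> Cset 1} = (UNIV :: complex set)" by (auto simp: Cset_def)
      ultimately show ?thesis by simp
    qed
    have hb: "cmod (h t) \<le> M" if "cmod t \<le> 1" for t
      unfolding h_def by (rule M[OF v \<rho>Q[OF that] j])
    have "cmod ((deriv ^^ 0) h (complex_of_real \<eta>) - (\<Sum>i\<le>1. (deriv ^^ i) h 0 * (complex_of_real \<eta> - 0) ^ i / fact i))
        \<le> (8 * M) * cmod (complex_of_real \<eta> - 0) ^ Suc 1 / fact 1"
    proof (rule complex_Taylor[where S = "ball 0 (1/2)" and f = "\<lambda>i. (deriv ^^ i) h"])
      show "((deriv ^^ i) h has_field_derivative (deriv ^^ Suc i) h x) (at x within ball 0 (1/2))" for i x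
        using holomorphic_derivI[OF holomorphic_higher_deriv[OF h_hol open_UNIV] open_UNIV UNIV_I] by simp
      show "cmod ((deriv ^^ Suc 1) h x) \<le> 8 * M" if x: "x \<in> ball 0 (1/2)" for x
      proof -
        have "norm ((deriv ^^ 2) h x) \<le> fact 2 * M / (1/2) ^ 2"
        proof (rule Cauchy_inequality)
          show "h holomorphic_on ball x (1/2)" by (rule holomorphic_on_subset[OF h_hol]) simp
          show "continuous_on (cball x (1/2)) h"
            by (rule holomorphic_on_imp_continuous_on[OF holomorphic_on_subset[OF h_hol]]) simp
          show "norm (h y) \<le> M" if "norm (x - y) = 1/2" for y
            using that x norm_triangle_ineq[of x "y - x"] by (intro hb) (simp add: norm_minus_commute)
        qed simp
        then show ?thesis by (simp add: numeral_2_eq_2 power2_eq_square)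
      qed
    qed (use \<eta> \<delta>(2) in auto)
    moreover have "h (complex_of_real \<eta>) = cone_spray v r j"
      using \<eta> by (simp add: h_def \<rho>_def cscale_cscale)
    moreover have "h 0 = v j" using cone_spray_zero[OF cone_Cset[OF vc]] by (simp add: h_def)
    moreover have "deriv h 0 * complex_of_real \<eta> = r j"
      using DERIV_imp_deriv[OF cone_spray_has_derivative[OF vc j, of \<rho>]] \<eta> by (simp add: h_def \<rho>_def)
    ultimately have "cmod (cone_spray v r j - (v j + r j)) \<le> (8 * M * \<eta>) * \<eta>"
      using \<eta> by (simp add: power2_eq_square mult.assoc)
    also have "\<dots> \<le> (1/4) * \<eta>"
    proof (rule mult_right_mono)
      have "32 * M * \<eta> \<le> 32 * M * (1 / (32 * M + 1))" using \<eta> \<delta>(3) M0 by (intro mult_left_mono) auto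
      also have "\<dots> \<le> 1" using M0 by (simp add: field_simps)
      finally show "8 * M * \<eta> \<le> 1/4" by simp
    qed (use \<eta> in simp)
    finally show "cmod (cone_spray v r j - v j - r j) \<le> \<eta> / 4" by (simp add: diff_diff_eq)
  qed
qed

lemma compact_thickening:
  assumes C: "compact C" "C \<subseteq> map_cone"
  obtains \<eta> C' where "\<eta> > 0" "compact C'" "C' \<subseteq> map_cone"
    "\<And>c v. c \<in> C \<Longrightarrow> v \<in> Cset 8 \<Longrightarrow> (\<And>j. j < 8 \<Longrightarrow> cmod (v j - c j) \<le> \<eta>) \<Longrightarrow> v \<in> C'"
proof -
  obtain V where V: "open V" "map_cone = Cset 8 \<inter> V"
    using openin_cone unfolding Ctop_def by (auto simp: openin_open)
  obtain e where e: "e > 0" "(\<Union>x\<in>C. ball x e) \<subseteq> V"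
    by (rule compact_subset_open_imp_ball_epsilon_subset[OF C(1) V(1)]) (use C(2) V(2) in blast)+
  define \<eta> where "\<eta> = e / 4"
  define Q where "Q = {\<rho> \<in> Cset 8. \<forall>j<8. cmod (\<rho> j - 0) \<le> \<eta>}"
  have Q: "compact Q" unfolding Q_def by (rule compact_closed_polydisc[of "\<lambda>_. 0"]) simp
  define C' where "C' = (\<lambda>p i. fst p i + snd p i) ` (C \<times> Q)"
  have "continuous_on (C \<times> Q) (\<lambda>p i. fst p i + snd p i)"
    by (intro continuous_on_coordinatewise_then_product continuous_on_add
      continuous_on_product_then_coordinatewise[OF continuous_on_fst[OF continuous_on_id]]
      continuous_on_product_then_coordinatewise[OF continuous_on_snd[OF continuous_on_id]])
  then have C': "compact C'" unfolding C'_def by (rule compact_continuous_image[OF _ compact_Times[OF C(1) Q]])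
  show ?thesis
  proof (rule that[of \<eta> C'])
    show "\<eta> > 0" using e by (simp add: \<eta>_def)
    show "compact C'" by (rule C')
    show "C' \<subseteq> map_cone"
    proof
      fix v assume "v \<in> C'"
      then obtain c \<rho> where c: "c \<in> C" "\<rho> \<in> Q" "v = (\<lambda>i. c i + \<rho> i)" by (auto simp: C'_def)
      have cC: "c \<in> Cset 8" using c C cone_Cset by auto
      have vC: "v \<in> Cset 8" using cC c by (auto simp: Q_def Cset_def)
      have "dist c v \<le> 2 * \<eta>"
        using c by (intro dist_le_coords[OF cC vC]) (use e in \<open>auto simp: Q_def \<eta>_def\<close>)
      then have "v \<in> ball c e" using e by (simp add: \<eta>_def)
      then show "v \<in> map_cone" using e(2) c(1) V(2) vC by blast
    qed
    fix c v assume cv: "c \<in> C" "v \<in> Cset 8" "\<And>j. j < 8 \<Longrightarrow> cmod (v j - c j) \<le> \<eta>"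
    have "c \<in> Cset 8" using cv C cone_Cset by auto
    then have "(\<lambda>i. v i - c i) \<in> Q" using cv by (auto simp: Q_def Cset_def)
    then show "v \<in> C'" unfolding C'_def using cv(1) by (intro image_eqI[of _ _ "(c, \<lambda>i. v i - c i)"]) auto
  qed
qed

lemma cscale_uniform:
  assumes K: "compact K" "K \<subseteq> Cset N" and e: "e > 0"
  obtains m :: nat where "m > 0"
    "\<And>s t z. \<bar>s - t\<bar> \<le> 1 / real m \<Longrightarrow> z \<in> K \<Longrightarrow> dist (cscale (complex_of_real s) z) (cscale (complex_of_real t) z) < e"
proof -
  have "\<exists>B\<ge>0. \<forall>z\<in>K. cmod (z j) \<le> B" for j
    by (rule compact_coord_bound[OF K(1) continuous_on_subset[OF continuous_on_product_coordinates subset_UNIV]])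
  from choice[OF allI[OF this]] obtain b where "\<forall>j. b j \<ge> 0 \<and> (\<forall>z\<in>K. cmod (z j) \<le> b j)" by (rule exE)
  then have b: "\<And>j. b j \<ge> 0" "\<And>j z. z \<in> K \<Longrightarrow> cmod (z j) \<le> b j" by blast+
  define B where "B = (\<Sum>j<N. b j)"
  have B0: "B \<ge> 0" unfolding B_def by (intro sum_nonneg b(1))
  have B: "cmod (z j) \<le> B" if "z \<in> K" "j < N" for z j
  proof -
    have "b j \<le> B" unfolding B_def using that b(1) by (intro member_le_sum) auto
    then show ?thesis using b(2)[OF that(1), of j] by simp
  qed
  obtain m :: nat where m: "2 * B / e < real m" "m > 0"
    using reals_Archimedean2[of "max (2 * B / e) 0"] by auto
  show ?thesis
  proof (rule that[OF m(2)])
    fix s t :: real and z assume st: "\<bar>s - t\<bar> \<le> 1 / real m" and z: "z \<in> K"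
    have "dist (cscale (complex_of_real s) z) (cscale (complex_of_real t) z) \<le> 2 * (1 / real m * B)"
    proof (rule dist_le_coords[where n = N])
      fix j assume j: "j < N"
      have "cmod (cscale (complex_of_real s) z j - cscale (complex_of_real t) z j) = \<bar>s - t\<bar> * cmod (z j)"
        by (simp add: left_diff_distrib[symmetric] norm_mult) (simp flip: of_real_diff)
      also have "\<dots> \<le> 1 / real m * B" using st B[OF z j] by (intro mult_mono) auto
      finally show "cmod (cscale (complex_of_real s) z j - cscale (complex_of_real t) z j) \<le> 1 / real m * B" .
    qed (use z K B0 in auto)
    also have "\<dots> < e" using m e by (simp add: field_simps)
    finally show "dist (cscale (complex_of_real s) z) (cscale (complex_of_real t) z) < e" .
  qed
qed

text \<open>Induction over a subdivision of the homotopy \<open>F(t z)\<close>, keeping the error below \<open>\<eta>\<close>.  In a step, the entire map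
  \<open>v\<close> is at distance at most \<open>\<eta>\<close> from the old value of \<open>F\<close>, the old value at distance at most \<open>\<eta>\<close> from the new
  one, and the latter at distance at most \<open>\<eta>/4\<close> from an entire map \<open>g\<close> into \<open>\<complex>\<^sup>8\<close>.  So \<open>r = g - v\<close> is bounded
  by \<open>9\<eta>/4\<close>, and \<open>S(v, r)\<close> differs from \<open>g = v + r\<close> by at most a quarter of this bound.  The new error is at
  most \<open>9\<eta>/16 + \<eta>/4 < \<eta>\<close>.\<close>

lemma approximation_in_cone:
  assumes K: "compact K" "K \<subseteq> U" and U: "openin (Ctop N) U"
    and F: "\<And>i. hol_fun N U (\<lambda>z. F z i)" and Fc: "\<And>z. z \<in> U \<Longrightarrow> F z \<in> map_cone"
    and star: "\<And>z t. z \<in> K \<Longrightarrow> 0 \<le> t \<Longrightarrow> t \<le> 1 \<Longrightarrow> cscale (complex_of_real t) z \<in> K"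
    and ne: "K \<noteq> {}" and \<epsilon>: "\<epsilon> > 0"
  shows "\<exists>G. (\<forall>i. hol_fun N (Cset N) (\<lambda>z. G z i)) \<and> (\<forall>z\<in>Cset N. G z \<in> map_cone) \<and>
     (\<forall>z\<in>K. \<forall>j<8. cmod (G z j - F z j) \<le> \<epsilon>)"
proof -
  have KC: "K \<subseteq> Cset N" using K openin_Ctop_subset[OF U] by auto
  have Fcont: "continuous_on U F"
    by (rule continuous_into_Cset[where m = 8]) (auto intro: cone_Cset Fc hol_fun_cont F)
  have "compact (F ` K)" by (rule compact_continuous_image[OF continuous_on_subset[OF Fcont K(2)] K(1)])
  moreover have "F ` K \<subseteq> map_cone" using Fc K by auto
  ultimately obtain \<eta>0 C where \<eta>0: "\<eta>0 > 0" and C: "compact C" "C \<subseteq> map_cone"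
    and near: "\<And>c v. c \<in> F ` K \<Longrightarrow> v \<in> Cset 8 \<Longrightarrow> (\<And>j. j < 8 \<Longrightarrow> cmod (v j - c j) \<le> \<eta>0) \<Longrightarrow> v \<in> C"
    using compact_thickening by metis
  obtain \<delta> where \<delta>: "\<delta> > 0"
    "\<And>v r \<eta> j. v \<in> C \<Longrightarrow> r \<in> Cset 8 \<Longrightarrow> 0 < \<eta> \<Longrightarrow> \<eta> \<le> \<delta> \<Longrightarrow> (\<And>i. i < 8 \<Longrightarrow> cmod (r i) \<le> \<eta>) \<Longrightarrow> j < 8 \<Longrightarrow>
       cmod (cone_spray v r j - v j - r j) \<le> \<eta> / 4"
    using cone_spray_error[OF C] by metis
  define \<eta> where "\<eta> = min \<epsilon> (min \<eta>0 (\<delta> / 3))"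
  have \<eta>: "\<eta> > 0" "\<eta> \<le> \<epsilon>" "\<eta> \<le> \<eta>0" "9/4 * \<eta> \<le> \<delta>" using \<epsilon> \<eta>0 \<delta>(1) by (auto simp: \<eta>_def)
  \<comment> \<open>a step size on which \<open>F\<close> varies by at most \<open>\<eta>\<close> along the rays\<close>
  have "\<exists>d>0. \<forall>w\<in>K. \<forall>w'\<in>K. dist w' w < d \<longrightarrow> dist (F w' j) (F w j) < \<eta>" for j
  proof -
    have "uniformly_continuous_on K (\<lambda>z. F z j)"
      by (rule compact_uniformly_continuous[OF continuous_on_subset[OF hol_fun_cont[OF F] K(2)] K(1)])
    then show ?thesis using \<eta>(1) unfolding uniformly_continuous_on_def by blast
  qed
  then obtain d where d: "\<And>j. d j > 0" "\<And>j w w'. w \<in> K \<Longrightarrow> w' \<in> K \<Longrightarrow> dist w' w < d j \<Longrightarrow> dist (F w' j) (F w j) < \<eta>"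
    by metis
  define d0 where "d0 = Min (d ` {..<8})"
  have d0: "d0 > 0" "\<And>j. j < 8 \<Longrightarrow> d0 \<le> d j" 
    using d(1) unfolding d0_def by (subst Min_gr_iff) (auto simp: lessThan_empty_iff)
  obtain m :: nat where m: "m > 0" "\<And>s t z. \<bar>s - t\<bar> \<le> 1 / real m \<Longrightarrow> z \<in> K \<Longrightarrow>
      dist (cscale (complex_of_real s) z) (cscale (complex_of_real t) z) < d0"
    using cscale_uniform[OF K(1) KC d0(1)] by metis
  define \<tau> where "\<tau> i = complex_of_real (real i / real m)" for i
  have \<tau>K: "cscale (\<tau> i) z \<in> K" if "i \<le> m" "z \<in> K" for i z
    unfolding \<tau>_def using that m(1) by (intro star) auto
  have Fstep: "cmod (F (cscale (\<tau> (Suc i)) z) j - F (cscale (\<tau> i) z) j) \<le> \<eta>"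
    if "Suc i \<le> m" "z \<in> K" "j < 8" for i z j
  proof -
    have "dist (cscale (\<tau> (Suc i)) z) (cscale (\<tau> i) z) < d0"
      unfolding \<tau>_def using m(1) that by (intro m(2)) (auto simp: diff_divide_distrib[symmetric])
    then have "dist (cscale (\<tau> (Suc i)) z) (cscale (\<tau> i) z) < d j" using d0(2)[OF that(3)] by simp
    then have "dist (F (cscale (\<tau> (Suc i)) z) j) (F (cscale (\<tau> i) z) j) < \<eta>"
      using that by (intro d(2) \<tau>K) auto
    then show ?thesis by (simp add: dist_norm)
  qed
  have main: "\<exists>G. (\<forall>i. hol_fun N (Cset N) (\<lambda>z. G z i)) \<and> (\<forall>z\<in>Cset N. G z \<in> map_cone) \<and>
     (\<forall>z\<in>K. \<forall>j<8. cmod (G z j - F (cscale (\<tau> i) z) j) \<le> \<eta>)" if "i \<le> m" for i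
    using that
  proof (induction i)
    case 0
    have "(\<lambda>_. 0) \<in> K" using ne star[of _ 0] by auto
    then show ?case
      using Fc[of "\<lambda>_. 0"] K \<eta>(1) by (intro exI[of _ "\<lambda>_. F (\<lambda>_. 0)"]) (auto simp: \<tau>_def)
  next
    case (Suc i)
    obtain v where "(\<forall>i. hol_fun N (Cset N) (\<lambda>z. v z i)) \<and> (\<forall>z\<in>Cset N. v z \<in> map_cone) \<and>
      (\<forall>z\<in>K. \<forall>j<8. cmod (v z j - F (cscale (\<tau> i) z) j) \<le> \<eta>)"
      using Suc.IH[OF Suc_leD[OF Suc.prems]] by (elim exE) (rule that)
    then have v: "\<And>i. hol_fun N (Cset N) (\<lambda>z. v z i)" "\<And>z. z \<in> Cset N \<Longrightarrow> v z \<in> map_cone"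
      and vF: "\<And>z j. z \<in> K \<Longrightarrow> j < 8 \<Longrightarrow> cmod (v z j - F (cscale (\<tau> i) z) j) \<le> \<eta>" by blast+
    define U' where "U' = {z \<in> Cset N. cscale (\<tau> (Suc i)) z \<in> U}"
    have U': "openin (Ctop N) U'" unfolding U'_def
      by (rule openin_Ctop_preimage[OF openin_Ctop_UNIV U hol_fun_cont[where n = 0]]) (auto intro: hol_fun_intros)
    have KU': "K \<subseteq> U'" using \<tau>K[OF Suc.prems] K KC by (auto simp: U'_def)
    have "\<exists>g. hol_fun N (Cset N) g \<and> (\<forall>z\<in>K. cmod (g z - F (cscale (\<tau> (Suc i)) z) j) < \<eta> / 4)" for j
      by (rule Runge_starlike[OF K(1) KU' U' hol_fun_cscale[OF U F U'] star])
        (use \<eta>(1) in \<open>auto simp: U'_def\<close>)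
    then obtain g where g: "\<And>j. hol_fun N (Cset N) (g j)"
      "\<And>j z. z \<in> K \<Longrightarrow> cmod (g j z - F (cscale (\<tau> (Suc i)) z) j) < \<eta> / 4" by metis
    define r where "r = (\<lambda>z j. if j < 8 then g j z - v z j else 0)"
    have rhol: "hol_fun N (Cset N) (\<lambda>z. r z j)" for j
      by (cases "j < 8") (simp_all add: r_def hol_fun_diff g v)
    show ?case
    proof (intro exI[of _ "\<lambda>z. cone_spray (v z) (r z)"] conjI allI ballI impI)
      show "hol_fun N (Cset N) (\<lambda>z. cone_spray (v z) (r z) j)" for j
        by (rule hol_fun_cone_spray[OF openin_Ctop_UNIV v(1) rhol v(2)])
      show "cone_spray (v z) (r z) \<in> map_cone" if "z \<in> Cset N" for z by (rule cone_spray_cone[OF v(2)[OF that]])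
      fix z j assume z: "z \<in> K" and j: "j < (8::nat)"
      have vC: "v z \<in> C"
      proof (rule near)
        show "F (cscale (\<tau> i) z) \<in> F ` K" using \<tau>K[of i z] Suc.prems z by auto
        show "v z \<in> Cset 8" using v(2) KC z cone_Cset by blast
        show "cmod (v z j - F (cscale (\<tau> i) z) j) \<le> \<eta>0" if "j < 8" for j
          using vF[OF z that] \<eta>(3) by simp
      qed
      have rb: "cmod (r z l) \<le> 9/4 * \<eta>" if l: "l < 8" for l
      proof -
        let ?a = "g l z" and ?b = "F (cscale (\<tau> (Suc i)) z) l" and ?c = "F (cscale (\<tau> i) z) l"
        have "r z l = (?a - ?b) + (?b - ?c) - (v z l - ?c)" using l by (simp add: r_def)
        then have "cmod (r z l) \<le> cmod (?a - ?b) + cmod (?b - ?c) + cmod (v z l - ?c)"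
          by (metis add_mono_thms_linordered_semiring(3) norm_triangle_ineq norm_triangle_ineq4 order_trans)
        then show ?thesis using g(2)[OF z, of l] Fstep[OF Suc.prems z l] vF[OF z l] by linarith
      qed
      have "cmod (cone_spray (v z) (r z) j - v z j - r z j) \<le> (9/4 * \<eta>) / 4"
        by (rule \<delta>(2)[OF vC _ _ \<eta>(4) rb j]) (use \<eta>(1) in \<open>auto simp: Cset_def r_def\<close>)
      moreover have "cone_spray (v z) (r z) j - v z j - r z j = cone_spray (v z) (r z) j - g j z" using j by (simp add: r_def)
      ultimately have "cmod (cone_spray (v z) (r z) j - g j z) \<le> 9/16 * \<eta>" by simp
      then show "cmod (cone_spray (v z) (r z) j - F (cscale (\<tau> (Suc i)) z) j) \<le> \<eta>"
        using g(2)[OF z, of j] \<eta>(1)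
          norm_triangle_ineq[of "cone_spray (v z) (r z) j - g j z" "g j z - F (cscale (\<tau> (Suc i)) z) j"] by simp
    qed
  qed
  have one: "cscale (\<tau> m) z = z" for z using m(1) by (simp add: \<tau>_def)
  obtain G where G: "(\<forall>i. hol_fun N (Cset N) (\<lambda>z. G z i)) \<and> (\<forall>z\<in>Cset N. G z \<in> map_cone) \<and>
     (\<forall>z\<in>K. \<forall>j<8. cmod (G z j - F (cscale (\<tau> m) z) j) \<le> \<eta>)"
    using main[OF le_refl] by (elim exE) (rule that)
  show ?thesis
  proof (intro exI[of _ G] conjI)
    show "\<forall>z\<in>K. \<forall>j<8. cmod (G z j - F z j) \<le> \<epsilon>"
      using G \<eta>(2) unfolding one by (meson order_trans)
  qed (use G in blast)+
qed

section \<open>Lifting to the cone\<close>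

definition locally_lifts :: "nat \<Rightarrow> (nat \<Rightarrow> complex) set \<Rightarrow> ((nat \<Rightarrow> complex) \<Rightarrow> (nat \<Rightarrow> complex) set) \<Rightarrow> bool" where
  "locally_lifts N U f \<longleftrightarrow> (\<forall>z\<in>U. \<exists>T g. openin (Ctop N) T \<and> z \<in> T \<and> T \<subseteq> U \<and>
     (\<forall>i. hol_fun N T (\<lambda>w. g w i)) \<and> (\<forall>w\<in>T. g w \<in> map_cone \<and> f w = proj_point (g w)))"

lemma locally_liftsE:
  assumes "locally_lifts N U f" "z \<in> U"
  obtains T g where "openin (Ctop N) T" "z \<in> T" "T \<subseteq> U" "\<And>i. hol_fun N T (\<lambda>w. g w i)"
    "\<And>w. w \<in> T \<Longrightarrow> g w \<in> map_cone" "\<And>w. w \<in> T \<Longrightarrow> f w = proj_point (g w)"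
  using assms unfolding locally_lifts_def by metis

lemma locally_lifts_compose:
  assumes f: "locally_lifts N U f" and V: "openin (Ctop n) V"
    and H: "\<And>i. hol_fun n V (\<lambda>z. H z i)" and HU: "\<And>z. z \<in> V \<Longrightarrow> H z \<in> U" and U: "U \<subseteq> Cset N"
  shows "locally_lifts n V (\<lambda>z. f (H z))"
  unfolding locally_lifts_def
proof
  fix z assume z: "z \<in> V"
  obtain T g where T: "openin (Ctop N) T" "H z \<in> T" "T \<subseteq> U" and g: "\<And>i. hol_fun N T (\<lambda>w. g w i)"
    "\<And>w. w \<in> T \<Longrightarrow> g w \<in> map_cone" "\<And>w. w \<in> T \<Longrightarrow> f w = proj_point (g w)"
    using locally_liftsE[OF f HU[OF z]] by metis
  let ?T = "{w \<in> V. H w \<in> T}"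
  have o: "openin (Ctop n) ?T"
    by (rule openin_Ctop_preimage[OF V T(1) hol_fun_cont[OF H]]) (use HU U in auto)
  show "\<exists>T g. openin (Ctop n) T \<and> z \<in> T \<and> T \<subseteq> V \<and>
     (\<forall>i. hol_fun n T (\<lambda>w. g w i)) \<and> (\<forall>w\<in>T. g w \<in> map_cone \<and> f (H w) = proj_point (g w))"
  proof (intro exI[of _ ?T] exI[of _ "\<lambda>w. g (H w)"] conjI allI ballI)
    show "hol_fun n ?T (\<lambda>w. g (H w) i)" for i
      by (rule hol_fun_compose[OF o T(1) g(1) hol_fun_subset[OF H]]) auto
  qed (use o z T g in auto)
qed

text \<open>Rescale any representative \<open>u\<close> of \<open>f(z)\<close> so that the normalizing functional of \<open>F(z)\<close> takes the value \<open>1\<close> at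
  it; the result does not depend on \<open>u\<close>.\<close>

lemma lift_step:
  assumes V: "openin (Ctop N) V" and F: "\<And>i. hol_fun N V (\<lambda>z. F z i)" and Fc: "\<And>z. z \<in> V \<Longrightarrow> F z \<in> map_cone"
    and f: "locally_lifts N V f"
    and W: "W = {z \<in> V. \<exists>u. f z = proj_point u \<and> normalizer (F z) u \<noteq> 0}"
  shows "openin (Ctop N) W"
    "\<exists>G. (\<forall>i. hol_fun N W (\<lambda>z. G z i)) \<and> (\<forall>z\<in>W. G z \<in> map_cone \<and> f z = proj_point (G z))"
proof -
  define G where "G = (\<lambda>z. let u = SOME u. f z = proj_point u in cscale (1 / normalizer (F z) u) u)"
  have G: "normalizer (F z) u \<noteq> 0 \<and> G z = cscale (1 / normalizer (F z) u) u"
    if z: "z \<in> W" and u: "f z = proj_point u" for z u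
  proof -
    obtain u0 where u0: "f z = proj_point u0" "normalizer (F z) u0 \<noteq> 0" using z W by auto
    have all: "\<exists>a. a \<noteq> 0 \<and> u' = cscale a u0" if "f z = proj_point u'" for u'
      using proj_point_eqD[of u0 u'] u0 that by simp
    define u1 where "u1 = (SOME u. f z = proj_point u)"
    have u1: "f z = proj_point u1" unfolding u1_def by (rule someI[of _ u]) (rule u)
    obtain a b where "a \<noteq> 0" "u = cscale a u0" "b \<noteq> 0" "u1 = cscale b u0" using all[OF u] all[OF u1] by blast
    then show ?thesis
      using u0(2) by (simp add: G_def Let_def u1_def[symmetric] normalizer_scale cscale_cscale)
  qed
  have loc: "\<exists>T. openin (Ctop N) T \<and> z \<in> T \<and> T \<subseteq> W \<and> (\<forall>i. hol_fun N T (\<lambda>z. G z i)) \<and> (\<forall>w\<in>T. G w \<in> map_cone \<and> f w = proj_point (G w))"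
    if z: "z \<in> W" for z
  proof -
    have zV: "z \<in> V" using z W by simp
    obtain T g where T: "openin (Ctop N) T" "z \<in> T" "T \<subseteq> V" and g: "\<And>i. hol_fun N T (\<lambda>w. g w i)"
      "\<And>w. w \<in> T \<Longrightarrow> g w \<in> map_cone" "\<And>w. w \<in> T \<Longrightarrow> f w = proj_point (g w)"
      using locally_liftsE[OF f zV] by metis
    have nf: "hol_fun N T (\<lambda>w. normalizer (F w) (g w))"
      by (rule hol_fun_normalizer[OF hol_fun_subset[OF F T(3)] g(1)]) (use Fc T(3) in auto)
    define T1 where "T1 = {w \<in> T. normalizer (F w) (g w) \<in> - {0}}"
    have T1: "openin (Ctop N) T1" unfolding T1_def
      by (rule openin_Ctop_continuous_preimage[OF T(1) hol_fun_cont[OF nf]]) (simp add: open_Compl)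
    have T1W: "T1 \<subseteq> W" using T(3) g(3) by (auto simp: T1_def W)
    have zT1: "z \<in> T1" using G[OF z g(3)[OF T(2)]] T(2) by (simp add: T1_def)
    have GT: "G w = cscale (1 / normalizer (F w) (g w)) (g w)" "normalizer (F w) (g w) \<noteq> 0" if "w \<in> T1" for w
      using G[of w "g w"] T1W g(3) that by (auto simp: T1_def)
    show ?thesis
    proof (intro exI[of _ T1] conjI allI ballI)
      fix i
      have "hol_fun N T1 (\<lambda>w. 1 / normalizer (F w) (g w) * g w i)"
        by (intro hol_fun_mult hol_fun_divide hol_fun_const hol_fun_subset[OF nf] hol_fun_subset[OF g(1)])
          (auto simp: T1_def)
      then show "hol_fun N T1 (\<lambda>w. G w i)" by (rule hol_fun_cong[OF _ T1]) (simp add: GT)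
    next
      fix w assume w: "w \<in> T1"
      then show "G w \<in> map_cone" "f w = proj_point (G w)"
        using GT[OF w] g(2,3)[of w] by (auto simp: T1_def cone_cscale proj_point_cscale)
    qed (use T1 T1W zT1 in auto)
  qed
  have loc': "\<exists>T. openin (Ctop N) T \<and> z \<in> T \<and> T \<subseteq> W \<and> hol_fun N T (\<lambda>z. G z i)"
    "G z \<in> map_cone \<and> f z = proj_point (G z)" if z: "z \<in> W" for z i
  proof -
    from loc[OF z] obtain T where T: "openin (Ctop N) T \<and> z \<in> T \<and> T \<subseteq> W \<and>
      (\<forall>i. hol_fun N T (\<lambda>z. G z i)) \<and> (\<forall>w\<in>T. G w \<in> map_cone \<and> f w = proj_point (G w))" by (rule exE)
    show "\<exists>T. openin (Ctop N) T \<and> z \<in> T \<and> T \<subseteq> W \<and> hol_fun N T (\<lambda>z. G z i)"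
      by (rule exI[of _ T]) (use T in simp)
    show "G z \<in> map_cone \<and> f z = proj_point (G z)" using T by blast
  qed
  show o: "openin (Ctop N) W"
    by (rule iffD2[OF openin_subopen]) (use loc'(1) in blast)
  show "\<exists>G. (\<forall>i. hol_fun N W (\<lambda>z. G z i)) \<and> (\<forall>z\<in>W. G z \<in> map_cone \<and> f z = proj_point (G z))"
  proof (intro exI[of _ G] conjI allI ballI)
    show "hol_fun N W (\<lambda>z. G z i)" for i by (rule hol_fun_local[OF o loc'(1)])
    show "G z \<in> map_cone" "f z = proj_point (G z)" if "z \<in> W" for z using loc'(2)[OF that] by simp_all
  qed
qed

text \<open>On the diagonal the functional is \<open>1\<close>, so it does not vanish near the diagonal; a Lebesgue number makes this
  uniform on \<open>K\<close>.  The condition is invariant under scaling of \<open>v\<close> and \<open>u\<close>.\<close>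

lemma normalizer_near:
  assumes f: "locally_lifts N U f" and K: "compact K" "K \<subseteq> U" and U: "U \<subseteq> Cset N"
  obtains e where "e > 0"
    "\<And>w w' v u. w \<in> K \<Longrightarrow> w' \<in> K \<Longrightarrow> dist w w' < e \<Longrightarrow> f w = proj_point v \<Longrightarrow> f w' = proj_point u \<Longrightarrow>
       normalizer v u \<noteq> 0"
proof -
  define good where "good V \<longleftrightarrow> open V \<and> (\<forall>w\<in>Cset N \<inter> V. \<forall>w'\<in>Cset N \<inter> V. \<forall>v u.
     f w = proj_point v \<longrightarrow> f w' = proj_point u \<longrightarrow> normalizer v u \<noteq> 0)" for V
  have ex: "\<exists>V. good V \<and> z \<in> V" if z: "z \<in> K" for z
  proof -
    obtain T g where T: "openin (Ctop N) T" "z \<in> T" and g: "\<And>i. hol_fun N T (\<lambda>w. g w i)"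
      "\<And>w. w \<in> T \<Longrightarrow> g w \<in> map_cone" "\<And>w. w \<in> T \<Longrightarrow> f w = proj_point (g w)"
      using locally_liftsE[OF f, of z] z K(2) by (metis subsetD)
    have zC: "z \<in> Cset N" using T openin_Ctop_subset by blast
    define S where "S = {y \<in> Cset (N + N). split1 N y \<in> T \<and> split2 N y \<in> T}"
    have S: "openin (Ctop (N + N)) S" unfolding S_def by (rule openin_join[OF T(1) T(1)])
    have h: "hol_fun (N + N) S (\<lambda>y. normalizer (g (split1 N y)) (g (split2 N y)))"
    proof (rule hol_fun_normalizer)
      show "hol_fun (N + N) S (\<lambda>y. g (split1 N y) i)" "hol_fun (N + N) S (\<lambda>y. g (split2 N y) i)" for i
        by (rule hol_fun_compose[OF S T(1) g(1) hol_fun_split(1)], simp add: S_def)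
          (rule hol_fun_compose[OF S T(1) g(1) hol_fun_split(2)], simp add: S_def)
    qed (use g(2) in \<open>auto simp: S_def\<close>)
    define S1 where "S1 = {y \<in> S. normalizer (g (split1 N y)) (g (split2 N y)) \<in> - {0}}"
    have S1: "openin (Ctop (N + N)) S1" unfolding S1_def
      by (rule openin_Ctop_continuous_preimage[OF S hol_fun_cont[OF h]]) (simp add: open_Compl)
    have "join N z z \<in> S1"
      using zC T(2) g(2)[OF T(2)] by (simp add: S1_def S_def join_Cset split_join normalizer_self)
    then obtain \<delta> where \<delta>: "\<delta> > 0"
      "\<And>y. y \<in> Cset (N + N) \<Longrightarrow> (\<And>j. j < N + N \<Longrightarrow> cmod (y j - join N z z j) < \<delta>) \<Longrightarrow> y \<in> S1"
      using openin_Ctop_nbhd[OF S1] by metis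
    have "openin (Ctop N) {w \<in> Cset N. \<forall>j<N. cmod (w j - z j) < \<delta>}" by (rule openin_polydisc[OF zC])
    then obtain V where V: "open V" "{w \<in> Cset N. \<forall>j<N. cmod (w j - z j) < \<delta>} = Cset N \<inter> V"
      unfolding Ctop_def by (auto simp: openin_open)
    have "normalizer v u \<noteq> 0"
      if w: "w \<in> Cset N \<inter> V" "w' \<in> Cset N \<inter> V" and vu: "f w = proj_point v" "f w' = proj_point u" for w w' v u
    proof -
      have wC: "w \<in> Cset N" "w' \<in> Cset N" using w by auto
      have "\<forall>j<N. cmod (w j - z j) < \<delta>" "\<forall>j<N. cmod (w' j - z j) < \<delta>" using w V(2) by blast+
      then have "join N w w' \<in> S1"
        using wC by (intro \<delta>(2) join_Cset) (auto simp: join_def)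
      then have n: "normalizer (g w) (g w') \<noteq> 0" and wT: "w \<in> T" "w' \<in> T"
        using wC by (auto simp: S1_def S_def split_join)
      obtain a where a: "a \<noteq> 0" "v = cscale a (g w)" using proj_point_eqD[of "g w" v] g(3)[OF wT(1)] vu(1) by auto
      obtain b where b: "b \<noteq> 0" "u = cscale b (g w')" using proj_point_eqD[of "g w'" u] g(3)[OF wT(2)] vu(2) by auto
      show ?thesis using n a b by (simp add: normalizer_scale normalizer_scale_left)
    qed
    then have "good V" using V(1) unfolding good_def by blast
    moreover have "z \<in> V" using V(2) zC \<delta>(1) by auto
    ultimately show ?thesis by blast
  qed
  have "K \<subseteq> \<Union> (Collect good)" using ex by blast
  moreover have "open V" if "V \<in> Collect good" for V using that by (simp add: good_def)
  ultimately obtain e where e: "e > 0" "\<And>x. x \<in> K \<Longrightarrow> \<exists>V\<in>Collect good. ball x e \<subseteq> V"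
    using Heine_Borel_lemma[OF K(1)] by metis
  show ?thesis
  proof (rule that[OF e(1)])
    fix w w' v u assume w: "w \<in> K" "w' \<in> K" "dist w w' < e" and vu: "f w = proj_point v" "f w' = proj_point u"
    obtain V where V: "good V" "ball w e \<subseteq> V" using e(2)[OF w(1)] by auto
    then have "w \<in> Cset N \<inter> V" "w' \<in> Cset N \<inter> V" using w e(1) K(2) U by auto
    then show "normalizer v u \<noteq> 0" using V(1) vu unfolding good_def by blast
  qed
qed

text \<open>Lift \<open>z \<mapsto> f(t z)\<close> successively for \<open>t = 0, 1/m, \<dots>, 1\<close>, beginning with a constant lift.  For large \<open>m\<close>
  consecutive maps are so close that \<open>lift_step\<close> applies on a neighbourhood of \<open>K\<close>, which may shrink in
  each of the finitely many steps.\<close>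

theorem global_lift:
  assumes f: "locally_lifts N U f" and K: "compact K" "K \<subseteq> U" and U: "openin (Ctop N) U"
    and star: "\<And>z t. z \<in> K \<Longrightarrow> 0 \<le> t \<Longrightarrow> t \<le> 1 \<Longrightarrow> cscale (complex_of_real t) z \<in> K"
    and ne: "K \<noteq> {}"
  shows "\<exists>V F. openin (Ctop N) V \<and> K \<subseteq> V \<and> (\<forall>i. hol_fun N V (\<lambda>z. F z i)) \<and>
     (\<forall>z\<in>V. F z \<in> map_cone \<and> f z = proj_point (F z))"
proof -
  have UC: "U \<subseteq> Cset N" by (rule openin_Ctop_subset[OF U])
  have KC: "K \<subseteq> Cset N" using K UC by auto
  obtain e where e: "e > 0"
    "\<And>w w' v u. w \<in> K \<Longrightarrow> w' \<in> K \<Longrightarrow> dist w w' < e \<Longrightarrow> f w = proj_point v \<Longrightarrow> f w' = proj_point u \<Longrightarrow>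
       normalizer v u \<noteq> 0"
    using normalizer_near[OF f K UC] by metis
  obtain m :: nat where m: "m > 0" "\<And>s t z. \<bar>s - t\<bar> \<le> 1 / real m \<Longrightarrow> z \<in> K \<Longrightarrow>
      dist (cscale (complex_of_real s) z) (cscale (complex_of_real t) z) < e"
    using cscale_uniform[OF K(1) KC e(1)] by metis
  define \<tau> where "\<tau> i = complex_of_real (real i / real m)" for i
  have \<tau>K: "cscale (\<tau> i) z \<in> K" if "i \<le> m" "z \<in> K" for i z
    unfolding \<tau>_def using that m(1) by (intro star) auto
  have "\<exists>V F. openin (Ctop N) V \<and> K \<subseteq> V \<and> (\<forall>i. hol_fun N V (\<lambda>z. F z i)) \<and>
     (\<forall>z\<in>V. F z \<in> map_cone \<and> f (cscale (\<tau> i) z) = proj_point (F z))" if "i \<le> m" for i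
    using that
  proof (induction i)
    case 0
    have "(\<lambda>_. 0) \<in> U" using ne star[of _ 0] K by auto
    then obtain g where "g (\<lambda>_. 0) \<in> map_cone" "f (\<lambda>_. 0) = proj_point (g (\<lambda>_. 0))"
      using locally_liftsE[OF f] by metis
    then show ?case
      using KC by (intro exI[of _ "Cset N"] exI[of _ "\<lambda>_. g (\<lambda>_. 0)"]) (auto simp: \<tau>_def)
  next
    case (Suc i)
    obtain V F where VF: "openin (Ctop N) V \<and> K \<subseteq> V \<and> (\<forall>i. hol_fun N V (\<lambda>z. F z i)) \<and>
      (\<forall>z\<in>V. F z \<in> map_cone \<and> f (cscale (\<tau> i) z) = proj_point (F z))"
      using Suc.IH[OF Suc_leD[OF Suc.prems]] by (elim exE) (rule that)
    then have V: "openin (Ctop N) V" "K \<subseteq> V" and F: "\<And>i. hol_fun N V (\<lambda>z. F z i)"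
      "\<And>z. z \<in> V \<Longrightarrow> F z \<in> map_cone" "\<And>z. z \<in> V \<Longrightarrow> f (cscale (\<tau> i) z) = proj_point (F z)" by blast+
    let ?H = "cscale (\<tau> (Suc i))"
    have Hhol: "hol_fun N S (\<lambda>z. ?H z j)" for S j by (simp add: hol_fun_mult)
    define V' where "V' = {z \<in> V. ?H z \<in> U}"
    have V': "openin (Ctop N) V'" unfolding V'_def
      by (rule openin_Ctop_preimage[OF V(1) U hol_fun_cont[OF Hhol[where S = V]]])
        (rule cscale_Cset, use openin_Ctop_subset[OF V(1)] in blast)
    have V'V: "V' \<subseteq> V" by (auto simp: V'_def)
    have lf: "locally_lifts N V' (\<lambda>z. f (?H z))"
      by (rule locally_lifts_compose[where H = ?H, OF f V' Hhol _ UC]) (simp add: V'_def)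
    define W where "W = {z \<in> V'. \<exists>u. f (?H z) = proj_point u \<and> normalizer (F z) u \<noteq> 0}"
    have Fc: "F z \<in> map_cone" if "z \<in> V'" for z using F(2) V'V that by blast
    note step = lift_step[OF V' hol_fun_subset[OF F(1) V'V] Fc lf W_def]
    have "K \<subseteq> W"
    proof
      fix z assume z: "z \<in> K"
      have zi: "cscale (\<tau> i) z \<in> K" "?H z \<in> K" using \<tau>K z Suc.prems by auto
      then have zV': "z \<in> V'" using V(2) z K(2) by (auto simp: V'_def)
      obtain g where u: "f (?H z) = proj_point (g (?H z))"
        using locally_liftsE[OF f] zi(2) K(2) by (metis subsetD)
      have "dist (cscale (\<tau> i) z) (?H z) < e"
        unfolding \<tau>_def using m(1) z by (intro m(2)) (auto simp: diff_divide_distrib[symmetric])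
      then have "normalizer (F z) (g (?H z)) \<noteq> 0"
        using e(2)[OF zi _ _ u] F(3) V(2) z by blast
      then show "z \<in> W" using zV' u by (auto simp: W_def)
    qed
    then show ?case using step by blast
  qed
  from this[of m] show ?thesis using m(1) by (simp add: \<tau>_def)
qed

section \<open>The Oka property\<close>

lemma holomorphic_map_locally_lifts:
  assumes U: "openin (Ctop N) U" and f: "holomorphic_map (open_submanifold (complex_space N) U) RM f"
  shows "locally_lifts N U f"
proof -
  let ?M = "open_submanifold (complex_space N) U"
  have M: "complex_manifold ?M"
    by (rule complex_manifold_open_submanifold[OF complex_manifold_complex_space]) (simp add: U)
  have UC: "U \<subseteq> Cset N" by (rule openin_Ctop_subset[OF U])
  have simps: "cm_top ?M = subtopology (Ctop N) U" "cm_dim ?M = N" "cm_atlas ?M = {(Cset N \<inter> U, id)}"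
    by (simp_all add: open_submanifold_def)
  have CU: "Cset N \<inter> U = U" using UC by auto
  show ?thesis
    unfolding locally_lifts_def
  proof
    fix z assume z: "z \<in> U"
    have "f z \<in> topspace (cm_top RM)"
      using f z UC unfolding holomorphic_map_def continuous_map_def simps by auto
    then obtain c where "c \<in> charts_at RM (f z)" using charts_at_nonempty[OF complex_manifold_RM] by blast
    then obtain k where k: "k \<le> 7" "f z \<in> fst (rchart k)" and c: "rchart k \<in> cm_atlas RM"
      by (auto simp: charts_at_def RM_simps)
    let ?T = "{x \<in> U. f x \<in> fst (rchart k)}"
    have cM: "(U, id) \<in> cm_atlas ?M" using CU by (simp add: simps)
    note D = holomorphic_mapD[OF M complex_manifold_RM f cM c, unfolded simps fst_conv snd_conv image_id]
    have T: "openin (Ctop N) ?T" using D(3) by simp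
    have h: "hol_fun N ?T (\<lambda>w. snd (rchart k) (f w) j)" for j
    proof (cases "j < 7")
      case True
      have "hol_fun N ?T (\<lambda>w. in_chart (U, id) (snd (rchart k) \<circ> f) w j)"
        using D(4)[of j] True by (simp add: RM_simps)
      then show ?thesis by (rule hol_fun_cong[OF _ T]) (simp add: in_chart_def)
    next
      case False
      have "hol_fun N ?T (\<lambda>w. 0)" by simp
      then show ?thesis
        by (rule hol_fun_cong[OF _ T])
          (use chart_in_Cset[OF complex_manifold_RM c] False in \<open>auto simp: RM_simps Cset_def\<close>)
    qed
    show "\<exists>T g. openin (Ctop N) T \<and> z \<in> T \<and> T \<subseteq> U \<and>
       (\<forall>i. hol_fun N T (\<lambda>w. g w i)) \<and> (\<forall>w\<in>T. g w \<in> map_cone \<and> f w = proj_point (g w))"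
    proof (intro exI[of _ ?T] exI[of _ "\<lambda>w. insert_one k (snd (rchart k) (f w))"] conjI allI ballI)
      show "hol_fun N ?T (\<lambda>w. insert_one k (snd (rchart k) (f w)) i)" for i
        by (rule hol_fun_insert_one[OF h])
    qed (use T z k proj_point_insert_one_rchart[of _ k] in auto)
  qed
qed

lemma cone_nonempty: "\<exists>v. v \<in> map_cone"
proof -
  \<comment> \<open>the pair \<open>(x\<^sup>3, y\<^sup>3)\<close>\<close>
  define v where "v = (\<lambda>i::nat. if i = 3 \<or> i = 4 then 1 else 0 :: complex)"
  have "resultant v \<noteq> 0"
    by (simp add: resultant_def bez_det_def Let_def bezout_entries bezout_entries' numerator_def denominator_def v_def)
  moreover have "v \<in> Cset 8" by (simp add: Cset_def v_def)
  ultimately show ?thesis unfolding map_cone_def by blast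
qed

text \<open>A Lebesgue number for a cover of \<open>C\<close> by sets on which the projection to the quotient oscillates little.\<close>

lemma mdist_proj_point_uniform:
  assumes D: "mtopology_of D = cm_top RM" and C: "compact C" "C \<subseteq> map_cone" and \<epsilon>: "\<epsilon> > 0"
  obtains \<eta> where "\<eta> > 0"
    "\<And>u v. u \<in> C \<Longrightarrow> v \<in> map_cone \<Longrightarrow> (\<And>j. j < 8 \<Longrightarrow> cmod (v j - u j) \<le> \<eta>) \<Longrightarrow>
       mdist D (proj_point u) (proj_point v) < \<epsilon>"
proof -
  have ms: "mspace D = proj_point ` map_cone"
    using arg_cong[OF D, of topspace] by (simp add: topspace_RM)
  have cont: "continuous_map (top_of_set map_cone) (cm_top RM) proj_point"
  proof -
    have s: "subtopology (Ctop 8) map_cone = top_of_set map_cone"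
      using openin_Ctop_subset[OF openin_cone] by (simp add: Ctop_def subtopology_subtopology inf.absorb2)
    have "continuous_map (subtopology (Ctop 8) map_cone) (proj_top 7) (\<lambda>v. proj_point v)"
      using continuous_map_proj_point[of "subtopology (Ctop 8) map_cone" 7 "\<lambda>v. v"] cone_punctured
      by (auto simp: continuous_map_from_subtopology)
    then show ?thesis unfolding s RM_simps continuous_map_in_subtopology by auto
  qed
  define good where "good V \<longleftrightarrow> open V \<and> (\<exists>L. L \<in> mspace D \<and> (\<forall>v\<in>map_cone \<inter> V. mdist D L (proj_point v) < \<epsilon> / 2))" for V
  have ex: "\<exists>V. good V \<and> u \<in> V" if u: "u \<in> C" for u
  proof -
    let ?L = "proj_point u"
    have L: "?L \<in> mspace D" using u C ms by auto
    have "openin (cm_top RM) (mball_of D ?L (\<epsilon> / 2))"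
      unfolding D[symmetric] by (simp add: Metric_space.openin_mball mball_of_def mtopology_of_def)
    from openin_continuous_map_preimage[OF cont this]
    have "openin (top_of_set map_cone) {v \<in> map_cone. proj_point v \<in> mball_of D ?L (\<epsilon> / 2)}" by simp
    then obtain V where V: "open V" "{v \<in> map_cone. proj_point v \<in> mball_of D ?L (\<epsilon> / 2)} = map_cone \<inter> V"
      by (auto simp: openin_open)
    have "\<forall>v\<in>map_cone \<inter> V. mdist D ?L (proj_point v) < \<epsilon> / 2"
      unfolding V(2)[symmetric] by simp
    then have "good V" using V(1) L unfolding good_def by blast
    moreover have "u \<in> map_cone \<inter> V"
    proof -
      have "mdist D ?L ?L = 0" using L by simp
      then have "mdist D ?L ?L < \<epsilon> / 2" using \<epsilon> by linarith
      then show ?thesis unfolding V(2)[symmetric] using u C(2) L \<epsilon> by auto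
    qed
    ultimately show ?thesis by blast
  qed
  have "C \<subseteq> \<Union> (Collect good)" using ex by blast
  moreover have "open V" if "V \<in> Collect good" for V using that by (simp add: good_def)
  ultimately obtain e where e: "e > 0" "\<And>x. x \<in> C \<Longrightarrow> \<exists>V\<in>Collect good. ball x e \<subseteq> V"
    using Heine_Borel_lemma[OF C(1)] by metis
  show ?thesis
  proof (rule that[of "e / 4"])
    fix u v assume u: "u \<in> C" and v: "v \<in> map_cone" and uv: "\<And>j. j < 8 \<Longrightarrow> cmod (v j - u j) \<le> e / 4"
    obtain V where V: "good V" "ball u e \<subseteq> V" using e(2)[OF u] by auto
    have uc: "u \<in> map_cone" using u C by auto
    have "dist v u \<le> 2 * (e / 4)"
      using e(1) by (intro dist_le_coords[OF cone_Cset[OF v] cone_Cset[OF uc] uv]) auto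
    then have "v \<in> V" "u \<in> V" using V(2) e(1) by (auto simp: dist_commute)
    then obtain L where "L \<in> mspace D" "mdist D L (proj_point v) < \<epsilon> / 2" "mdist D L (proj_point u) < \<epsilon> / 2"
      using V(1) v uc unfolding good_def by blast
    moreover have "proj_point u \<in> mspace D" "proj_point v \<in> mspace D" using uc v ms by auto
    ultimately show "mdist D (proj_point u) (proj_point v) < \<epsilon>"
      using mdist_triangle[of "proj_point u" D L "proj_point v"] mdist_commute[of D L "proj_point u"] by simp
  qed (use e in simp)
qed

theorem Oka_manifold_RM: "Oka_manifold RM"
  unfolding Oka_manifold_def
proof (intro conjI allI impI complex_manifold_RM)
  fix N :: nat and K U f and D :: "(nat \<Rightarrow> complex) set metric" and \<epsilon> :: real
  assume "compactin (Ctop N) K \<and> Cconvex K"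
    and "openin (Ctop N) U \<and> K \<subseteq> U \<and> holomorphic_map (open_submanifold (complex_space N) U) RM f"
    and D: "mtopology_of D = cm_top RM" and \<epsilon>: "\<epsilon> > 0"
  then have cK: "compact K" and KC: "K \<subseteq> Cset N" and conv: "Cconvex K" and U: "openin (Ctop N) U" and KU: "K \<subseteq> U"
    and f: "holomorphic_map (open_submanifold (complex_space N) U) RM f"
    by (auto simp: Ctop_def compactin_subtopology)
  show "\<exists>g. holomorphic_map (complex_space N) RM g \<and> (\<forall>z\<in>K. mdist D (f z) (g z) < \<epsilon>)"
  proof (cases "K = {}")
    case True
    obtain v where "v \<in> map_cone" using cone_nonempty by blast
    then have "holomorphic_map (complex_space N) RM (\<lambda>z. proj_point v)"
      by (intro holomorphic_map_proj_point) auto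
    then show ?thesis using True by blast
  next
    case False
    then obtain z0 where z0: "z0 \<in> K" by blast
    have z0C: "z0 \<in> Cset N" using z0 KC by auto
    \<comment> \<open>translate so that \<open>K\<close> becomes starlike around the origin\<close>
    define H where "H = (\<lambda>z i. z0 i + (z i :: complex))"
    have HC: "H z \<in> Cset N" if "z \<in> Cset N" for z using that z0C by (simp add: H_def Cset_def)
    have Hhol: "hol_fun n S (\<lambda>z. H z i)" for n S i unfolding H_def by (intro hol_fun_intros)
    define H' where "H' = (\<lambda>z i. (z i :: complex) - z0 i)"
    have H'C: "H' z \<in> Cset N" if "z \<in> Cset N" for z using that z0C by (simp add: H'_def Cset_def)
    have H'hol: "hol_fun n S (\<lambda>z. H' z i)" for n S i unfolding H'_def by (intro hol_fun_intros)
    have HH': "H (H' z) = z" for z by (simp add: H_def H'_def)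
    define K' where "K' = H' ` K"
    have cK': "compact K'" unfolding K'_def
      by (rule compact_continuous_image[OF _ cK])
        (intro continuous_on_coordinatewise_then_product hol_fun_cont[where n = 0] H'hol)
    define U' where "U' = {z \<in> Cset N. H z \<in> U}"
    have U': "openin (Ctop N) U'" unfolding U'_def
      by (rule openin_Ctop_preimage[OF openin_Ctop_UNIV U hol_fun_cont[where n = 0]]) (auto intro: Hhol HC)
    have KU': "K' \<subseteq> U'" using KU KC H'C HH' by (auto simp: K'_def U'_def)
    have star: "cscale (complex_of_real t) z \<in> K'" if z: "z \<in> K'" and t: "0 \<le> t" "t \<le> 1" for z t
    proof -
      obtain w where w: "w \<in> K" "z = H' w" using z by (auto simp: K'_def)
      have "(\<lambda>i. of_real (1 - t) * z0 i + of_real t * w i) \<in> K"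
        using conv z0 w(1) t unfolding Cconvex_def by blast
      moreover have "cscale (complex_of_real t) z = H' (\<lambda>i. of_real (1 - t) * z0 i + of_real t * w i)"
        by (auto simp: w(2) H'_def algebra_simps)
      ultimately show ?thesis unfolding K'_def by blast
    qed
    have ne: "K' \<noteq> {}" using False by (simp add: K'_def)
    have lf: "locally_lifts N U' (\<lambda>z. f (H z))"
      by (rule locally_lifts_compose[OF holomorphic_map_locally_lifts[OF U f] U' Hhol _ openin_Ctop_subset[OF U]])
        (simp add: U'_def)
    have "\<exists>V F. openin (Ctop N) V \<and> K' \<subseteq> V \<and> (\<forall>i. hol_fun N V (\<lambda>z. F z i)) \<and>
      (\<forall>z\<in>V. F z \<in> map_cone \<and> f (H z) = proj_point (F z))"
      by (rule global_lift[OF lf cK' KU' U' _ ne]) (rule star)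
    then obtain V F where "openin (Ctop N) V \<and> K' \<subseteq> V \<and> (\<forall>i. hol_fun N V (\<lambda>z. F z i)) \<and>
      (\<forall>z\<in>V. F z \<in> map_cone \<and> f (H z) = proj_point (F z))"
      by (elim exE) (rule that)
    then have V: "openin (Ctop N) V" "K' \<subseteq> V" and F: "\<And>i. hol_fun N V (\<lambda>z. F z i)"
      "\<And>z. z \<in> V \<Longrightarrow> F z \<in> map_cone" "\<And>z. z \<in> V \<Longrightarrow> f (H z) = proj_point (F z)" by blast+
    have Fcont: "continuous_on V F"
      by (rule continuous_into_Cset[where m = 8]) (auto intro: cone_Cset F hol_fun_cont)
    have "compact (F ` K')" by (rule compact_continuous_image[OF continuous_on_subset[OF Fcont V(2)] cK'])
    moreover have "F ` K' \<subseteq> map_cone" using F(2) V(2) by auto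
    ultimately obtain \<eta> where \<eta>: "\<eta> > 0"
      "\<And>u v. u \<in> F ` K' \<Longrightarrow> v \<in> map_cone \<Longrightarrow> (\<And>j. j < 8 \<Longrightarrow> cmod (v j - u j) \<le> \<eta>) \<Longrightarrow>
         mdist D (proj_point u) (proj_point v) < \<epsilon>"
      using mdist_proj_point_uniform[OF D _ _ \<epsilon>] by metis
    have "\<exists>G. (\<forall>i. hol_fun N (Cset N) (\<lambda>z. G z i)) \<and> (\<forall>z\<in>Cset N. G z \<in> map_cone) \<and>
      (\<forall>z\<in>K'. \<forall>j<8. cmod (G z j - F z j) \<le> \<eta>)"
      by (rule approximation_in_cone[OF cK' V(2) V(1) F(1) F(2) _ ne \<eta>(1)]) (auto intro: star)
    then obtain G where "(\<forall>i. hol_fun N (Cset N) (\<lambda>z. G z i)) \<and> (\<forall>z\<in>Cset N. G z \<in> map_cone) \<and>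
      (\<forall>z\<in>K'. \<forall>j<8. cmod (G z j - F z j) \<le> \<eta>)"
      by (elim exE) (rule that)
    then have G: "\<And>i. hol_fun N (Cset N) (\<lambda>z. G z i)" "\<And>z. z \<in> Cset N \<Longrightarrow> G z \<in> map_cone"
      "\<And>z j. z \<in> K' \<Longrightarrow> j < 8 \<Longrightarrow> cmod (G z j - F z j) \<le> \<eta>" by blast+
    show ?thesis
    proof (intro exI[of _ "\<lambda>z. proj_point (G (H' z))"] conjI ballI)
      show "holomorphic_map (complex_space N) RM (\<lambda>z. proj_point (G (H' z)))"
        by (intro holomorphic_map_proj_point hol_fun_compose[OF openin_Ctop_UNIV openin_Ctop_UNIV G(1) H'hol H'C])
          (auto intro: G H'C)
      fix z assume z: "z \<in> K"
      then have zK': "H' z \<in> K'" by (simp add: K'_def)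
      have "f z = proj_point (F (H' z))" using F(3)[of "H' z"] V(2) zK' HH' by auto
      moreover have "G (H' z) \<in> map_cone" using G(2) H'C KC z by blast
      ultimately show "mdist D (f z) (proj_point (G (H' z))) < \<epsilon>"
        using \<eta>(2)[of "F (H' z)" "G (H' z)"] G(3)[OF zK'] zK' by auto
    qed
  qed
qed

theorem theorem1p3:
  shows "holomorphically_elliptic (rational_map_space 3) \<and> Oka_manifold (rational_map_space 3)"
  unfolding holomorphically_elliptic_def
  by (intro conjI exI complex_manifold_RM Oka_manifold_RM) (rule dominating_spray_RM)


end
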